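(* There is an absolute constant $C>0$ such that the following holds. Let $\{X_i: i\in\mathcal V\}$ be a family of real-valued random variables with $\mathbb{E}X_i=0$, indexed by the vertices of a (finite, simple) dependency graph $\mathcal G=(\mathcal V,\mathcal E)$ with maximal degree $d\ge1$. Let $S=\sum_{i\in\mathcal V}X_i$, $\sigma^2=\mathrm{Var}(S)\in(0,\infty)$, let $A_i$ be the set consisting of $i$ and all vertices joined to $i$ by an edge, $Y_i=\sum_{j\in A_i}X_j$, and $$V=\sqrt{\Big(\sum_{i\in\mathcal V}(X_iY_i-\bar X\bar Y)\Big)_+},\qquad \bar X=\frac1{|\mathcal V|}\sum_{i\in\mathcal V}X_i,\quad \bar Y=\frac1{|\mathcal V|}\sum_{i\in\mathcal V}Y_i .$$ Put $W_1=S/\sigma$ and $W_2=S/V$. Then $$\sup_{z\in\mathbb{R}}|\mathbb{P}(W_1\le z)-\Phi(z)|\le Cd^2\sum_{i\in\mathcal V}\frac{\|X_i\|_4^3}{\sigma^3}+Cd^{3/2}\Big(\sum_{i\in\mathcal V}\frac{\|X_i\|_4^4}{\sigma^4}\Big)^{1/2}$$ and $$\sup_{z\in\mathbb{R}}|\mathbb{P}(W_2\le z)-\Phi(z)|\le C\lambda_1\Big(d^2\sum_{i\in\mathcal V}\frac{\|X_i\|_4^3}{\sigma^3}+d^{3/2}\Big(\sum_{i\in\mathcal V}\frac{\|X_i\|_4^4}{\sigma^4}\Big)^{1/2}\Big),$$ where $\lambda_1=d\sum_{i\in\mathcal V}\mathbb{E}|X_i|^2/\sigma^2$.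
   Context: A graph $\mathcal G=(\mathcal V,\mathcal E)$ is a dependency graph for $\{X_i:i\in\mathcal V\}$ if for any two disjoint subsets $\Gamma_1,\Gamma_2\subseteq\mathcal V$ such that no edge in $\mathcal E$ connects a vertex of $\Gamma_1$ with a vertex of $\Gamma_2$, the collections $\{X_i:i\in\Gamma_1\}$ and $\{X_i:i\in\Gamma_2\}$ are independent. $\Phi$ is the standard normal distribution function, $(x)_+=\max(x,0)$, $\|X\|_p=(\mathbb{E}|X|^p)^{1/p}$. On the event $\{V=0\}$ the value of $W_2$ may be fixed by any convention. *)

theory Defs
  imports "HOL-Probability.Probability"
begin

definition finite_simple_graph :: "'v set \<Rightarrow> 'v set set \<Rightarrow> bool" where
  "finite_simple_graph V E \<longleftrightarrow> finite V \<and> (\<forall>e\<in>E. e \<subseteq> V \<and> card e = 2)"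

definition neighbours :: "'v set \<Rightarrow> 'v set set \<Rightarrow> 'v \<Rightarrow> 'v set" where
  "neighbours V E i = {j \<in> V. {i, j} \<in> E}"

definition max_degree :: "'v set \<Rightarrow> 'v set set \<Rightarrow> nat" where
  "max_degree V E = Max ((\<lambda>i. card (neighbours V E i)) ` V)"

definition dependency_graph ::
    "'a measure \<Rightarrow> 'v set \<Rightarrow> 'v set set \<Rightarrow> ('v \<Rightarrow> 'a \<Rightarrow> real) \<Rightarrow> bool" where
  "dependency_graph M V E X \<longleftrightarrow>
     finite_simple_graph V E \<and>
     (\<forall>\<Gamma>\<^sub>1 \<Gamma>\<^sub>2. \<Gamma>\<^sub>1 \<subseteq> V \<longrightarrow> \<Gamma>\<^sub>2 \<subseteq> V \<longrightarrow> \<Gamma>\<^sub>1 \<inter> \<Gamma>\<^sub>2 = {} \<longrightarrow>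
        (\<forall>i\<in>\<Gamma>\<^sub>1. \<forall>j\<in>\<Gamma>\<^sub>2. {i, j} \<notin> E) \<longrightarrow>
        prob_space.indep_var M
          (Pi\<^sub>M \<Gamma>\<^sub>1 (\<lambda>_. borel)) (\<lambda>\<omega>. \<lambda>i\<in>\<Gamma>\<^sub>1. X i \<omega>)
          (Pi\<^sub>M \<Gamma>\<^sub>2 (\<lambda>_. borel)) (\<lambda>\<omega>. \<lambda>i\<in>\<Gamma>\<^sub>2. X i \<omega>))"

definition total_sum :: "'v set \<Rightarrow> ('v \<Rightarrow> 'a \<Rightarrow> real) \<Rightarrow> 'a \<Rightarrow> real" where
  "total_sum V X \<omega> = (\<Sum>i\<in>V. X i \<omega>)"

definition local_sum :: "'v set \<Rightarrow> 'v set set \<Rightarrow> ('v \<Rightarrow> 'a \<Rightarrow> real) \<Rightarrow> 'v \<Rightarrow> 'a \<Rightarrow> real" where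
  "local_sum V E X i \<omega> = (\<Sum>j\<in>insert i (neighbours V E i). X j \<omega>)"

definition vertex_mean :: "'v set \<Rightarrow> ('v \<Rightarrow> 'a \<Rightarrow> real) \<Rightarrow> 'a \<Rightarrow> real" where
  "vertex_mean V Z \<omega> = (\<Sum>i\<in>V. Z i \<omega>) / real (card V)"

definition self_normalizer :: "'v set \<Rightarrow> 'v set set \<Rightarrow> ('v \<Rightarrow> 'a \<Rightarrow> real) \<Rightarrow> 'a \<Rightarrow> real" where
  "self_normalizer V E X \<omega> =
     sqrt (max (\<Sum>i\<in>V. X i \<omega> * local_sum V E X i \<omega>
                  - vertex_mean V X \<omega> * vertex_mean V (local_sum V E X) \<omega>) 0)"

definition sd :: "'a measure \<Rightarrow> ('a \<Rightarrow> real) \<Rightarrow> real" where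
  "sd M Z = sqrt (prob_space.variance M Z)"

text \<open>
  Integrability of the square is needed for the variance to be the mathematical one, since
  a non-integrable function has Bochner integral 0. Moments of the single variables need not
  be finite beyond the first one.
\<close>

locale centred_dependent_sum = prob_space M
  for M :: "'a measure" +
  fixes V :: "'v set" and E :: "'v set set" and X :: "'v \<Rightarrow> 'a \<Rightarrow> real"
  assumes dependency_graph: "dependency_graph M V E X"
    and max_degree: "1 \<le> max_degree V E"
    and integrable: "\<And>i. i \<in> V \<Longrightarrow> integrable M (X i)"
    and centred: "\<And>i. i \<in> V \<Longrightarrow> expectation (X i) = 0"
    and square_integrable: "integrable M (\<lambda>\<omega>. (total_sum V X \<omega>)\<^sup>2)"
    and variance_pos: "0 < variance (total_sum V X)"

text \<open>
  A version of \<open>S / V\<close>: any random variable that equals the quotient off the event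
  that the self-normalizer vanishes, whatever its values on that event.
\<close>

definition self_normalized ::
    "'a measure \<Rightarrow> 'v set \<Rightarrow> 'v set set \<Rightarrow> ('v \<Rightarrow> 'a \<Rightarrow> real) \<Rightarrow> ('a \<Rightarrow> real) \<Rightarrow> bool" where
  "self_normalized M V E X W \<longleftrightarrow>
     W \<in> borel_measurable M \<and>
     (\<forall>\<omega>\<in>space M. self_normalizer V E X \<omega> \<noteq> 0 \<longrightarrow>
        W \<omega> = total_sum V X \<omega> / self_normalizer V E X \<omega>)"

definition kolmogorov_distance :: "'a measure \<Rightarrow> ('a \<Rightarrow> real) \<Rightarrow> ennreal" where
  "kolmogorov_distance M W =
     (SUP z. ennreal \<bar>measure M {\<omega> \<in> space M. W \<omega> \<le> z} - cdf std_normal_distribution z\<bar>)"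

text \<open>
  Norms are extended nonnegative, so that a bound involving an infinite fourth moment is the
  trivial one. The power function below is meant for exponents \<open>a > 0\<close>.
\<close>

definition ennreal_powr :: "ennreal \<Rightarrow> real \<Rightarrow> ennreal" where
  "ennreal_powr x a = (if x = \<infinity> then \<infinity> else ennreal (enn2real x powr a))"

definition Lp_norm :: "real \<Rightarrow> 'a measure \<Rightarrow> ('a \<Rightarrow> real) \<Rightarrow> ennreal" where
  "Lp_norm p M Z = ennreal_powr (\<integral>\<^sup>+\<omega>. ennreal (\<bar>Z \<omega>\<bar> powr p) \<partial>M) (1 / p)"

definition lambda1 ::
    "'a measure \<Rightarrow> 'v set \<Rightarrow> 'v set set \<Rightarrow> ('v \<Rightarrow> 'a \<Rightarrow> real) \<Rightarrow> ennreal" where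
  "lambda1 M V E X =
     of_nat (max_degree V E) * (\<Sum>i\<in>V. \<integral>\<^sup>+\<omega>. ennreal (\<bar>X i \<omega>\<bar>\<^sup>2) \<partial>M)
       / ennreal ((sd M (total_sum V X))\<^sup>2)"

definition normal_approximation_bound ::
    "real \<Rightarrow> 'a measure \<Rightarrow> 'v set \<Rightarrow> 'v set set \<Rightarrow> ('v \<Rightarrow> 'a \<Rightarrow> real) \<Rightarrow> bool" where
  "normal_approximation_bound C M V E X \<longleftrightarrow>
     (let d = max_degree V E; \<sigma> = sd M (total_sum V X) in
      kolmogorov_distance M (\<lambda>\<omega>. total_sum V X \<omega> / \<sigma>)
        \<le> ennreal C * of_nat d ^ 2 * (\<Sum>i\<in>V. Lp_norm 4 M (X i) ^ 3 / ennreal (\<sigma> ^ 3))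
          + ennreal C * ennreal (real d powr (3 / 2))
            * ennreal_powr (\<Sum>i\<in>V. Lp_norm 4 M (X i) ^ 4 / ennreal (\<sigma> ^ 4)) (1 / 2))"

definition self_normalized_bound ::
    "real \<Rightarrow> 'a measure \<Rightarrow> 'v set \<Rightarrow> 'v set set \<Rightarrow> ('v \<Rightarrow> 'a \<Rightarrow> real) \<Rightarrow> ('a \<Rightarrow> real) \<Rightarrow> bool" where
  "self_normalized_bound C M V E X W \<longleftrightarrow>
     (let d = max_degree V E; \<sigma> = sd M (total_sum V X) in
      kolmogorov_distance M W
        \<le> ennreal C * lambda1 M V E X
          * (of_nat d ^ 2 * (\<Sum>i\<in>V. Lp_norm 4 M (X i) ^ 3 / ennreal (\<sigma> ^ 3))
             + ennreal (real d powr (3 / 2))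
               * ennreal_powr (\<Sum>i\<in>V. Lp_norm 4 M (X i) ^ 4 / ennreal (\<sigma> ^ 4)) (1 / 2)))"

text \<open>
  HOL cannot quantify over types inside a formula, so in a theorem of the form
  "there is \<open>C\<close> such that for all \<open>M :: 'a measure\<close> and \<open>V :: 'v set\<close> ..." the constant
  could depend on \<open>'a\<close> and \<open>'v\<close>. An absolute constant is therefore chosen here once and
  for all, as one that works for one fixed pair of types (a finite family of real random
  variables has its joint law realised on \<open>nat \<Rightarrow> real\<close>); the theorem then asserts that this
  same number is positive and works for all types.
\<close>

definition absolute_constant :: real where
  "absolute_constant =
     (SOME C. 0 < C \<and>
        (\<forall>(M :: (nat \<Rightarrow> real) measure) (V :: nat set) E X.
           centred_dependent_sum M V E X \<longrightarrow>
             normal_approximation_bound C M V E X \<and>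
             (\<forall>W. self_normalized M V E X W \<longrightarrow> self_normalized_bound C M V E X W)))"

end

theory Submission
  imports Defs
begin

text \<open>
  Put \<open>\<xi>\<^sub>i = X\<^sub>i / \<sigma>\<close>, let \<open>A\<^sub>i\<close> be the closed neighbourhood of \<open>i\<close>, \<open>\<eta>\<^sub>i\<close> the sum of the \<open>\<xi>\<^sub>j\<close> with
  \<open>j \<in> A\<^sub>i\<close>, \<open>W\<close> the sum of all \<open>\<xi>\<^sub>i\<close>, and \<open>D = d + 1\<close>. All errors are measured by
  \<open>\<beta> = D\<^sup>2 \<Sum> \<parallel>\<xi>\<^sub>i\<parallel>\<^sup>3 + sqrt (D\<^sup>3 \<Sum> \<parallel>\<xi>\<^sub>i\<parallel>\<^sup>4)\<close> with norms in \<open>L\<^sub>4\<close>. Up to a constant factor this is the bound of the theorem.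

  Both parts are instances of one statement (\<open>kolmogorov_perturbed_sum\<close>) about \<open>U = W G\<close>: for the
  first part \<open>G = 1\<close>, for the second part \<open>G\<close> is a truncation of \<open>\<sigma> / V\<close>. Let \<open>f\<close> solve Stein's equation
  for a function \<open>h\<close> that falls linearly from 1 to 0 on an interval of length \<open>a\<close>. Let \<open>G'\<^sub>k\<close> be a version
  of \<open>G\<close> that depends only on the variables outside \<open>A\<^sub>k\<close>. As \<open>\<xi>\<^sub>k\<close> is centred and independent of those
  variables, \<open>E U f(U)\<close> is the sum over \<open>k\<close> of \<open>E \<xi>\<^sub>k (G f(U) - G'\<^sub>k f((W - \<eta>\<^sub>k) G'\<^sub>k))\<close>, and a first-order expansion of
  \<open>f\<close> at \<open>U\<close> produces \<open>E f'(U) G\<^sup>2 \<Sum> \<xi>\<^sub>k \<eta>\<^sub>k\<close>. The factor \<open>\<Sum> \<xi>\<^sub>k \<eta>\<^sub>k\<close> has mean 1 and variance of order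
  \<open>D\<^sup>3 \<Sum> \<parallel>\<xi>\<^sub>i\<parallel>\<^sup>4\<close> (\<open>pair_sum_variance\<close>), so that this term is close to \<open>E f'(U)\<close>. The second-order error
  of the smooth part of \<open>f'\<close> is at most a multiple of \<open>\<Sum> E \<bar>\<xi>\<^sub>k\<bar> \<eta>\<^sub>k\<^sup>2 (1 + \<bar>W\<bar>)\<close>, which Hoelder's inequality and
  a bound on the fourth moment of \<open>W\<close> (\<open>weighted_sum_fourth_moment\<close>) turn into \<open>D\<^sup>2 \<Sum> \<parallel>\<xi>\<^sub>i\<parallel>\<^sup>3\<close>.

  The essential point is the error caused by the steep part of \<open>h\<close>. At the index \<open>k\<close> it vanishes
  unless \<open>U\<close> is closer than about \<open>\<bar>\<eta>\<^sub>k\<bar>\<close> to the interval where \<open>h\<close> falls. The line is therefore divided into cells of width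
  \<open>a\<close> according to the distance from that interval. On the cell at distance about \<open>m a\<close>, the total error is
  at most a sum over pairs, \<open>R\<^sub>m = \<Sum>\<^sub>k \<Sum>\<^sub>j \<bar>\<xi>\<^sub>k\<bar> \<psi>\<^sub>m(\<bar>\<xi>\<^sub>j\<bar>)\<close> with \<open>j \<in> A\<^sub>k\<close>: the error is dominated by a convex function of \<open>\<bar>\<eta>\<^sub>k\<bar>\<close>, which
  splits along the summands of \<open>\<eta>\<^sub>k\<close>. Only pairs occur in \<open>R\<^sub>m\<close>, so its standard deviation is
  of order \<open>\<beta>\<close> by the same variance bound as before, and by the Cauchy-Schwarz inequality \<open>E R\<^sub>m 1(U in the cell)\<close>
  is at most \<open>E R\<^sub>m p + C \<beta> sqrt p\<close>, where \<open>p = 3 a + 4 \<delta>\<close> bounds the probability of the cell in terms of the unknown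
  Kolmogorov distance \<open>\<delta>\<close>. The means \<open>E R\<^sub>m\<close> add up to \<open>C \<beta> / a\<close>, and a number of cells of order
  \<open>1 / sqrt a\<close> suffices, because farther away the fourth moments alone give \<open>C \<beta>\<^sup>2 / a\<close>. The total is
  \<open>C \<beta> (1 + \<delta> / a)\<close>, and for \<open>a\<close> a large multiple of \<open>\<beta>\<close> the inequality can be solved for \<open>\<delta>\<close>.

  For the second part, \<open>V\<^sup>2\<close> is the positive part of \<open>\<sigma>\<^sup>2 (1 + \<Delta>)\<close> with a \<open>\<Delta>\<close> that is small in \<open>L\<^sub>1\<close>, and \<open>G = 1 / sqrt (1 + \<Delta>)\<close> where \<open>\<bar>\<Delta>\<bar> \<le> 1/2\<close>. Then \<open>G\<^sup>2 \<Sum> \<xi>\<^sub>k \<eta>\<^sub>k\<close> is again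
  close to 1. The cost of leaving \<open>A\<^sub>k\<close> out of \<open>\<Delta>\<close> brings in \<open>\<Lambda> = \<Sum>\<^sub>k \<Sum>\<^sub>j E \<bar>\<xi>\<^sub>k \<xi>\<^sub>j\<bar>\<close>, which is between 1 and \<open>2 \<lambda>\<^sub>1\<close>.

  These arguments work for families on any probability space and give one numerical constant. The constant of the
  theorem is defined by a choice among those that are valid for families on \<open>nat \<Rightarrow> real\<close>; the last section carries
  its validity back to all other families, since every quantity in the bounds depends on the joint law only.
\<close>

section \<open>Stein's equation for the normal law\<close>

lemma std_normal_density_has_derivative:
  "(std_normal_density has_real_derivative (- x * std_normal_density x)) (at x)"
  unfolding std_normal_density_def
  by (auto intro!: derivative_eq_intros simp: field_simps power2_eq_square)

lemma continuous_std_normal_density: "continuous_on S std_normal_density"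
  by (meson DERIV_isCont continuous_at_imp_continuous_on std_normal_density_has_derivative)

lemma integrable_std_normal_density: "integrable lborel std_normal_density"
  using integrable_std_normal_moment[of 0] by simp

lemma tendsto_std_normal_density_at_top: "(std_normal_density \<longlongrightarrow> 0) at_top"
proof -
  have "filterlim (\<lambda>x::real. x\<^sup>2 / 2) at_top at_top"
    by (rule filterlim_at_top_mono[OF filterlim_ident])
       (auto intro!: eventually_mono[OF eventually_ge_at_top[of 2]] simp: power2_eq_square)
  then have "((\<lambda>x::real. 1 / sqrt (2 * pi) * exp (- (x\<^sup>2 / 2))) \<longlongrightarrow> 1 / sqrt (2 * pi) * 0) at_top"
    by (intro tendsto_intros filterlim_compose[OF exp_at_bot]
          filterlim_compose[OF filterlim_uminus_at_bot_at_top])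
  then show ?thesis
    unfolding std_normal_density_def by simp
qed

text \<open>
  On the half-line, \<open>x / w \<ge> 1\<close>, and \<open>x \<mapsto> (x / w) \<cdot> density\<close> has an explicit antiderivative.
\<close>

lemma mills_ratio_upper:
  assumes "0 < w"
  shows "(LINT x:{w..}|lborel. std_normal_density x) \<le> std_normal_density w / w"
proof -
  let ?p = std_normal_density
  have deriv: "DERIV (\<lambda>x. - ?p x / w) x :> x / w * ?p x" for x
    using assms by (auto intro!: derivative_eq_intros std_normal_density_has_derivative)
  have lim: "((\<lambda>x. - ?p x / w) \<longlongrightarrow> 0) at_top"
    using tendsto_divide[OF tendsto_minus[OF tendsto_std_normal_density_at_top] tendsto_const, of w] assms
    by simp
  have "(\<integral>\<^sup>+x. ennreal (x / w * ?p x) * indicator {w..} x \<partial>lborel) = ennreal (0 - (- ?p w / w))"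
    by (rule nn_integral_FTC_atLeast[OF _ deriv _ lim]) (use assms in auto)
  moreover have "(\<integral>\<^sup>+x. ennreal (?p x) * indicator {w..} x \<partial>lborel)
     \<le> (\<integral>\<^sup>+x. ennreal (x / w * ?p x) * indicator {w..} x \<partial>lborel)"
  proof (rule nn_integral_mono)
    fix x
    show "ennreal (?p x) * indicator {w..} x \<le> ennreal (x / w * ?p x) * indicator {w..} x"
    proof (cases "w \<le> x")
      case True
      then have "1 * ?p x \<le> x / w * ?p x"
        using assms by (intro mult_right_mono) auto
      then show ?thesis by (simp add: ennreal_leI mult_right_mono)
    qed auto
  qed
  moreover have "ennreal (LINT x:{w..}|lborel. ?p x) = (\<integral>\<^sup>+x. ennreal (?p x) * indicator {w..} x \<partial>lborel)"
    unfolding set_lebesgue_integral_def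
    using integrable_mult_indicator[OF _ integrable_std_normal_density, of "{w..}"]
    by (subst nn_integral_eq_integral[symmetric])
       (auto intro!: nn_integral_cong simp: indicator_def)
  ultimately have "ennreal (LINT x:{w..}|lborel. ?p x) \<le> ennreal (?p w / w)"
    by simp
  then show ?thesis using assms by (subst (asm) ennreal_le_iff) auto
qed

lemma mills_ratio_lower:
  assumes "w < 0"
  shows "(LINT x:{..w}|lborel. std_normal_density x) \<le> std_normal_density w / \<bar>w\<bar>"
proof -
  have "(LINT x:{..w}|lborel. std_normal_density x) = (LINT x:{-w..}|lborel. std_normal_density x)"
    unfolding set_lebesgue_integral_def
    by (subst lborel_integral_real_affine[where c="-1" and t=0])
       (auto intro!: Bochner_Integration.integral_cong simp: indicator_def std_normal_density_def)
  with mills_ratio_upper[of "-w"] assms show ?thesis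
    by (simp add: std_normal_density_def)
qed

lemma std_normal_density_lower:
  assumes "\<bar>w\<bar> \<le> 1" shows "1 \<le> 6 * std_normal_density w"
proof -
  have "w\<^sup>2 \<le> 1" using assms by (simp add: abs_square_le_1)
  then have "1/2 \<le> exp (- w\<^sup>2 / 2)"
    using exp_ge_add_one_self[of "- w\<^sup>2 / 2"] by linarith
  moreover have "sqrt (2 * pi) \<le> 3"
  proof (rule real_le_lsqrt)
    show "2 * pi \<le> 3\<^sup>2" using pi_less_4 by (simp add: power2_eq_square)
  qed auto
  then have "1/3 \<le> 1 / sqrt (2 * pi)" by (simp add: field_simps)
  ultimately have "(1/3) * (1/2) \<le> std_normal_density w"
    unfolding std_normal_density_def by (intro mult_mono) auto
  then show ?thesis by simp
qed

text \<open>
  The solution is \<open>H\<close> divided by the normal density, where \<open>H w\<close> is the integral of \<open>h - N h\<close> against the normal law over \<open>{..w}\<close>. As the integrand has total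
  integral zero, \<open>H\<close> can be bounded by the normal mass of either half-line, and Mills' ratio controls the quotient; near
  the origin the density is bounded below. The value 6 is merely convenient.
\<close>

lemma stein_solution:
  fixes h :: "real \<Rightarrow> real"
  assumes cont: "continuous_on UNIV h" and h: "\<And>x. 0 \<le> h x" "\<And>x. h x \<le> 1"
  defines "Nh \<equiv> LINT x|std_normal_distribution. h x"
  obtains f where
    "\<And>w. (f has_real_derivative (w * f w + h w - Nh)) (at w)"
    "\<And>w. \<bar>f w\<bar> \<le> 6" "\<And>w. \<bar>w * f w\<bar> \<le> 6"
proof -
  let ?p = std_normal_density
  have [measurable]: "h \<in> borel_measurable borel"
    using cont by (rule borel_measurable_continuous_onI)
  have p_pos: "0 < ?p x" for x by (simp add: normal_density_pos)
  have intp: "integrable lborel ?p" by (rule integrable_std_normal_density)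
  have inthp: "integrable lborel (\<lambda>x. ?p x * h x)"
    by (rule Bochner_Integration.integrable_bound[OF intp])
       (use h in \<open>auto intro!: AE_I2 simp: abs_mult mult_left_le\<close>)
  have Nh: "Nh = (LINT x|lborel. ?p x * h x)"
    unfolding Nh_def by (subst integral_density) auto
  have p1: "(LINT x|lborel. ?p x) = 1"
    using integral_std_normal_moment_even[of 0] by simp
  have Nh01: "0 \<le> Nh" "Nh \<le> 1"
  proof -
    show "0 \<le> Nh" unfolding Nh by (intro Bochner_Integration.integral_nonneg) (use h in auto)
    have "Nh \<le> (LINT x|lborel. ?p x)" unfolding Nh
      by (intro integral_mono inthp intp) (use h in \<open>auto simp: mult_left_le\<close>)
    then show "Nh \<le> 1" using p1 by simp
  qed
  define q where "q x = (h x - Nh) * ?p x" for x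
  have intq: "integrable lborel q"
    unfolding q_def using inthp intp
    by (auto simp: algebra_simps)
  have q_total: "(LINT x|lborel. q x) = 0"
    unfolding q_def left_diff_distrib using inthp intp Nh p1 by (simp add: mult.commute)
  have absq: "\<bar>q x\<bar> \<le> ?p x" for x
  proof -
    have "\<bar>h x - Nh\<bar> \<le> 1" using h[of x] Nh01 by linarith
    then show ?thesis unfolding q_def by (simp add: abs_mult mult_left_le_one_le)
  qed
  have cq: "continuous_on S q" for S
    unfolding q_def using cont continuous_std_normal_density
    by (auto intro!: continuous_intros intro: continuous_on_subset)
  have [measurable]: "q \<in> borel_measurable borel"
    using cq[of UNIV] by (rule borel_measurable_continuous_onI)
  have sq: "set_integrable lborel S q" if "S \<in> sets borel" for S
    unfolding set_integrable_def using integrable_mult_indicator[OF _ intq] that by simp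
  have sp: "set_integrable lborel S ?p" if "S \<in> sets borel" for S
    unfolding set_integrable_def using integrable_mult_indicator[OF _ intp] that by simp
  define H where "H w = (LINT x:{..w}|lborel. q x)" for w
  have H': "H w = - (LINT x:{w..}|lborel. q x)" for w
  proof -
    have "(LINT x:{..w} \<union> {w<..}|lborel. q x) = H w + (LINT x:{w<..}|lborel. q x)"
      unfolding H_def by (intro set_integral_Un sq) auto
    moreover have "{..w} \<union> {w<..} = UNIV" by auto
    moreover have "(LINT x:{w<..}|lborel. q x) = (LINT x:{w..}|lborel. q x)"
      by (intro set_integral_cong_set)
         (auto simp: set_borel_measurable_def intro!: eventually_mono[OF AE_lborel_singleton[of w]])
    ultimately show ?thesis using q_total by (simp add: set_lebesgue_integral_def)
  qed
  have absH: "\<bar>LINT x:S|lborel. q x\<bar> \<le> (LINT x:S|lborel. ?p x)" if "S \<in> sets borel" for S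
  proof -
    have "\<bar>LINT x:S|lborel. q x\<bar> \<le> (LINT x:S|lborel. \<bar>q x\<bar>)"
      unfolding set_lebesgue_integral_def
      by (rule order_trans[OF integral_abs_bound]) (simp add: abs_mult)
    also have "\<dots> \<le> (LINT x:S|lborel. ?p x)"
      by (intro set_integral_mono set_integrable_abs sq sp that absq)
    finally show ?thesis .
  qed
  have dH: "(H has_real_derivative q w) (at w)" for w
  proof -
    let ?a = "w - 1" and ?b = "w + 1"
    have eq: "H u = H ?a + integral {?a..u} q" if "?a \<le> u" for u
    proof -
      have "(LINT x:{..?a} \<union> {?a<..u}|lborel. q x) = H ?a + (LINT x:{?a<..u}|lborel. q x)"
        unfolding H_def by (intro set_integral_Un sq) auto
      moreover have "{..?a} \<union> {?a<..u} = {..u}" using that by auto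
      moreover have "(LINT x:{?a<..u}|lborel. q x) = (LINT x:{?a..u}|lborel. q x)"
        by (intro set_integral_cong_set)
         (auto simp: set_borel_measurable_def intro!: eventually_mono[OF AE_lborel_singleton[of "?a"]])
      moreover have "(LINT x:{?a..u}|lborel. q x) = integral {?a..u} q"
        by (rule set_borel_integral_eq_integral) (intro sq, simp)
      ultimately show ?thesis by (simp add: H_def)
    qed
    have "((\<lambda>x. integral {?a..x} q) has_real_derivative q w) (at w within {?a..?b})"
      by (rule integral_has_real_derivative[OF cq]) auto
    then have "((\<lambda>x. integral {?a..x} q) has_real_derivative q w) (at w)"
      by (simp add: at_within_Icc_at)
    then have "((\<lambda>x. H ?a + integral {?a..x} q) has_real_derivative q w) (at w)"
      by (auto intro!: derivative_eq_intros)
    then show ?thesis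
      by (rule has_field_derivative_transform_within[where d=1])
         (auto simp: dist_real_def intro!: eq[symmetric])
  qed
  define f where "f w = H w / ?p w" for w
  have df: "(f has_real_derivative (w * f w + h w - Nh)) (at w)" for w
    unfolding f_def
    by (rule DERIV_cong[OF DERIV_divide[OF dH std_normal_density_has_derivative]])
       (use p_pos[of w] in \<open>auto simp: q_def field_simps power2_eq_square\<close>)
  have big: "\<bar>f w\<bar> \<le> 1 / \<bar>w\<bar>" if "w \<noteq> 0" for w
  proof -
    have "\<bar>H w\<bar> \<le> ?p w / \<bar>w\<bar>"
    proof (cases "w < 0")
      case True
      then show ?thesis using absH[of "{..w}"] mills_ratio_lower[of w] unfolding H_def by simp
    next
      case False
      then show ?thesis using absH[of "{w..}"] mills_ratio_upper[of w] that unfolding H' by simp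
    qed
    then show ?thesis unfolding f_def using p_pos[of w] by (simp add: field_simps)
  qed
  have small: "\<bar>f w\<bar> \<le> 6" if "\<bar>w\<bar> \<le> 1" for w
  proof -
    have "\<bar>H w\<bar> \<le> (LINT x:{..w}|lborel. ?p x)" unfolding H_def by (intro absH) auto
    also have "\<dots> \<le> (LINT x|lborel. ?p x)"
      unfolding set_lebesgue_integral_def
      by (intro integral_mono intp sp[unfolded set_integrable_def]) (auto simp: indicator_def)
    finally have "\<bar>H w\<bar> \<le> 6 * ?p w" using p1 std_normal_density_lower[OF that] by simp
    then show ?thesis unfolding f_def using p_pos[of w] by (simp add: field_simps)
  qed
  show thesis
  proof
    show "(f has_real_derivative (w * f w + h w - Nh)) (at w)" for w by (rule df)
    show "\<bar>f w\<bar> \<le> 6" for w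
    proof (cases "\<bar>w\<bar> \<le> 1")
      case False
      then have "1 / \<bar>w\<bar> \<le> 1" by simp
      then show ?thesis using big[of w] False by linarith
    qed (rule small)
    show "\<bar>w * f w\<bar> \<le> 6" for w
    proof (cases "w = 0")
      case False
      then show ?thesis using big[of w] by (simp add: abs_mult field_simps)
    qed simp
  qed
qed

section \<open>Smoothed indicators\<close>

text \<open>
  The smoothed indicator of \<open>{..z}\<close> used below is \<open>1 - ramp a z\<close>: it is 1 up to \<open>z\<close> and 0 from \<open>z + a\<close> on. Its
  antiderivative is kept in closed form, so that the expansion errors need no integrals.
\<close>

definition ramp :: "real \<Rightarrow> real \<Rightarrow> real \<Rightarrow> real" where
  "ramp a z x = (max (x - z) 0 - max (x - z - a) 0) / a"

definition ramp_integral :: "real \<Rightarrow> real \<Rightarrow> real \<Rightarrow> real" where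
  "ramp_integral a z x = ((max (x - z) 0)\<^sup>2 - (max (x - z - a) 0)\<^sup>2) / (2 * a)"

text \<open>
  The positive part squared is convex, and its derivative is Lipschitz with constant 2.
\<close>

lemma positive_part_square_expansion:
  fixes x y :: real
  shows "0 \<le> (max y 0)\<^sup>2 - (max x 0)\<^sup>2 - 2 * max x 0 * (y - x)"
    and "(max y 0)\<^sup>2 - (max x 0)\<^sup>2 - 2 * max x 0 * (y - x) \<le> (y - x)\<^sup>2"
proof -
  have p: "0 \<le> (y - x)\<^sup>2" "0 \<le> y\<^sup>2" "0 \<le> x\<^sup>2" by auto
  consider "0 \<le> x" "0 \<le> y" | "0 \<le> x" "y < 0" | "x < 0" "0 \<le> y" | "x < 0" "y < 0" by linarith
  then show "0 \<le> (max y 0)\<^sup>2 - (max x 0)\<^sup>2 - 2 * max x 0 * (y - x)"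
  proof cases
    case 1 then show ?thesis using p by (simp add: max_def power2_eq_square algebra_simps)
  next
    case 2
    then have "(max y 0)\<^sup>2 - (max x 0)\<^sup>2 - 2 * max x 0 * (y - x) = x * x + 2 * (x * (- y))"
      by (simp add: max_def power2_eq_square algebra_simps)
    moreover have "0 \<le> x * (- y)" using 2 by (intro mult_nonneg_nonneg) auto
    moreover have "0 \<le> x * x" by simp
    ultimately show ?thesis by linarith
  qed (use p in \<open>simp_all add: max_def\<close>)
  consider "0 \<le> x" "0 \<le> y" | "0 \<le> x" "y < 0" | "x < 0" "0 \<le> y" | "x < 0" "y < 0" by linarith
  then show "(max y 0)\<^sup>2 - (max x 0)\<^sup>2 - 2 * max x 0 * (y - x) \<le> (y - x)\<^sup>2"
  proof cases
    case 3
    then have "x * (y * 2) \<le> 0" "x * y \<le> 0" by (simp_all add: mult_nonpos_nonneg)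
    then show ?thesis using 3 p by (simp add: max_def power2_eq_square algebra_simps)
  qed (use p in \<open>auto simp: max_def power2_eq_square algebra_simps\<close>)
qed

lemma ramp_bounds:
  assumes "0 < a" shows "0 \<le> ramp a z x" "ramp a z x \<le> 1"
  using assms by (auto simp: ramp_def field_simps)

lemma continuous_ramp: "continuous_on S (ramp a z)"
  unfolding ramp_def divide_inverse by (intro continuous_intros)

lemma ramp_integral_expansion:
  assumes "0 < a"
  shows "\<bar>ramp_integral a z y - ramp_integral a z x - ramp a z x * (y - x)\<bar> \<le> (y - x)\<^sup>2 / (2 * a)"
proof -
  let ?e = "\<lambda>c. (max (y - c) 0)\<^sup>2 - (max (x - c) 0)\<^sup>2 - 2 * max (x - c) 0 * (y - x)"
  have e: "0 \<le> ?e c" "?e c \<le> (y - x)\<^sup>2" for c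
    using positive_part_square_expansion[of "y - c" "x - c"] by auto
  have "ramp_integral a z y - ramp_integral a z x - ramp a z x * (y - x) = (?e z - ?e (z + a)) / (2 * a)"
    using assms unfolding ramp_def ramp_integral_def by (simp add: field_simps)
  then have "\<bar>ramp_integral a z y - ramp_integral a z x - ramp a z x * (y - x)\<bar> = \<bar>?e z - ?e (z + a)\<bar> / (2 * a)"
    using assms by (simp only: abs_divide) simp
  also have "\<bar>?e z - ?e (z + a)\<bar> \<le> (y - x)\<^sup>2"
    using e[of z] e[of "z + a"] by linarith
  finally show ?thesis using assms by (simp add: divide_right_mono)
qed

lemma quadratic_remainder_imp_derivative:
  fixes F :: "real \<Rightarrow> real"
  assumes "\<And>y. \<bar>F y - F x - D * (y - x)\<bar> \<le> L * (y - x)\<^sup>2"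
  shows "(F has_real_derivative D) (at x)"
proof -
  have "((\<lambda>h. (F (x + h) - F x) / h - D) \<longlongrightarrow> 0) (at 0)"
  proof (rule Lim_null_comparison)
    show "\<forall>\<^sub>F h in at 0. norm ((F (x + h) - F x) / h - D) \<le> \<bar>L\<bar> * \<bar>h\<bar>"
    proof -
      have "norm ((F (x + h) - F x) / h - D) \<le> \<bar>L\<bar> * \<bar>h\<bar>" if "h \<noteq> 0" for h :: real
      proof -
      have "\<bar>F (x + h) - F x - D * h\<bar> \<le> \<bar>L\<bar> * h\<^sup>2"
        using assms[of "x + h"] by (smt (verit) mult_right_mono zero_le_power2)
      then have "\<bar>F (x + h) - F x - D * h\<bar> / \<bar>h\<bar> \<le> \<bar>L\<bar> * h\<^sup>2 / \<bar>h\<bar>"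
        by (intro divide_right_mono) auto
      moreover have "\<bar>L\<bar> * h\<^sup>2 / \<bar>h\<bar> = \<bar>L\<bar> * \<bar>h\<bar>"
        using \<open>h \<noteq> 0\<close> by (simp add: power2_eq_square field_simps abs_if)
      moreover have "\<bar>F (x + h) - F x - D * h\<bar> / \<bar>h\<bar> = \<bar>(F (x + h) - F x) / h - D\<bar>"
        using \<open>h \<noteq> 0\<close> by (simp add: abs_divide[symmetric] field_simps del: abs_divide)
      ultimately show "norm ((F (x + h) - F x) / h - D) \<le> \<bar>L\<bar> * \<bar>h\<bar>" by simp
      qed
      then show ?thesis unfolding eventually_at by (intro exI[of _ 1]) auto
    qed
    show "((\<lambda>h::real. \<bar>L\<bar> * \<bar>h\<bar>) \<longlongrightarrow> 0) (at 0)"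
      by (auto intro!: tendsto_eq_intros)
  qed
  then show ?thesis unfolding DERIV_def by (rule LIM_zero_cancel)
qed

lemma ramp_integral_has_derivative:
  assumes "0 < a" shows "(ramp_integral a z has_real_derivative ramp a z x) (at x)"
  by (rule quadratic_remainder_imp_derivative[where L = "1 / (2 * a)"])
     (use ramp_integral_expansion[OF assms] in simp)

lemma ramp_integral_increment:
  assumes "0 < a" "x \<le> y"
  shows "0 \<le> ramp_integral a z y - ramp_integral a z x"
    and "ramp_integral a z y - ramp_integral a z x \<le> y - x"
proof -
  have "ramp_integral a z x \<le> ramp_integral a z y"
    by (rule DERIV_nonneg_imp_nondecreasing[OF assms(2)])
       (use ramp_integral_has_derivative[OF assms(1)] ramp_bounds[OF assms(1)] in blast)
  then show "0 \<le> ramp_integral a z y - ramp_integral a z x" by simp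
  have "(\<lambda>u. u - ramp_integral a z u) x \<le> (\<lambda>u. u - ramp_integral a z u) y"
  proof (rule DERIV_nonneg_imp_nondecreasing[OF assms(2)])
    fix u
    show "\<exists>d. ((\<lambda>u. u - ramp_integral a z u) has_real_derivative d) (at u) \<and> 0 \<le> d"
      using ramp_bounds[OF assms(1), of z u]
      by (intro exI[of _ "1 - ramp a z u"])
         (auto intro!: derivative_eq_intros ramp_integral_has_derivative assms)
  qed
  then show "ramp_integral a z y - ramp_integral a z x \<le> y - x" by simp
qed

text \<open>
  The distance of \<open>x\<close> from the interval \<open>{z..z + a}\<close> on which the ramp rises.
\<close>

definition ramp_gap :: "real \<Rightarrow> real \<Rightarrow> real \<Rightarrow> real" where
  "ramp_gap a z x = max (max (z - x) (x - z - a)) 0"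

definition ramp_error :: "real \<Rightarrow> real \<Rightarrow> real \<Rightarrow> real \<Rightarrow> real" where
  "ramp_error a z x t = ramp_integral a z x - ramp_integral a z (x - t) - t * ramp a z x"

lemma ramp_error_le_linear:
  assumes "0 < a" shows "\<bar>ramp_error a z x t\<bar> \<le> \<bar>t\<bar>"
proof (cases "0 \<le> t")
  case True
  have "0 \<le> t * ramp a z x" "t * ramp a z x \<le> t"
    using ramp_bounds[OF assms, of z x] True by (auto simp: mult_left_le)
  then show ?thesis
    using ramp_integral_increment[OF assms, of "x - t" x z] True by (simp add: ramp_error_def)
next
  case False
  have "t * ramp a z x \<le> 0" "t \<le> t * ramp a z x"
    using ramp_bounds[OF assms, of z x] False mult_left_mono_neg[of "ramp a z x" 1 t]
    by (auto simp: mult_nonpos_nonneg)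
  then show ?thesis
    using ramp_integral_increment[OF assms, of x "x - t" z] False
    unfolding ramp_error_def by linarith
qed

lemma ramp_error_le_quadratic:
  assumes "0 < a" shows "\<bar>ramp_error a z x t\<bar> \<le> t\<^sup>2 / (2 * a)"
  using ramp_integral_expansion[OF assms, of z "x - t" x]
  by (simp add: ramp_error_def abs_minus_commute mult.commute)

text \<open>
  On either side of the rising interval the ramp is constant and its antiderivative affine, so the error starts only
  after the step \<open>t\<close> has crossed the gap; from there it grows at most linearly.
\<close>

lemma ramp_error_le_gap:
  assumes "0 < a" shows "\<bar>ramp_error a z x t\<bar> \<le> max (\<bar>t\<bar> - ramp_gap a z x) 0"
proof -
  consider "ramp_gap a z x = 0" | "x < z" | "z + a < x"
    unfolding ramp_gap_def by linarith
  then show ?thesis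
  proof cases
    case 1
    then show ?thesis using ramp_error_le_linear[OF assms] by simp
  next
    case 2
    then have r: "ramp a z x = 0" "ramp_integral a z z = 0" "ramp_integral a z x = 0"
      using assms by (auto simp: ramp_def ramp_integral_def)
    have g: "ramp_gap a z x = z - x" using 2 assms by (simp add: ramp_gap_def)
    show ?thesis
    proof (cases "x - t \<le> z")
      case True
      then have "ramp_integral a z (x - t) = 0" using assms by (simp add: ramp_integral_def)
      then show ?thesis by (simp add: ramp_error_def r)
    next
      case False
      then show ?thesis using ramp_integral_increment[OF assms, of z "x - t" z] r g 2
        by (simp add: ramp_error_def)
    qed
  next
    case 3
    have *: "ramp_integral a z y = y - z - a / 2" if "z + a \<le> y" for y
      using that assms by (simp add: ramp_integral_def field_simps power2_eq_square)
    have r: "ramp a z x = 1"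
      using assms 3 by (simp add: ramp_def)
    have g: "ramp_gap a z x = x - z - a" using 3 assms by (simp add: ramp_gap_def)
    show ?thesis
    proof (cases "z + a \<le> x - t")
      case True
      then show ?thesis using *[of x] *[of "x - t"] 3 by (simp add: ramp_error_def r)
    next
      case False
      then show ?thesis using ramp_integral_increment[OF assms, of "x - t" "z + a" z] r g 3 *[of x] *[of "z + a"]
        by (simp add: ramp_error_def)
    qed
  qed
qed

definition ramp_cell :: "real \<Rightarrow> real \<Rightarrow> nat \<Rightarrow> real set" where
  "ramp_cell a z m = {x. real m * a \<le> ramp_gap a z x \<and> ramp_gap a z x < real (Suc m) * a}"

text \<open>
  The cell number \<open>m\<close> collects the points at distance between \<open>m a\<close> and \<open>(m + 1) a\<close>. In the cell 0 the linear bound \<open>b\<close> would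
  be too weak for small steps; the quadratic bound is what makes the means of all cells add up to order \<open>b\<^sup>2 / a\<close>.
\<close>

definition cell_weight :: "real \<Rightarrow> nat \<Rightarrow> real \<Rightarrow> real" where
  "cell_weight a m b = (if m = 0 then min b (b\<^sup>2 / (2 * a)) else max (b - real m * a) 0)"

lemma ramp_error_le_cells:
  assumes a: "0 < a" and b: "\<bar>t\<bar> \<le> b"
  shows "\<bar>ramp_error a z x t\<bar>
    \<le> (\<Sum>m<M. indicator (ramp_cell a z m) x * cell_weight a m b) + max (b - real M * a) 0"
proof -
  let ?g = "ramp_gap a z x"
  have b0: "0 \<le> b" using b by linarith
  have g0: "0 \<le> ?g" by (simp add: ramp_gap_def)
  have w0: "0 \<le> cell_weight a m b" for m using b0 a by (auto simp: cell_weight_def)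
  (* the number of the cell that contains x *)
  define m where "m = nat \<lfloor>?g / a\<rfloor>"
  have m: "real m * a \<le> ?g" "?g < real (Suc m) * a"
  proof -
    have "real m \<le> ?g / a" "?g / a < real m + 1"
      using g0 a unfolding m_def by (simp_all add: of_nat_nat)
    then show "real m * a \<le> ?g" "?g < real (Suc m) * a" using a by (auto simp: field_simps)
  qed
  show ?thesis
  proof (cases "m < M")
    case True
    have "\<bar>ramp_error a z x t\<bar> \<le> cell_weight a m b"
    proof (cases "m = 0")
      case True
      have "t\<^sup>2 \<le> b\<^sup>2" using power_mono[OF b, of 2] by simp
      then have "t\<^sup>2 / (2 * a) \<le> b\<^sup>2 / (2 * a)" using a by (intro divide_right_mono) auto
      then show ?thesis
        using ramp_error_le_linear[OF a, of z x t] ramp_error_le_quadratic[OF a, of z x t] b True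
        by (simp add: cell_weight_def)
    next
      case False
      then show ?thesis using ramp_error_le_gap[OF a, of z x t] m b by (simp add: cell_weight_def)
    qed
    also have "\<dots> = indicator (ramp_cell a z m) x * cell_weight a m b"
      using m by (simp add: ramp_cell_def)
    also have "\<dots> \<le> (\<Sum>m<M. indicator (ramp_cell a z m) x * cell_weight a m b)"
      by (rule member_le_sum) (use True w0 in auto)
    finally show ?thesis by simp
  next
    case False
    then have "real M * a \<le> real m * a" using a by simp
    then have "\<bar>ramp_error a z x t\<bar> \<le> max (b - real M * a) 0"
      using ramp_error_le_gap[OF a, of z x t] m b by (smt (verit))
    moreover have "0 \<le> (\<Sum>m<M. indicator (ramp_cell a z m) x * cell_weight a m b)"
      by (intro sum_nonneg mult_nonneg_nonneg w0) auto
    ultimately show ?thesis by linarith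
  qed
qed

text \<open>
  Huber's function, the supremum of the lines \<open>\<theta> x - \<theta>\<^sup>2 c / 2\<close> with slopes \<open>\<theta>\<close> between 0 and 1 (for \<open>x \<ge> 0\<close>).
\<close>

definition huber :: "real \<Rightarrow> real \<Rightarrow> real" where
  "huber c x = (if x \<le> c then x\<^sup>2 / (2 * c) else x - c / 2)"

lemma huber_support_line:
  assumes "0 < c" "0 \<le> \<theta>" "\<theta> \<le> 1" "0 \<le> x"
  shows "\<theta> * x - \<theta>\<^sup>2 * c / 2 \<le> huber c x"
proof (cases "x \<le> c")
  case True
  have "0 \<le> (x - \<theta> * c)\<^sup>2" by simp
  then have "(\<theta> * x - \<theta>\<^sup>2 * c / 2) * (2 * c) \<le> x\<^sup>2"
    by (simp add: power2_eq_square algebra_simps)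
  then show ?thesis using True assms by (simp add: huber_def pos_le_divide_eq)
next
  case False
  have "(1 + \<theta>) * c \<le> 2 * c" using assms by (intro mult_right_mono) auto
  then have "0 \<le> x - (1 + \<theta>) * c / 2" using False by linarith
  with assms have "0 \<le> (1 - \<theta>) * (x - (1 + \<theta>) * c / 2)"
    by (intro mult_nonneg_nonneg) auto
  also have "\<dots> = (x - c / 2) - (\<theta> * x - \<theta>\<^sup>2 * c / 2)"
    by (simp add: power2_eq_square field_simps)
  finally show ?thesis using False by (simp add: huber_def)
qed

definition split_weight :: "real \<Rightarrow> nat \<Rightarrow> real \<Rightarrow> real" where
  "split_weight c m x = (if m = 0 then 2 * huber c x else max (x - real m * c) 0)"

text \<open>
  The cell weights are dominated by convex functions of \<open>b\<close>, which split along a sum of at most \<open>D\<close> terms when \<open>a\<close> is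
  replaced by \<open>a / D\<close>. This is what turns functions of a whole neighbourhood into sums over pairs.
\<close>

lemma cell_weight_le_split:
  assumes a: "0 < a" and D: "0 < D" and A: "finite A" "real (card A) \<le> D"
    and x: "\<And>j. j \<in> A \<Longrightarrow> 0 \<le> x j"
  shows "cell_weight a m (\<Sum>j\<in>A. x j) \<le> (\<Sum>j\<in>A. split_weight (a / D) m (x j))"
proof -
  define b where "b = (\<Sum>j\<in>A. x j)"
  have b0: "0 \<le> b" unfolding b_def by (intro sum_nonneg x)
  have cardA: "real (card A) * (a / D) \<le> a"
    using mult_right_mono[OF A(2), of "a / D"] a D by simp
  show ?thesis
  proof (cases "m = 0")
    case True
    (* the slope of the line that supports Huber's function at b; the same line is then used for all summands *)
    define \<theta> where "\<theta> = min 1 (b / a)"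
    have th: "0 \<le> \<theta>" "\<theta> \<le> 1" using b0 a by (auto simp: \<theta>_def)
    have "min b (b\<^sup>2 / (2 * a)) \<le> 2 * (\<theta> * b - \<theta>\<^sup>2 * a / 2)"
    proof (cases "b \<le> a")
      case True
      then have "\<theta> = b / a" using a by (simp add: \<theta>_def)
      then have "2 * (\<theta> * b - \<theta>\<^sup>2 * a / 2) = b\<^sup>2 / a" using a by (simp add: field_simps power2_eq_square)
      moreover have "b\<^sup>2 / (2 * a) \<le> b\<^sup>2 / a" using a by (simp add: field_simps)
      ultimately show ?thesis by linarith
    next
      case False
      then have "\<theta> = 1" using a by (simp add: \<theta>_def field_simps)
      then show ?thesis using False by simp
    qed
    also have "\<dots> \<le> 2 * (\<theta> * b - \<theta>\<^sup>2 * (real (card A) * (a / D)) / 2)"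
      using mult_left_mono[OF cardA, of "\<theta>\<^sup>2"] by simp
    also have "\<dots> = 2 * (\<Sum>j\<in>A. \<theta> * x j - \<theta>\<^sup>2 * (a / D) / 2)"
      by (simp add: b_def sum_subtractf sum_distrib_left)
    also have "\<dots> \<le> 2 * (\<Sum>j\<in>A. huber (a / D) (x j))"
      using a D th x by (intro mult_left_mono sum_mono huber_support_line) auto
    finally show ?thesis using True
      by (simp add: cell_weight_def split_weight_def b_def sum_distrib_left)
  next
    case False
    have "b - real m * a \<le> b - real m * (real (card A) * (a / D))"
      using mult_left_mono[OF cardA, of "real m"] by simp
    also have "\<dots> = (\<Sum>j\<in>A. x j - real m * (a / D))"
      by (simp add: b_def sum_subtractf)
    also have "\<dots> \<le> (\<Sum>j\<in>A. max (x j - real m * (a / D)) 0)"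
      by (intro sum_mono) auto
    finally have "b - real m * a \<le> (\<Sum>j\<in>A. max (x j - real m * (a / D)) 0)" .
    moreover have "0 \<le> (\<Sum>j\<in>A. max (x j - real m * (a / D)) 0)"
      by (intro sum_nonneg) auto
    ultimately show ?thesis using False
      by (simp add: cell_weight_def split_weight_def b_def)
  qed
qed

lemma split_weight_bounds:
  assumes "0 < c" "0 \<le> x"
  shows "0 \<le> split_weight c m x" "split_weight c m x \<le> 2 * x"
proof -
  have "x\<^sup>2 / (2 * c) \<le> x" if "x \<le> c"
    using that assms mult_right_mono[of x "2 * c" x] by (simp add: field_simps power2_eq_square)
  moreover have "x - real m * c \<le> 2 * x"
    using assms by (smt (verit) mult_nonneg_nonneg of_nat_0_le_iff)
  ultimately show "0 \<le> split_weight c m x" "split_weight c m x \<le> 2 * x"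
    using assms by (auto simp: split_weight_def huber_def)
qed

lemma measurable_split_weight [measurable]: "split_weight c m \<in> borel_measurable borel"
  unfolding split_weight_def huber_def by measurable

text \<open>
  The terms with \<open>m > x / c\<close> vanish and every other one with \<open>m \<ge> 1\<close> is at most \<open>x\<close>.
\<close>

lemma sum_split_weight:
  assumes c: "0 < c" and x: "0 \<le> x"
  shows "(\<Sum>m<M. split_weight c m x) \<le> 2 * x\<^sup>2 / c"
proof -
  have z: "split_weight c 0 x \<le> x\<^sup>2 / c"
  proof (cases "x \<le> c")
    case False
    have "0 \<le> (x - c)\<^sup>2" by simp
    then have "2 * (x - c / 2) * c \<le> x\<^sup>2" by (simp add: power2_eq_square algebra_simps)
    then show ?thesis using False c by (simp add: split_weight_def huber_def pos_le_divide_eq)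
  qed (simp add: split_weight_def huber_def)
  have "(\<Sum>m<M. split_weight c m x) \<le> split_weight c 0 x + (\<Sum>m\<in>{1..<Suc M}. split_weight c m x)"
  proof -
    have "(\<Sum>m<M. split_weight c m x) \<le> (\<Sum>m\<in>insert 0 {1..<Suc M}. split_weight c m x)"
      using split_weight_bounds[OF c x] by (intro sum_mono2) auto
    then show ?thesis by simp
  qed
  also have "(\<Sum>m\<in>{1..<Suc M}. split_weight c m x) \<le> (\<Sum>m\<in>{1..nat \<lfloor>x / c\<rfloor>}. x)"
  proof -
    have "(\<Sum>m\<in>{1..<Suc M}. split_weight c m x) \<le> (\<Sum>m\<in>{1..<Suc M}. if m \<le> nat \<lfloor>x / c\<rfloor> then x else 0)"
    proof (intro sum_mono)
      fix m assume "m \<in> {1..<Suc M}"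
      then have m: "m \<noteq> 0" by auto
      show "split_weight c m x \<le> (if m \<le> nat \<lfloor>x / c\<rfloor> then x else 0)"
      proof (cases "m \<le> nat \<lfloor>x / c\<rfloor>")
        case True
        then show ?thesis using m x c by (simp add: split_weight_def)
      next
        case False
        then have "x / c < real m" using x c by linarith
        then have "x \<le> real m * c" using c by (simp add: field_simps)
        then show ?thesis using m False by (simp add: split_weight_def)
      qed
    qed
    also have "\<dots> = (\<Sum>m\<in>{m \<in> {1..<Suc M}. m \<le> nat \<lfloor>x / c\<rfloor>}. x)"
      by (rule sum.inter_filter[symmetric]) simp
    also have "\<dots> \<le> (\<Sum>m\<in>{1..nat \<lfloor>x / c\<rfloor>}. x)"
      using x by (intro sum_mono2) auto
    finally show ?thesis .
  qed
  also have "\<dots> \<le> (x / c) * x"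
    using mult_right_mono[OF of_int_floor_le[of "x / c"] x] x c by (simp add: of_nat_nat)
  finally show ?thesis using z by (simp add: power2_eq_square)
qed

lemma split_weight_tail:
  fixes x y :: real
  assumes "0 < y" "0 \<le> x" shows "max (x - y) 0 \<le> x ^ 3 / y\<^sup>2"
proof (cases "x \<le> y")
  case False
  have "(x - y) * y\<^sup>2 \<le> x * x\<^sup>2"
    using False assms by (intro mult_mono power_mono) auto
  then show ?thesis using assms False by (simp add: pos_le_divide_eq power2_eq_square power3_eq_cube)
qed (use assms in auto)

section \<open>Fourth moments\<close>

lemma am_gm_3:
  fixes a b c :: real
  assumes "0 \<le> a" "0 \<le> b" "0 \<le> c"
  shows "a * b * c \<le> (a ^ 3 + b ^ 3 + c ^ 3) / 3"
proof -
  have "0 \<le> (a + b + c) * ((a - b)\<^sup>2 + (b - c)\<^sup>2 + (c - a)\<^sup>2)"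
    using assms by (intro mult_nonneg_nonneg add_nonneg_nonneg) auto
  also have "\<dots> = 2 * (a ^ 3 + b ^ 3 + c ^ 3) - 6 * (a * b * c)"
    by (simp add: power2_eq_square power3_eq_cube algebra_simps)
  finally show ?thesis by simp
qed

lemma am_gm_4:
  fixes a b c d :: real
  shows "a * b * c * d \<le> (a ^ 4 + b ^ 4 + c ^ 4 + d ^ 4) / 4"
proof -
  have sq: "2 * (x * y) \<le> x\<^sup>2 + y\<^sup>2" for x y :: real
    using sum_squares_bound[of x y] by simp
  have "4 * (a * b * c * d) \<le> 2 * ((a * b)\<^sup>2 + (c * d)\<^sup>2)"
    using sq[of "a * b" "c * d"] by (simp add: mult.assoc)
  also have "\<dots> = 2 * (a\<^sup>2 * b\<^sup>2) + 2 * (c\<^sup>2 * d\<^sup>2)" by (simp add: power_mult_distrib)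
  also have "\<dots> \<le> ((a\<^sup>2)\<^sup>2 + (b\<^sup>2)\<^sup>2) + ((c\<^sup>2)\<^sup>2 + (d\<^sup>2)\<^sup>2)"
    by (intro add_mono sq)
  finally show ?thesis by simp
qed

lemma sqrt_sqrt_pow4: "sqrt (sqrt (c ^ 4)) = \<bar>c\<bar>"
proof -
  have "c ^ 4 = (c\<^sup>2)\<^sup>2" by simp
  then show ?thesis by (simp only: real_sqrt_abs abs_power2)
qed

context prob_space
begin

text \<open>
  The quadratic polynomial \<open>E (\<bar>X\<bar> - t \<bar>Y\<bar>)\<^sup>2\<close> in \<open>t\<close> is nonnegative.
\<close>

lemma cauchy_schwarz_expectation:
  fixes X Y :: "'a \<Rightarrow> real"
  assumes [measurable]: "X \<in> borel_measurable M" "Y \<in> borel_measurable M"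
    and X: "integrable M (\<lambda>\<omega>. (X \<omega>)\<^sup>2)" and Y: "integrable M (\<lambda>\<omega>. (Y \<omega>)\<^sup>2)"
  shows "integrable M (\<lambda>\<omega>. X \<omega> * Y \<omega>)"
    and "expectation (\<lambda>\<omega>. \<bar>X \<omega> * Y \<omega>\<bar>)
      \<le> sqrt (expectation (\<lambda>\<omega>. (X \<omega>)\<^sup>2)) * sqrt (expectation (\<lambda>\<omega>. (Y \<omega>)\<^sup>2))"
proof -
  show int: "integrable M (\<lambda>\<omega>. X \<omega> * Y \<omega>)"
  proof (rule Bochner_Integration.integrable_bound[OF Bochner_Integration.integrable_add[OF X Y]])
    show "AE \<omega> in M. norm (X \<omega> * Y \<omega>) \<le> norm ((X \<omega>)\<^sup>2 + (Y \<omega>)\<^sup>2)"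
    proof (rule AE_I2)
      fix \<omega>
      have "2 * (\<bar>X \<omega>\<bar> * \<bar>Y \<omega>\<bar>) \<le> (X \<omega>)\<^sup>2 + (Y \<omega>)\<^sup>2"
        using sum_squares_bound[of "\<bar>X \<omega>\<bar>" "\<bar>Y \<omega>\<bar>"] by simp
      moreover have "0 \<le> \<bar>X \<omega>\<bar> * \<bar>Y \<omega>\<bar>" by simp
      moreover have "norm ((X \<omega>)\<^sup>2 + (Y \<omega>)\<^sup>2) = (X \<omega>)\<^sup>2 + (Y \<omega>)\<^sup>2" by simp
      ultimately show "norm (X \<omega> * Y \<omega>) \<le> norm ((X \<omega>)\<^sup>2 + (Y \<omega>)\<^sup>2)"
        unfolding real_norm_def abs_mult by linarith
    qed
  qed simp
  define a b c where "a = expectation (\<lambda>\<omega>. (X \<omega>)\<^sup>2)" and "b = expectation (\<lambda>\<omega>. (Y \<omega>)\<^sup>2)"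
    and "c = expectation (\<lambda>\<omega>. \<bar>X \<omega> * Y \<omega>\<bar>)"
  have ab: "0 \<le> a" "0 \<le> b" "0 \<le> c" by (auto simp: a_def b_def c_def)
  have quad: "2 * t * c \<le> a + t\<^sup>2 * b" if "0 \<le> t" for t
  proof -
    have "expectation (\<lambda>\<omega>. 2 * t * \<bar>X \<omega> * Y \<omega>\<bar>) \<le> expectation (\<lambda>\<omega>. (X \<omega>)\<^sup>2 + t\<^sup>2 * (Y \<omega>)\<^sup>2)"
    proof (rule integral_mono)
      fix \<omega>
      show "2 * t * \<bar>X \<omega> * Y \<omega>\<bar> \<le> (X \<omega>)\<^sup>2 + t\<^sup>2 * (Y \<omega>)\<^sup>2"
        using sum_squares_bound[of "\<bar>X \<omega>\<bar>" "t * \<bar>Y \<omega>\<bar>"] that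
        by (simp add: abs_mult power_mult_distrib ac_simps)
    qed (use int X Y in auto)
    then show ?thesis using X Y int by (simp add: a_def b_def c_def)
  qed
  have "c \<le> sqrt a * sqrt b"
  proof (cases "b = 0")
    case True
    show ?thesis
    proof (rule ccontr)
      assume "\<not> ?thesis"
      then have "0 < c" using True by simp
      then have "2 * ((a + 1) / c) * c \<le> a" using quad[of "(a + 1) / c"] True ab by simp
      then show False using \<open>0 < c\<close> ab by simp
    qed
  next
    case False
    then have "0 < b" using ab by simp
    have "2 * (c / b) * c \<le> a + (c / b)\<^sup>2 * b" by (intro quad) (use ab in auto)
    then have "c\<^sup>2 \<le> a * b" using \<open>0 < b\<close> by (simp add: field_simps power2_eq_square)
    then have "c \<le> sqrt (a * b)" using ab by (simp add: real_le_rsqrt)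
    then show ?thesis by (simp add: real_sqrt_mult)
  qed
  then show "expectation (\<lambda>\<omega>. \<bar>X \<omega> * Y \<omega>\<bar>)
      \<le> sqrt (expectation (\<lambda>\<omega>. (X \<omega>)\<^sup>2)) * sqrt (expectation (\<lambda>\<omega>. (Y \<omega>)\<^sup>2))"
    by (simp add: a_def b_def c_def)
qed

definition L4 :: "('a \<Rightarrow> real) set" where
  "L4 = {Z \<in> borel_measurable M. integrable M (\<lambda>\<omega>. Z \<omega> ^ 4)}"

text \<open>
  The fourth root is written as an iterated square root because products are split by Cauchy-Schwarz twice.
\<close>

definition L4_norm :: "('a \<Rightarrow> real) \<Rightarrow> real" where
  "L4_norm Z = sqrt (sqrt (expectation (\<lambda>\<omega>. Z \<omega> ^ 4)))"

lemma L4_measurable: "Z \<in> L4 \<Longrightarrow> Z \<in> borel_measurable M"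
  and L4_integrable: "Z \<in> L4 \<Longrightarrow> integrable M (\<lambda>\<omega>. Z \<omega> ^ 4)"
  by (auto simp: L4_def)

lemma L4_norm_nonneg [simp]: "0 \<le> L4_norm Z"
  by (auto simp: L4_norm_def intro!: real_sqrt_ge_zero)

lemma L4_norm_pow4: "L4_norm Z ^ 4 = expectation (\<lambda>\<omega>. Z \<omega> ^ 4)"
proof -
  have e: "0 \<le> expectation (\<lambda>\<omega>. Z \<omega> ^ 4)" by auto
  have "L4_norm Z ^ 4 = (L4_norm Z ^ 2) ^ 2" by simp
  also have "\<dots> = expectation (\<lambda>\<omega>. Z \<omega> ^ 4)"
    unfolding L4_norm_def using e by (simp del: power2_eq_square)
  finally show ?thesis .
qed

lemma L4_norm_sq: "(L4_norm Z)\<^sup>2 = sqrt (expectation (\<lambda>\<omega>. Z \<omega> ^ 4))"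
  by (simp add: L4_norm_def)

lemma L4_const [simp]: "(\<lambda>_. c) \<in> L4"
  by (simp add: L4_def)

lemma L4_norm_const [simp]: "L4_norm (\<lambda>_. c) = \<bar>c\<bar>"
  unfolding L4_norm_def by (simp add: prob_space sqrt_sqrt_pow4)

lemma L4_cmult: "Z \<in> L4 \<Longrightarrow> (\<lambda>\<omega>. c * Z \<omega>) \<in> L4"
  by (auto simp: L4_def power_mult_distrib)

lemma L4_norm_cmult: "L4_norm (\<lambda>\<omega>. c * Z \<omega>) = \<bar>c\<bar> * L4_norm Z"
  unfolding L4_norm_def by (simp add: power_mult_distrib real_sqrt_mult sqrt_sqrt_pow4)

lemma L4_abs: "Z \<in> L4 \<Longrightarrow> (\<lambda>\<omega>. \<bar>Z \<omega>\<bar>) \<in> L4"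
  by (auto simp: L4_def power_even_abs_numeral)

lemma L4_norm_abs [simp]: "L4_norm (\<lambda>\<omega>. \<bar>Z \<omega>\<bar>) = L4_norm Z"
  by (simp add: L4_norm_def power_even_abs_numeral)

lemma L4_add:
  assumes "Y \<in> L4" "Z \<in> L4" shows "(\<lambda>\<omega>. Y \<omega> + Z \<omega>) \<in> L4"
proof -
  have [measurable]: "Y \<in> borel_measurable M" "Z \<in> borel_measurable M"
    using assms by (auto intro: L4_measurable)
  have p: "(a + b) ^ 4 \<le> 8 * (a ^ 4 + b ^ 4)" for a b :: real
  proof -
    have "(a + b)\<^sup>2 \<le> 2 * (a\<^sup>2 + b\<^sup>2)" using sum_squares_bound[of a b] by (simp add: power2_sum)
    then have "((a + b)\<^sup>2)\<^sup>2 \<le> (2 * (a\<^sup>2 + b\<^sup>2))\<^sup>2" by (intro power_mono) auto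
    also have "\<dots> = 4 * (a\<^sup>2 + b\<^sup>2)\<^sup>2" by (simp only: power_mult_distrib) simp
    also have "\<dots> \<le> 4 * (2 * ((a\<^sup>2)\<^sup>2 + (b\<^sup>2)\<^sup>2))"
      using sum_squares_bound[of "a\<^sup>2" "b\<^sup>2"] by (simp add: power2_sum)
    finally show ?thesis by simp
  qed
  have "integrable M (\<lambda>\<omega>. (Y \<omega> + Z \<omega>) ^ 4)"
  proof (rule Bochner_Integration.integrable_bound)
    show "integrable M (\<lambda>\<omega>. 8 * (Y \<omega> ^ 4 + Z \<omega> ^ 4))"
      using assms by (auto intro!: L4_integrable)
  qed (use p in auto)
  then show ?thesis by (simp add: L4_def)
qed

lemma L4_sum: "(\<And>i. i \<in> I \<Longrightarrow> Z i \<in> L4) \<Longrightarrow> (\<lambda>\<omega>. \<Sum>i\<in>I. Z i \<omega>) \<in> L4"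
proof (induction I rule: infinite_finite_induct)
  case (insert i I)
  then show ?case using L4_add[of "Z i" "\<lambda>\<omega>. \<Sum>i\<in>I. Z i \<omega>"] by simp
qed simp_all

lemma L4_diff: "Y \<in> L4 \<Longrightarrow> Z \<in> L4 \<Longrightarrow> (\<lambda>\<omega>. Y \<omega> - Z \<omega>) \<in> L4"
  using L4_add[of Y "\<lambda>\<omega>. - 1 * Z \<omega>"] L4_cmult[of Z "-1"] by simp

lemma L4_product_square:
  assumes "Y \<in> L4" "Z \<in> L4"
  shows "integrable M (\<lambda>\<omega>. (Y \<omega> * Z \<omega>)\<^sup>2)"
    and "sqrt (expectation (\<lambda>\<omega>. (Y \<omega> * Z \<omega>)\<^sup>2)) \<le> L4_norm Y * L4_norm Z"
proof -
  have [measurable]: "Y \<in> borel_measurable M" "Z \<in> borel_measurable M"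
    using assms by (auto intro: L4_measurable)
  have i: "integrable M (\<lambda>\<omega>. ((Y \<omega>)\<^sup>2)\<^sup>2)" "integrable M (\<lambda>\<omega>. ((Z \<omega>)\<^sup>2)\<^sup>2)"
    using assms by (auto dest: L4_integrable)
  note cs = cauchy_schwarz_expectation[OF _ _ i]
  show "integrable M (\<lambda>\<omega>. (Y \<omega> * Z \<omega>)\<^sup>2)" using cs(1) by (simp add: power_mult_distrib)
  have "expectation (\<lambda>\<omega>. (Y \<omega> * Z \<omega>)\<^sup>2) \<le> (L4_norm Y)\<^sup>2 * (L4_norm Z)\<^sup>2"
    using cs(2) by (simp add: L4_norm_sq power_mult_distrib)
  then have "sqrt (expectation (\<lambda>\<omega>. (Y \<omega> * Z \<omega>)\<^sup>2)) \<le> sqrt ((L4_norm Y * L4_norm Z)\<^sup>2)"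
    by (intro real_sqrt_le_mono) (simp add: power_mult_distrib)
  then show "sqrt (expectation (\<lambda>\<omega>. (Y \<omega> * Z \<omega>)\<^sup>2)) \<le> L4_norm Y * L4_norm Z" by simp
qed

lemma L4_holder:
  assumes "X \<in> L4" "Y \<in> L4" "Z \<in> L4" "W \<in> L4"
  shows "integrable M (\<lambda>\<omega>. X \<omega> * Y \<omega> * Z \<omega> * W \<omega>)"
    and "expectation (\<lambda>\<omega>. \<bar>X \<omega> * Y \<omega> * Z \<omega> * W \<omega>\<bar>)
      \<le> L4_norm X * L4_norm Y * L4_norm Z * L4_norm W"
proof -
  have [measurable]: "X \<in> borel_measurable M" "Y \<in> borel_measurable M"
      "Z \<in> borel_measurable M" "W \<in> borel_measurable M"
    using assms by (auto intro: L4_measurable)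
  note cs = cauchy_schwarz_expectation[OF _ _ L4_product_square(1)[OF assms(1,2)]
      L4_product_square(1)[OF assms(3,4)]]
  show "integrable M (\<lambda>\<omega>. X \<omega> * Y \<omega> * Z \<omega> * W \<omega>)"
    using cs(1) by (simp add: mult.assoc)
  have "expectation (\<lambda>\<omega>. \<bar>X \<omega> * Y \<omega> * (Z \<omega> * W \<omega>)\<bar>)
      \<le> (L4_norm X * L4_norm Y) * (L4_norm Z * L4_norm W)"
    by (rule order_trans[OF cs(2) mult_mono])
       (auto intro!: L4_product_square assms real_sqrt_ge_zero)
  then show "expectation (\<lambda>\<omega>. \<bar>X \<omega> * Y \<omega> * Z \<omega> * W \<omega>\<bar>)
      \<le> L4_norm X * L4_norm Y * L4_norm Z * L4_norm W"
    by (simp add: mult.assoc)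
qed

lemma L4_holder3:
  assumes "X \<in> L4" "Y \<in> L4" "Z \<in> L4"
  shows "integrable M (\<lambda>\<omega>. X \<omega> * Y \<omega> * Z \<omega>)"
    and "expectation (\<lambda>\<omega>. \<bar>X \<omega> * Y \<omega> * Z \<omega>\<bar>) \<le> L4_norm X * L4_norm Y * L4_norm Z"
  using L4_holder[OF assms L4_const[of 1]] by simp_all

lemma L4_holder2:
  assumes "X \<in> L4" "Y \<in> L4"
  shows "integrable M (\<lambda>\<omega>. X \<omega> * Y \<omega>)"
    and "expectation (\<lambda>\<omega>. \<bar>X \<omega> * Y \<omega>\<bar>) \<le> L4_norm X * L4_norm Y"
  using L4_holder3[OF assms L4_const[of 1]] by simp_all

lemma L4_holder1:
  assumes "X \<in> L4"
  shows "integrable M X" and "expectation (\<lambda>\<omega>. \<bar>X \<omega>\<bar>) \<le> L4_norm X"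
  using L4_holder2[OF assms L4_const[of 1]] by simp_all

text \<open>
  A bound on the second moment out of separate bounds on mean and variance.
\<close>

lemma L2_norm_triangle_mean:
  fixes T :: "'a \<Rightarrow> real"
  assumes [measurable]: "T \<in> borel_measurable M" and "integrable M (\<lambda>\<omega>. (T \<omega>)\<^sup>2)"
    and T: "\<bar>expectation T\<bar> \<le> u" and v: "expectation (\<lambda>\<omega>. (T \<omega> - expectation T)\<^sup>2) \<le> v\<^sup>2" "0 \<le> v"
  shows "sqrt (expectation (\<lambda>\<omega>. (T \<omega>)\<^sup>2)) \<le> u + v"
proof -
  have i: "integrable M T"
    using cauchy_schwarz_expectation(1)[OF assms(1) _ assms(2), of "\<lambda>_. 1"] by simp
  have "expectation (\<lambda>\<omega>. (T \<omega> - expectation T)\<^sup>2) = expectation (\<lambda>\<omega>. (T \<omega>)\<^sup>2) - (expectation T)\<^sup>2"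
    by (rule variance_eq[OF i assms(2)])
  then have "expectation (\<lambda>\<omega>. (T \<omega>)\<^sup>2) \<le> v\<^sup>2 + (expectation T)\<^sup>2"
    using v by linarith
  also have "(expectation T)\<^sup>2 \<le> u\<^sup>2"
    using power_mono[OF T, of 2] by simp
  also have "v\<^sup>2 + u\<^sup>2 \<le> (u + v)\<^sup>2"
    using T v by (simp add: power2_sum mult_nonneg_nonneg)
  finally show ?thesis
    using T v by (intro real_le_lsqrt) auto
qed

end

section \<open>Sums over neighbourhoods\<close>

text \<open>
  The normalised situation of Stein's method. Independence is stated for vertex sets \<open>\<Gamma>\<close> and \<open>\<Delta>\<close> such that no
  closed neighbourhood of a vertex of \<open>\<Gamma>\<close> meets \<open>\<Delta>\<close>; as \<open>i \<in> A i\<close>, such sets are disjoint.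
\<close>

locale local_dependence = prob_space M for M :: "'a measure" +
  fixes V :: "'v set" and A :: "'v \<Rightarrow> 'v set" and D :: real and \<xi> :: "'v \<Rightarrow> 'a \<Rightarrow> real"
  assumes finite_V: "finite V"
    and A_subset: "\<And>i. i \<in> V \<Longrightarrow> A i \<subseteq> V"
    and A_self: "\<And>i. i \<in> V \<Longrightarrow> i \<in> A i"
    and A_sym: "\<And>i j. i \<in> V \<Longrightarrow> j \<in> A i \<Longrightarrow> i \<in> A j"
    and A_card: "\<And>i. i \<in> V \<Longrightarrow> real (card (A i)) \<le> D"
    and L4_xi: "\<And>i. i \<in> V \<Longrightarrow> \<xi> i \<in> L4"
    and mean_xi: "\<And>i. i \<in> V \<Longrightarrow> expectation (\<xi> i) = 0"
    and unit_variance: "expectation (\<lambda>\<omega>. (\<Sum>i\<in>V. \<xi> i \<omega>)\<^sup>2) = 1"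
    and separated_indep: "\<And>\<Gamma> \<Delta>. \<Gamma> \<subseteq> V \<Longrightarrow> \<Delta> \<subseteq> V \<Longrightarrow> (\<And>i. i \<in> \<Gamma> \<Longrightarrow> A i \<inter> \<Delta> = {}) \<Longrightarrow>
      indep_var (Pi\<^sub>M \<Gamma> (\<lambda>_. borel)) (\<lambda>\<omega>. \<lambda>i\<in>\<Gamma>. \<xi> i \<omega>) (Pi\<^sub>M \<Delta> (\<lambda>_. borel)) (\<lambda>\<omega>. \<lambda>i\<in>\<Delta>. \<xi> i \<omega>)"
begin

abbreviation "W \<equiv> \<lambda>\<omega>. \<Sum>i\<in>V. \<xi> i \<omega>"
abbreviation "\<eta> \<equiv> \<lambda>i \<omega>. \<Sum>j\<in>A i. \<xi> j \<omega>"
abbreviation "x \<equiv> \<lambda>i. L4_norm (\<xi> i)"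

text \<open>
  The two error terms: \<open>T3\<close> bounds sums of third moments over triples in a common neighbourhood, and \<open>T4\<close> bounds
  variances of sums over pairs, hence the square root.
\<close>

definition T3 :: real where "T3 = D\<^sup>2 * (\<Sum>i\<in>V. x i ^ 3)"
definition T4 :: real where "T4 = D ^ 3 * (\<Sum>i\<in>V. x i ^ 4)"
definition \<beta> :: real where "\<beta> = T3 + sqrt T4"

lemma V_nonempty: "V \<noteq> {}"
  using unit_variance by auto

lemma finite_A: "i \<in> V \<Longrightarrow> finite (A i)"
  using A_subset finite_V finite_subset by metis

lemma D_ge_1: "1 \<le> D"
proof -
  obtain i where i: "i \<in> V" using V_nonempty by auto
  then have "0 < card (A i)" using A_self finite_A card_gt_0_iff by blast
  then show ?thesis using A_card[OF i] by simp
qed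

lemma D_pos: "0 < D" using D_ge_1 by simp

lemma in_A: "i \<in> V \<Longrightarrow> j \<in> A i \<Longrightarrow> j \<in> V"
  using A_subset by auto

lemma A_memD: "j \<in> A i \<Longrightarrow> i \<in> V \<Longrightarrow> j \<in> V"
  by (rule in_A)

lemma xi_measurable [measurable]: "i \<in> V \<Longrightarrow> \<xi> i \<in> borel_measurable M"
  using L4_xi L4_measurable by auto

lemma L4_W: "W \<in> L4" by (intro L4_sum L4_xi)

lemma L4_eta: "i \<in> V \<Longrightarrow> \<eta> i \<in> L4" by (intro L4_sum L4_xi) (auto dest: A_memD)

lemma T3_nonneg: "0 \<le> T3"
  unfolding T3_def by (intro mult_nonneg_nonneg sum_nonneg zero_le_power less_imp_le[OF D_pos]) auto

lemma T4_nonneg: "0 \<le> T4"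
  unfolding T4_def by (intro mult_nonneg_nonneg sum_nonneg zero_le_power less_imp_le[OF D_pos]) auto

lemma beta_bounds: "0 \<le> \<beta>" "T3 \<le> \<beta>" "T4 \<le> \<beta>\<^sup>2"
proof -
  show "0 \<le> \<beta>" "T3 \<le> \<beta>" using T3_nonneg T4_nonneg by (auto simp: \<beta>_def)
  have "sqrt T4 \<le> \<beta>" using T3_nonneg by (simp add: \<beta>_def)
  then have "(sqrt T4)\<^sup>2 \<le> \<beta>\<^sup>2" by (intro power_mono) (use T4_nonneg in auto)
  then show "T4 \<le> \<beta>\<^sup>2" using T4_nonneg by simp
qed

lemma sum_pairs_swap:
  fixes F :: "'v \<Rightarrow> 'v \<Rightarrow> 'b :: comm_monoid_add"
  shows "(\<Sum>i\<in>V. \<Sum>j\<in>A i. F i j) = (\<Sum>i\<in>V. \<Sum>j\<in>A i. F j i)"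
proof -
  have restr: "(\<Sum>j\<in>A i. G j) = (\<Sum>j\<in>V. if j \<in> A i then G j else 0)" if "i \<in> V" for i and G :: "'v \<Rightarrow> 'b"
    using sum.inter_restrict[OF finite_V, of G "A i"] A_subset[OF that] by (simp add: Int_absorb1)
  have "(\<Sum>i\<in>V. \<Sum>j\<in>A i. F i j) = (\<Sum>i\<in>V. \<Sum>j\<in>V. if j \<in> A i then F i j else 0)"
    by (rule sum.cong[OF refl restr])
  also have "\<dots> = (\<Sum>j\<in>V. \<Sum>i\<in>V. if j \<in> A i then F i j else 0)" by (rule sum.swap)
  also have "\<dots> = (\<Sum>j\<in>V. \<Sum>i\<in>V. if i \<in> A j then F i j else 0)"
    by (intro sum.cong refl if_cong) (use A_sym in blast)
  also have "\<dots> = (\<Sum>j\<in>V. \<Sum>i\<in>A j. F i j)"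
    by (rule sum.cong[OF refl restr[symmetric]])
  finally show ?thesis .
qed

lemma sum_nbhd_const_le: "i \<in> V \<Longrightarrow> 0 \<le> c \<Longrightarrow> (\<Sum>j\<in>A i. c) \<le> D * c"
  using A_card[of i] by (simp add: mult_right_mono)

lemma sum_pairs_le_fst:
  assumes "\<And>i. i \<in> V \<Longrightarrow> 0 \<le> f i"
  shows "(\<Sum>i\<in>V. \<Sum>j\<in>A i. f i) \<le> D * (\<Sum>i\<in>V. f i)"
  unfolding sum_distrib_left by (intro sum_mono sum_nbhd_const_le assms)

lemma sum_pairs_le_snd:
  assumes "\<And>i. i \<in> V \<Longrightarrow> 0 \<le> f i"
  shows "(\<Sum>i\<in>V. \<Sum>j\<in>A i. f j) \<le> D * (\<Sum>i\<in>V. f i)"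
  by (rule order_trans[OF eq_refl[OF sum_pairs_swap] sum_pairs_le_fst[OF assms]])

lemma sum_pairs_tree:
  assumes f: "\<And>i. i \<in> V \<Longrightarrow> 0 \<le> f i"
  shows "(\<Sum>i\<in>V. \<Sum>j\<in>A i. f i + f j) \<le> 2 * D * (\<Sum>i\<in>V. f i)"
proof -
  have "(\<Sum>i\<in>V. \<Sum>j\<in>A i. f i + f j) = (\<Sum>i\<in>V. \<Sum>j\<in>A i. f i) + (\<Sum>i\<in>V. \<Sum>j\<in>A i. f j)"
    by (simp only: sum.distrib)
  then show ?thesis using sum_pairs_le_fst[of f, OF f] sum_pairs_le_snd[of f, OF f] by linarith
qed

text \<open>
  Sums over configurations of a few adjacent vertices occur in two shapes, a centre with leaves (star) and a path.
  Each further vertex costs a factor \<open>D\<close>, whatever vertex the summand depends on; symmetry of the neighbourhood relation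
  moves the summation to that vertex.
\<close>

lemma sum_star3_le:
  assumes f: "\<And>i. i \<in> V \<Longrightarrow> 0 \<le> f i"
  shows "(\<Sum>i\<in>V. \<Sum>j\<in>A i. \<Sum>k\<in>A i. f i + f j + f k) \<le> 3 * D\<^sup>2 * (\<Sum>i\<in>V. f i)"
proof -
  have "(\<Sum>i\<in>V. \<Sum>j\<in>A i. \<Sum>k\<in>A i. f i + f j + f k)
      = (\<Sum>i\<in>V. \<Sum>j\<in>A i. \<Sum>k\<in>A i. f i + f j) + (\<Sum>i\<in>V. \<Sum>j\<in>A i. \<Sum>k\<in>A i. f k)"
    by (simp only: sum.distrib)
  also have "(\<Sum>i\<in>V. \<Sum>j\<in>A i. \<Sum>k\<in>A i. f i + f j) \<le> (\<Sum>i\<in>V. \<Sum>j\<in>A i. D * (f i + f j))"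
    by (intro sum_mono sum_nbhd_const_le add_nonneg_nonneg f) (auto dest: A_memD)
  also have "\<dots> = D * (\<Sum>i\<in>V. \<Sum>j\<in>A i. f i + f j)" by (simp add: sum_distrib_left)
  also have "\<dots> \<le> D * (2 * D * (\<Sum>i\<in>V. f i))"
    using D_pos by (intro mult_left_mono sum_pairs_tree f) auto
  also have "(\<Sum>i\<in>V. \<Sum>j\<in>A i. \<Sum>k\<in>A i. f k) \<le> (\<Sum>i\<in>V. D * (\<Sum>k\<in>A i. f k))"
    by (intro sum_mono sum_nbhd_const_le sum_nonneg f) (auto dest: A_memD)
  also have "\<dots> = D * (\<Sum>i\<in>V. \<Sum>k\<in>A i. f k)" by (simp add: sum_distrib_left)
  also have "\<dots> \<le> D * (D * (\<Sum>i\<in>V. f i))"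
    using D_pos by (intro mult_left_mono sum_pairs_le_snd f) auto
  finally show ?thesis by (simp add: power2_eq_square)
qed

lemma sum_star4_le:
  assumes f: "\<And>i. i \<in> V \<Longrightarrow> 0 \<le> f i"
  shows "(\<Sum>i\<in>V. \<Sum>j\<in>A i. \<Sum>k\<in>A i. \<Sum>l\<in>A i. f i + f j + f k + f l) \<le> 4 * D ^ 3 * (\<Sum>i\<in>V. f i)"
proof -
  have "(\<Sum>i\<in>V. \<Sum>j\<in>A i. \<Sum>k\<in>A i. \<Sum>l\<in>A i. f i + f j + f k + f l)
      = (\<Sum>i\<in>V. \<Sum>j\<in>A i. \<Sum>k\<in>A i. \<Sum>l\<in>A i. f i + f j + f k)
        + (\<Sum>i\<in>V. \<Sum>j\<in>A i. \<Sum>k\<in>A i. \<Sum>l\<in>A i. f l)"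
    by (simp only: sum.distrib)
  also have "(\<Sum>i\<in>V. \<Sum>j\<in>A i. \<Sum>k\<in>A i. \<Sum>l\<in>A i. f i + f j + f k)
      \<le> (\<Sum>i\<in>V. \<Sum>j\<in>A i. \<Sum>k\<in>A i. D * (f i + f j + f k))"
    by (intro sum_mono sum_nbhd_const_le add_nonneg_nonneg f) (auto dest: A_memD)
  also have "\<dots> = D * (\<Sum>i\<in>V. \<Sum>j\<in>A i. \<Sum>k\<in>A i. f i + f j + f k)" by (simp add: sum_distrib_left)
  also have "\<dots> \<le> D * (3 * D\<^sup>2 * (\<Sum>i\<in>V. f i))"
    using D_pos by (intro mult_left_mono sum_star3_le f) auto
  also have "(\<Sum>i\<in>V. \<Sum>j\<in>A i. \<Sum>k\<in>A i. \<Sum>l\<in>A i. f l) \<le> (\<Sum>i\<in>V. D * (D * (\<Sum>l\<in>A i. f l)))"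
  proof (rule sum_mono)
    fix i assume i: "i \<in> V"
    have "0 \<le> (\<Sum>l\<in>A i. f l)" by (intro sum_nonneg f in_A[OF i])
    then have "(\<Sum>j\<in>A i. \<Sum>k\<in>A i. \<Sum>l\<in>A i. f l) \<le> (\<Sum>j\<in>A i. D * (\<Sum>l\<in>A i. f l))"
      by (intro sum_mono sum_nbhd_const_le i)
    also have "\<dots> \<le> D * (D * (\<Sum>l\<in>A i. f l))"
      using \<open>0 \<le> (\<Sum>l\<in>A i. f l)\<close> D_pos by (intro sum_nbhd_const_le i) auto
    finally show "(\<Sum>j\<in>A i. \<Sum>k\<in>A i. \<Sum>l\<in>A i. f l) \<le> D * (D * (\<Sum>l\<in>A i. f l))" .
  qed
  also have "\<dots> = D * D * (\<Sum>i\<in>V. \<Sum>k\<in>A i. f k)" by (simp add: sum_distrib_left mult.assoc)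
  also have "\<dots> \<le> D * D * (D * (\<Sum>i\<in>V. f i))"
    using D_pos by (intro mult_left_mono sum_pairs_le_snd f) auto
  finally show ?thesis by (simp add: power2_eq_square power3_eq_cube)
qed

lemma sum_path4_le:
  assumes f: "\<And>i. i \<in> V \<Longrightarrow> 0 \<le> f i"
  shows "(\<Sum>i\<in>V. \<Sum>j\<in>A i. \<Sum>k\<in>A i. \<Sum>l\<in>A k. f i + f j + f k + f l) \<le> 4 * D ^ 3 * (\<Sum>i\<in>V. f i)"
proof -
  have "(\<Sum>i\<in>V. \<Sum>j\<in>A i. \<Sum>k\<in>A i. \<Sum>l\<in>A k. f i + f j + f k + f l)
      = (\<Sum>i\<in>V. \<Sum>j\<in>A i. \<Sum>k\<in>A i. \<Sum>l\<in>A k. f i + f j + f k)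
        + (\<Sum>i\<in>V. \<Sum>j\<in>A i. \<Sum>k\<in>A i. \<Sum>l\<in>A k. f l)"
    by (simp only: sum.distrib)
  also have "(\<Sum>i\<in>V. \<Sum>j\<in>A i. \<Sum>k\<in>A i. \<Sum>l\<in>A k. f i + f j + f k)
      \<le> (\<Sum>i\<in>V. \<Sum>j\<in>A i. \<Sum>k\<in>A i. D * (f i + f j + f k))"
    by (intro sum_mono sum_nbhd_const_le add_nonneg_nonneg f) (auto dest: A_memD)
  also have "\<dots> = D * (\<Sum>i\<in>V. \<Sum>j\<in>A i. \<Sum>k\<in>A i. f i + f j + f k)" by (simp add: sum_distrib_left)
  also have "\<dots> \<le> D * (3 * D\<^sup>2 * (\<Sum>i\<in>V. f i))"
    using D_pos by (intro mult_left_mono sum_star3_le f) auto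
  also have "(\<Sum>i\<in>V. \<Sum>j\<in>A i. \<Sum>k\<in>A i. \<Sum>l\<in>A k. f l) \<le> (\<Sum>i\<in>V. D * (\<Sum>k\<in>A i. \<Sum>l\<in>A k. f l))"
    by (intro sum_mono sum_nbhd_const_le sum_nonneg f) (auto dest: A_memD)
  also have "\<dots> = D * (\<Sum>i\<in>V. \<Sum>k\<in>A i. \<Sum>l\<in>A k. f l)" by (simp add: sum_distrib_left)
  also have "\<dots> \<le> D * (D * (\<Sum>k\<in>V. \<Sum>l\<in>A k. f l))"
    using D_pos by (intro mult_left_mono sum_pairs_le_snd sum_nonneg f) (auto dest: A_memD)
  also have "\<dots> \<le> D * (D * (D * (\<Sum>i\<in>V. f i)))"
    using D_pos by (intro mult_left_mono sum_pairs_le_snd f) auto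
  finally show ?thesis by (simp add: power2_eq_square power3_eq_cube)
qed

lemma expectation_triple_le:
  assumes "Z \<in> L4" "i \<in> V" "j \<in> V" "k \<in> V"
  shows "expectation (\<lambda>\<omega>. \<bar>\<xi> i \<omega> * \<xi> j \<omega> * \<xi> k \<omega> * Z \<omega>\<bar>) \<le> (x i ^ 3 + x j ^ 3 + x k ^ 3) / 3 * L4_norm Z"
  by (rule order_trans[OF L4_holder(2)], (intro mult_right_mono am_gm_3 L4_xi assms L4_norm_nonneg)+)

lemma sum_expectation_triple:
  assumes "Z \<in> L4"
  shows "(\<Sum>i\<in>V. \<Sum>j\<in>A i. \<Sum>k\<in>A i. expectation (\<lambda>\<omega>. \<bar>\<xi> i \<omega> * \<xi> j \<omega> * \<xi> k \<omega> * Z \<omega>\<bar>)) \<le> T3 * L4_norm Z"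
proof -
  have "(\<Sum>i\<in>V. \<Sum>j\<in>A i. \<Sum>k\<in>A i. expectation (\<lambda>\<omega>. \<bar>\<xi> i \<omega> * \<xi> j \<omega> * \<xi> k \<omega> * Z \<omega>\<bar>))
    \<le> (\<Sum>i\<in>V. \<Sum>j\<in>A i. \<Sum>k\<in>A i. (x i ^ 3 + x j ^ 3 + x k ^ 3) / 3 * L4_norm Z)"
    by (intro sum_mono expectation_triple_le assms) (auto dest: A_memD)
  also have "\<dots> = (\<Sum>i\<in>V. \<Sum>j\<in>A i. \<Sum>k\<in>A i. x i ^ 3 + x j ^ 3 + x k ^ 3) / 3 * L4_norm Z"
    by (simp only: sum_distrib_right sum_divide_distrib)
  also have "\<dots> \<le> (3 * D\<^sup>2 * (\<Sum>i\<in>V. x i ^ 3)) / 3 * L4_norm Z"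
    by (intro mult_right_mono divide_right_mono sum_star3_le) auto
  finally show ?thesis by (simp add: T3_def)
qed

lemma expectation_quadruple_le:
  assumes "i \<in> V" "j \<in> V" "k \<in> V" "l \<in> V"
  shows "expectation (\<lambda>\<omega>. \<bar>\<xi> i \<omega> * \<xi> j \<omega> * \<xi> k \<omega> * \<xi> l \<omega>\<bar>) \<le> (x i ^ 4 + x j ^ 4 + x k ^ 4 + x l ^ 4) / 4"
  by (rule order_trans[OF L4_holder(2)], (intro am_gm_4 L4_xi assms)+)

lemma sum_expectation_star4:
  "(\<Sum>i\<in>V. \<Sum>j\<in>A i. \<Sum>k\<in>A i. \<Sum>l\<in>A i. expectation (\<lambda>\<omega>. \<bar>\<xi> i \<omega> * \<xi> j \<omega> * \<xi> k \<omega> * \<xi> l \<omega>\<bar>)) \<le> T4"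
proof -
  have "(\<Sum>i\<in>V. \<Sum>j\<in>A i. \<Sum>k\<in>A i. \<Sum>l\<in>A i. expectation (\<lambda>\<omega>. \<bar>\<xi> i \<omega> * \<xi> j \<omega> * \<xi> k \<omega> * \<xi> l \<omega>\<bar>))
    \<le> (\<Sum>i\<in>V. \<Sum>j\<in>A i. \<Sum>k\<in>A i. \<Sum>l\<in>A i. (x i ^ 4 + x j ^ 4 + x k ^ 4 + x l ^ 4) / 4)"
    by (intro sum_mono expectation_quadruple_le) (auto dest: A_memD)
  also have "\<dots> = (\<Sum>i\<in>V. \<Sum>j\<in>A i. \<Sum>k\<in>A i. \<Sum>l\<in>A i. x i ^ 4 + x j ^ 4 + x k ^ 4 + x l ^ 4) / 4"
    by (simp only: sum_divide_distrib)
  also have "\<dots> \<le> (4 * D ^ 3 * (\<Sum>i\<in>V. x i ^ 4)) / 4"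
    by (intro divide_right_mono sum_star4_le) auto
  finally show ?thesis by (simp add: T4_def)
qed

text \<open>
  The \<open>\<sigma>\<close>-algebra of the variables indexed by \<open>\<Gamma>\<close>. Measurability with respect to it is a convenient way to say that a
  random variable is a function of these variables only.
\<close>

definition generated :: "'v set \<Rightarrow> 'a measure" where
  "generated \<Gamma> = vimage_algebra (space M) (\<lambda>\<omega>. \<lambda>i\<in>\<Gamma>. \<xi> i \<omega>) (Pi\<^sub>M \<Gamma> (\<lambda>_. borel))"

lemma space_generated [simp]: "space (generated \<Gamma>) = space M"
  by (simp add: generated_def)

lemma xi_generated: "i \<in> \<Gamma> \<Longrightarrow> \<xi> i \<in> borel_measurable (generated \<Gamma>)"
proof -
  assume i: "i \<in> \<Gamma>"
  have "(\<lambda>\<omega>. \<lambda>i\<in>\<Gamma>. \<xi> i \<omega>) \<in> measurable (generated \<Gamma>) (Pi\<^sub>M \<Gamma> (\<lambda>_. borel))"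
    unfolding generated_def by (rule measurable_vimage_algebra1) (auto simp: space_PiM)
  then have "(\<lambda>\<omega>. (\<lambda>i\<in>\<Gamma>. \<xi> i \<omega>) i) \<in> borel_measurable (generated \<Gamma>)"
    by (rule measurable_compose[OF _ measurable_component_singleton[OF i]])
  then show ?thesis using i by simp
qed

lemma generated_measurable:
  assumes "\<Gamma> \<subseteq> V" "f \<in> borel_measurable (generated \<Gamma>)"
  shows "f \<in> borel_measurable M"
proof -
  have "(\<lambda>\<omega>. \<lambda>i\<in>\<Gamma>. \<xi> i \<omega>) \<in> measurable M (Pi\<^sub>M \<Gamma> (\<lambda>_. borel))"
    using assms(1) by (intro measurable_restrict) auto
  then have "(\<lambda>\<omega>. \<omega>) \<in> measurable M (generated \<Gamma>)"
    unfolding generated_def by (intro measurable_vimage_algebra2) auto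
  from measurable_compose[OF this assms(2)] show ?thesis .
qed

lemma separated_product:
  assumes sep: "\<Gamma> \<subseteq> V" "\<Delta> \<subseteq> V" "\<And>i. i \<in> \<Gamma> \<Longrightarrow> A i \<inter> \<Delta> = {}"
    and f: "f \<in> borel_measurable (generated \<Gamma>)" and g: "g \<in> borel_measurable (generated \<Delta>)"
    and int: "integrable M f" "integrable M g"
  shows "integrable M (\<lambda>\<omega>. f \<omega> * g \<omega> :: real)"
    and "expectation (\<lambda>\<omega>. f \<omega> * g \<omega>) = expectation f * expectation g"
proof -
  let ?X = "\<lambda>\<Gamma> \<omega>. \<lambda>i\<in>\<Gamma>. \<xi> i \<omega>"
  have gen: "sigma_sets (space M) {f -` B \<inter> space M | B. B \<in> sets borel}
      \<subseteq> sigma_sets (space M) {?X \<Gamma> -` B \<inter> space M | B. B \<in> sets (Pi\<^sub>M \<Gamma> (\<lambda>_. borel))}"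
    if "f \<in> borel_measurable (generated \<Gamma>)" for f :: "'a \<Rightarrow> real" and \<Gamma>
  proof (rule sigma_sets_mono, safe)
    fix B :: "real set" assume "B \<in> sets borel"
    then have "f -` B \<inter> space M \<in> sets (generated \<Gamma>)"
      using measurable_sets[OF that] by simp
    then show "f -` B \<inter> space M \<in> sigma_sets (space M)
        {?X \<Gamma> -` B \<inter> space M | B. B \<in> sets (Pi\<^sub>M \<Gamma> (\<lambda>_. borel))}"
      unfolding generated_def by (simp add: sets_vimage_algebra)
  qed
  have "indep_set (sigma_sets (space M) {?X \<Gamma> -` B \<inter> space M | B. B \<in> sets (Pi\<^sub>M \<Gamma> (\<lambda>_. borel))})
     (sigma_sets (space M) {?X \<Delta> -` B \<inter> space M | B. B \<in> sets (Pi\<^sub>M \<Delta> (\<lambda>_. borel))})"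
    using separated_indep[OF sep] unfolding indep_var_eq by blast
  then have "indep_set (sigma_sets (space M) {f -` B \<inter> space M | B. B \<in> sets borel})
     (sigma_sets (space M) {g -` B \<inter> space M | B. B \<in> sets borel})"
    using gen[OF f] gen[OF g] unfolding indep_sets2_eq by blast
  then have "indep_var borel f borel g"
    unfolding indep_var_eq using generated_measurable[OF sep(1) f] generated_measurable[OF sep(2) g] by simp
  from indep_var_integrable[OF this int] indep_var_lebesgue_integral[OF this int]
  show "integrable M (\<lambda>\<omega>. f \<omega> * g \<omega>)" "expectation (\<lambda>\<omega>. f \<omega> * g \<omega>) = expectation f * expectation g"
    by auto
qed

text \<open>
  The identity behind Stein's method: \<open>\<xi> k\<close> is centred and independent of everything outside its neighbourhood.
\<close>

lemma leave_out_zero: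
  assumes k: "k \<in> V" and g: "g \<in> borel_measurable (generated (V - A k))" "integrable M g"
  shows "integrable M (\<lambda>\<omega>. \<xi> k \<omega> * g \<omega>)" "expectation (\<lambda>\<omega>. \<xi> k \<omega> * g \<omega>) = 0"
proof -
  have "integrable M (\<xi> k)" using L4_holder1(1)[OF L4_xi[OF k]] .
  note sp = separated_product[of "{k}" "V - A k", OF _ _ _ xi_generated[of k "{k}"] g(1) this g(2)]
  show "integrable M (\<lambda>\<omega>. \<xi> k \<omega> * g \<omega>)" "expectation (\<lambda>\<omega>. \<xi> k \<omega> * g \<omega>) = 0"
    using sp k mean_xi[OF k] by auto
qed

end

section \<open>Variance of local pair sums\<close>

context local_dependence
begin

lemma expectation_sum_pairs:
  fixes F :: "'v \<Rightarrow> 'v \<Rightarrow> 'a \<Rightarrow> real"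
  assumes "\<And>i j. i \<in> V \<Longrightarrow> j \<in> A i \<Longrightarrow> integrable M (F i j)"
  shows "integrable M (\<lambda>\<omega>. \<Sum>i\<in>V. \<Sum>j\<in>A i. F i j \<omega>)"
    and "expectation (\<lambda>\<omega>. \<Sum>i\<in>V. \<Sum>j\<in>A i. F i j \<omega>) = (\<Sum>i\<in>V. \<Sum>j\<in>A i. expectation (F i j))"
proof -
  have 1: "integrable M (\<lambda>\<omega>. \<Sum>j\<in>A i. F i j \<omega>)" if "i \<in> V" for i
    using assms that by (intro Bochner_Integration.integrable_sum)
  then show "integrable M (\<lambda>\<omega>. \<Sum>i\<in>V. \<Sum>j\<in>A i. F i j \<omega>)"
    by (rule Bochner_Integration.integrable_sum)
  show "expectation (\<lambda>\<omega>. \<Sum>i\<in>V. \<Sum>j\<in>A i. F i j \<omega>) = (\<Sum>i\<in>V. \<Sum>j\<in>A i. expectation (F i j))"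
    using Bochner_Integration.integral_sum[of V M "\<lambda>i \<omega>. \<Sum>j\<in>A i. F i j \<omega>", OF 1]
      Bochner_Integration.integral_sum[of "A i" M "F i" for i, OF assms]
    by simp
qed

text \<open>
  Two pairs contribute a covariance only if some vertex of one is in the neighbourhood of some vertex of the other, which
  can happen in four ways. Together with the two edges inside the pairs such a link forms a path of four vertices, so there are
  \<open>D\<^sup>3\<close> such configurations per vertex, and each covariance is at most twice the mean of four fourth moments. It is essential
  that each summand depends on two variables: for a function of a whole neighbourhood the same argument would lose two factors \<open>D\<close>.
\<close>

lemma pair_sum_variance:
  fixes Y :: "'v \<Rightarrow> 'v \<Rightarrow> 'a \<Rightarrow> real"
  assumes gen: "\<And>i j. i \<in> V \<Longrightarrow> j \<in> A i \<Longrightarrow> Y i j \<in> borel_measurable (generated {i, j})"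
    and bound: "\<And>i j \<omega>. i \<in> V \<Longrightarrow> j \<in> A i \<Longrightarrow> \<bar>Y i j \<omega>\<bar> \<le> c * \<bar>\<xi> i \<omega> * \<xi> j \<omega>\<bar>"
    and c: "0 \<le> c"
  defines "T \<equiv> \<lambda>\<omega>. \<Sum>i\<in>V. \<Sum>j\<in>A i. Y i j \<omega>"
  shows "T \<in> borel_measurable M" "integrable M T" "integrable M (\<lambda>\<omega>. (T \<omega>)\<^sup>2)"
    and "expectation (\<lambda>\<omega>. (T \<omega> - expectation T)\<^sup>2) \<le> 8 * c\<^sup>2 * T4"
proof -
  have Ym: "Y i j \<in> borel_measurable M" if "i \<in> V" "j \<in> A i" for i j
    using generated_measurable[OF _ gen[OF that]] that in_A by auto
  have Yi: "integrable M (Y i j)" and Ye: "\<bar>expectation (Y i j)\<bar> \<le> c * (x i * x j)"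
    if ij: "i \<in> V" "j \<in> A i" for i j
  proof -
    have L: "\<xi> i \<in> L4" "\<xi> j \<in> L4" using L4_xi ij in_A by auto
    have ci: "integrable M (\<lambda>\<omega>. c * \<bar>\<xi> i \<omega> * \<xi> j \<omega>\<bar>)"
      using L4_holder2(1)[OF L] by (intro Bochner_Integration.integrable_mult_right integrable_abs) auto
    show i: "integrable M (Y i j)"
      by (rule Bochner_Integration.integrable_bound[OF ci Ym[OF ij]])
         (use bound[OF ij] c in \<open>auto simp: abs_mult\<close>)
    have "\<bar>expectation (Y i j)\<bar> \<le> expectation (\<lambda>\<omega>. \<bar>Y i j \<omega>\<bar>)" by (rule integral_abs_bound)
    also have "\<dots> \<le> expectation (\<lambda>\<omega>. c * \<bar>\<xi> i \<omega> * \<xi> j \<omega>\<bar>)"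
      using i ci bound[OF ij] by (intro integral_mono) auto
    also have "\<dots> \<le> c * (x i * x j)"
      using L4_holder2(2)[OF L] c by (simp add: mult_left_mono)
    finally show "\<bar>expectation (Y i j)\<bar> \<le> c * (x i * x j)" .
  qed
  have YYi: "integrable M (\<lambda>\<omega>. Y i j \<omega> * Y k l \<omega>)"
    and YYe: "\<bar>expectation (\<lambda>\<omega>. Y i j \<omega> * Y k l \<omega>)\<bar> \<le> c\<^sup>2 * (x i * x j * x k * x l)"
    if ij: "i \<in> V" "j \<in> A i" and kl: "k \<in> V" "l \<in> A k" for i j k l
  proof -
    have L: "\<xi> i \<in> L4" "\<xi> j \<in> L4" "\<xi> k \<in> L4" "\<xi> l \<in> L4" using L4_xi ij kl in_A by auto
    have ci: "integrable M (\<lambda>\<omega>. c\<^sup>2 * \<bar>\<xi> i \<omega> * \<xi> j \<omega> * \<xi> k \<omega> * \<xi> l \<omega>\<bar>)"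
      using L4_holder(1)[OF L] by (intro Bochner_Integration.integrable_mult_right integrable_abs) auto
    have b: "\<bar>Y i j \<omega> * Y k l \<omega>\<bar> \<le> c\<^sup>2 * \<bar>\<xi> i \<omega> * \<xi> j \<omega> * \<xi> k \<omega> * \<xi> l \<omega>\<bar>" for \<omega>
      using mult_mono[OF bound[OF ij, of \<omega>] bound[OF kl, of \<omega>]] c
      by (simp add: abs_mult power2_eq_square ac_simps)
    show i: "integrable M (\<lambda>\<omega>. Y i j \<omega> * Y k l \<omega>)"
      by (rule Bochner_Integration.integrable_bound[OF ci])
         (use b Ym[OF ij] Ym[OF kl] in \<open>auto simp: abs_mult\<close>)
    have "\<bar>expectation (\<lambda>\<omega>. Y i j \<omega> * Y k l \<omega>)\<bar> \<le> expectation (\<lambda>\<omega>. \<bar>Y i j \<omega> * Y k l \<omega>\<bar>)"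
      by (rule integral_abs_bound)
    also have "\<dots> \<le> expectation (\<lambda>\<omega>. c\<^sup>2 * \<bar>\<xi> i \<omega> * \<xi> j \<omega> * \<xi> k \<omega> * \<xi> l \<omega>\<bar>)"
      using i ci b by (intro integral_mono) auto
    also have "\<dots> \<le> c\<^sup>2 * (x i * x j * x k * x l)"
      using L4_holder(2)[OF L] by (simp add: mult_left_mono)
    finally show "\<bar>expectation (\<lambda>\<omega>. Y i j \<omega> * Y k l \<omega>)\<bar> \<le> c\<^sup>2 * (x i * x j * x k * x l)" .
  qed
  show Tm: "T \<in> borel_measurable M"
    unfolding T_def using Ym by (intro borel_measurable_sum) auto
  have Ti: "integrable M T" and ET: "expectation T = (\<Sum>i\<in>V. \<Sum>j\<in>A i. expectation (Y i j))"
    unfolding T_def using expectation_sum_pairs[of Y] Yi by auto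
  show "integrable M T" by (rule Ti)
  define Z where "Z i j \<omega> = Y i j \<omega> - expectation (Y i j)" for i j \<omega>
  have ZZi: "integrable M (\<lambda>\<omega>. Z i j \<omega> * Z k l \<omega>)"
    and ZZe: "expectation (\<lambda>\<omega>. Z i j \<omega> * Z k l \<omega>)
      = expectation (\<lambda>\<omega>. Y i j \<omega> * Y k l \<omega>) - expectation (Y i j) * expectation (Y k l)"
    if ij: "i \<in> V" "j \<in> A i" and kl: "k \<in> V" "l \<in> A k" for i j k l
    unfolding Z_def using YYi[OF that] Yi[OF ij] Yi[OF kl]
    by (simp_all add: left_diff_distrib right_diff_distrib prob_space algebra_simps)
  define s where "s i j k l = x i ^ 4 + x j ^ 4 + x k ^ 4 + x l ^ 4" for i j k l
  have s0: "0 \<le> s i j k l" for i j k l by (auto simp: s_def intro!: add_nonneg_nonneg)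
  have cov: "expectation (\<lambda>\<omega>. Z i j \<omega> * Z k l \<omega>) \<le> c\<^sup>2 / 2 *
      ((if k \<in> A i then s i j k l else 0) + (if l \<in> A i then s i j k l else 0)
       + (if k \<in> A j then s i j k l else 0) + (if l \<in> A j then s i j k l else 0))"
    (is "_ \<le> _ * ?r")
    if ij: "i \<in> V" "j \<in> A i" and kl: "k \<in> V" "l \<in> A k" for i j k l
  (* linked pairs are estimated, unlinked pairs are independent *)
  proof (cases "k \<in> A i \<or> l \<in> A i \<or> k \<in> A j \<or> l \<in> A j")
    case True
    have "\<bar>expectation (Y i j)\<bar> * \<bar>expectation (Y k l)\<bar> \<le> (c * (x i * x j)) * (c * (x k * x l))"
      using c by (intro mult_mono Ye ij kl mult_nonneg_nonneg) auto
    then have "\<bar>expectation (Y i j) * expectation (Y k l)\<bar> \<le> c\<^sup>2 * (x i * x j * x k * x l)"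
      by (simp add: abs_mult power2_eq_square ac_simps)
    with YYe[OF that] have "expectation (\<lambda>\<omega>. Z i j \<omega> * Z k l \<omega>) \<le> 2 * (c\<^sup>2 * (x i * x j * x k * x l))"
      unfolding ZZe[OF that] by linarith
    also have "\<dots> \<le> 2 * (c\<^sup>2 * (s i j k l / 4))"
      unfolding s_def by (intro mult_left_mono am_gm_4) auto
    also have "\<dots> = c\<^sup>2 / 2 * s i j k l" by simp
    also have "\<dots> \<le> c\<^sup>2 / 2 * ?r"
      using True s0[of i j k l] by (intro mult_left_mono) auto
    finally show ?thesis .
  next
    case False
    have "expectation (\<lambda>\<omega>. Y i j \<omega> * Y k l \<omega>) = expectation (Y i j) * expectation (Y k l)"
      using False ij kl in_A
      by (intro separated_product(2)[OF _ _ _ gen[OF ij] gen[OF kl] Yi[OF ij] Yi[OF kl]]) auto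
    then show ?thesis unfolding ZZe[OF that] using False by simp
  qed
  have sq: "(T \<omega> - expectation T)\<^sup>2 = (\<Sum>i\<in>V. \<Sum>j\<in>A i. \<Sum>k\<in>V. \<Sum>l\<in>A k. Z i j \<omega> * Z k l \<omega>)" for \<omega>
  proof -
    have "T \<omega> - expectation T = (\<Sum>i\<in>V. \<Sum>j\<in>A i. Z i j \<omega>)"
      unfolding ET Z_def by (simp only: sum_subtractf T_def)
    then have "(T \<omega> - expectation T)\<^sup>2 = (\<Sum>i\<in>V. \<Sum>j\<in>A i. Z i j \<omega>) * (\<Sum>k\<in>V. \<Sum>l\<in>A k. Z k l \<omega>)"
      by (simp only: power2_eq_square)
    also have "\<dots> = (\<Sum>i\<in>V. \<Sum>j\<in>A i. Z i j \<omega> * (\<Sum>k\<in>V. \<Sum>l\<in>A k. Z k l \<omega>))"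
      by (simp only: sum_distrib_right)
    finally show ?thesis by (simp only: sum_distrib_left)
  qed
  have inner: "integrable M (\<lambda>\<omega>. \<Sum>k\<in>V. \<Sum>l\<in>A k. Z i j \<omega> * Z k l \<omega>)"
    "expectation (\<lambda>\<omega>. \<Sum>k\<in>V. \<Sum>l\<in>A k. Z i j \<omega> * Z k l \<omega>)
      = (\<Sum>k\<in>V. \<Sum>l\<in>A k. expectation (\<lambda>\<omega>. Z i j \<omega> * Z k l \<omega>))"
    if "i \<in> V" "j \<in> A i" for i j
    using expectation_sum_pairs[of "\<lambda>k l \<omega>. Z i j \<omega> * Z k l \<omega>"] ZZi[OF that] by auto
  have var_i: "integrable M (\<lambda>\<omega>. (T \<omega> - expectation T)\<^sup>2)"
    unfolding sq by (rule expectation_sum_pairs(1)[OF inner(1)])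
  have "integrable M (\<lambda>\<omega>. (T \<omega> - expectation T)\<^sup>2 + (2 * expectation T * T \<omega> - (expectation T)\<^sup>2))"
    using var_i Ti by auto
  then show "integrable M (\<lambda>\<omega>. (T \<omega>)\<^sup>2)"
    by (rule Bochner_Integration.integrable_cong[THEN iffD1, OF refl, rotated])
       (simp add: power2_eq_square algebra_simps)
  have "expectation (\<lambda>\<omega>. (T \<omega> - expectation T)\<^sup>2)
      = (\<Sum>i\<in>V. \<Sum>j\<in>A i. \<Sum>k\<in>V. \<Sum>l\<in>A k. expectation (\<lambda>\<omega>. Z i j \<omega> * Z k l \<omega>))"
    unfolding sq
    by (rule trans[OF expectation_sum_pairs(2)[where F = "\<lambda>i j \<omega>. \<Sum>k\<in>V. \<Sum>l\<in>A k. Z i j \<omega> * Z k l \<omega>", OF inner(1)]])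
       (auto intro!: sum.cong inner(2))
  also have "\<dots> \<le> (\<Sum>i\<in>V. \<Sum>j\<in>A i. \<Sum>k\<in>V. \<Sum>l\<in>A k. c\<^sup>2 / 2 *
      ((if k \<in> A i then s i j k l else 0) + (if l \<in> A i then s i j k l else 0)
       + (if k \<in> A j then s i j k l else 0) + (if l \<in> A j then s i j k l else 0)))"
    by (intro sum_mono cov)
  also have "\<dots> = c\<^sup>2 / 2 *
     ((\<Sum>i\<in>V. \<Sum>j\<in>A i. \<Sum>k\<in>V. \<Sum>l\<in>A k. if k \<in> A i then s i j k l else 0)
      + (\<Sum>i\<in>V. \<Sum>j\<in>A i. \<Sum>k\<in>V. \<Sum>l\<in>A k. if l \<in> A i then s i j k l else 0)
      + (\<Sum>i\<in>V. \<Sum>j\<in>A i. \<Sum>k\<in>V. \<Sum>l\<in>A k. if k \<in> A j then s i j k l else 0)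
      + (\<Sum>i\<in>V. \<Sum>j\<in>A i. \<Sum>k\<in>V. \<Sum>l\<in>A k. if l \<in> A j then s i j k l else 0))"
    (is "_ = _ * (?a + ?b + ?c + ?d)")
    by (simp only: sum_distrib_left[symmetric] sum.distrib)
  (* the four kinds of link agree after exchanging the vertices within a pair *)
  also have "?b = ?a"
    by (intro sum.cong refl trans[OF sum_pairs_swap]) (auto simp: s_def)
  also have "?c = ?a"
    by (subst sum_pairs_swap) (intro sum.cong refl, auto simp: s_def)
  also have "?d = ?a"
  proof -
    have "?d = (\<Sum>i\<in>V. \<Sum>j\<in>A i. \<Sum>k\<in>V. \<Sum>l\<in>A k. if l \<in> A i then s i j k l else 0)"
      by (subst sum_pairs_swap) (intro sum.cong refl, auto simp: s_def)
    also have "\<dots> = ?a"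
      by (intro sum.cong refl trans[OF sum_pairs_swap]) (auto simp: s_def)
    finally show ?thesis .
  qed
  also have "?a = (\<Sum>i\<in>V. \<Sum>j\<in>A i. \<Sum>k\<in>A i. \<Sum>l\<in>A k. s i j k l)"
  proof (rule sum.cong[OF refl], rule sum.cong[OF refl])
    fix i j assume i: "i \<in> V"
    have "(\<Sum>k\<in>V. \<Sum>l\<in>A k. if k \<in> A i then s i j k l else 0)
        = (\<Sum>k\<in>V. if k \<in> A i then (\<Sum>l\<in>A k. s i j k l) else 0)"
      by (intro sum.cong refl) auto
    also have "\<dots> = (\<Sum>k\<in>V \<inter> A i. \<Sum>l\<in>A k. s i j k l)"
      by (rule sum.inter_restrict[OF finite_V, symmetric])
    also have "V \<inter> A i = A i" using A_subset[OF i] by auto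
    finally show "(\<Sum>k\<in>V. \<Sum>l\<in>A k. if k \<in> A i then s i j k l else 0)
        = (\<Sum>k\<in>A i. \<Sum>l\<in>A k. s i j k l)" .
  qed
  also have "c\<^sup>2 / 2 * ((\<Sum>i\<in>V. \<Sum>j\<in>A i. \<Sum>k\<in>A i. \<Sum>l\<in>A k. s i j k l)
      + (\<Sum>i\<in>V. \<Sum>j\<in>A i. \<Sum>k\<in>A i. \<Sum>l\<in>A k. s i j k l)
      + (\<Sum>i\<in>V. \<Sum>j\<in>A i. \<Sum>k\<in>A i. \<Sum>l\<in>A k. s i j k l)
      + (\<Sum>i\<in>V. \<Sum>j\<in>A i. \<Sum>k\<in>A i. \<Sum>l\<in>A k. s i j k l))
      \<le> c\<^sup>2 / 2 * (4 * T4 + 4 * T4 + 4 * T4 + 4 * T4)"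
    using sum_path4_le[of "\<lambda>i. x i ^ 4"] unfolding s_def T4_def
    by (intro mult_left_mono add_mono) auto
  finally show "expectation (\<lambda>\<omega>. (T \<omega> - expectation T)\<^sup>2) \<le> 8 * c\<^sup>2 * T4" by simp
qed

end

section \<open>Moments of weighted sums\<close>

lemma (in prob_space) expectation_abs_le_L2:
  fixes T :: "'a \<Rightarrow> real"
  assumes "T \<in> borel_measurable M" "integrable M (\<lambda>\<omega>. (T \<omega>)\<^sup>2)"
  shows "expectation (\<lambda>\<omega>. \<bar>T \<omega>\<bar>) \<le> sqrt (expectation (\<lambda>\<omega>. (T \<omega>)\<^sup>2))"
  using cauchy_schwarz_expectation(2)[OF assms(1) _ assms(2), of "\<lambda>_. 1"] by (simp add: prob_space)

lemma (in prob_space) expectation_double_sum: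
  fixes F :: "'i \<Rightarrow> 'j \<Rightarrow> 'a \<Rightarrow> real"
  assumes "\<And>i j. i \<in> I \<Longrightarrow> j \<in> J \<Longrightarrow> integrable M (F i j)"
  shows "expectation (\<lambda>\<omega>. \<Sum>i\<in>I. \<Sum>j\<in>J. F i j \<omega>) = (\<Sum>i\<in>I. \<Sum>j\<in>J. expectation (F i j))"
proof -
  have "expectation (\<lambda>\<omega>. \<Sum>i\<in>I. \<Sum>j\<in>J. F i j \<omega>) = (\<Sum>i\<in>I. expectation (\<lambda>\<omega>. \<Sum>j\<in>J. F i j \<omega>))"
    by (rule Bochner_Integration.integral_sum[OF Bochner_Integration.integrable_sum[OF assms]])
  also have "\<dots> = (\<Sum>i\<in>I. \<Sum>j\<in>J. expectation (F i j))"
    by (rule sum.cong[OF refl Bochner_Integration.integral_sum[OF assms]])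
  finally show ?thesis .
qed

lemma (in prob_space) expectation_triple_sum:
  fixes F :: "'i \<Rightarrow> 'j \<Rightarrow> 'k \<Rightarrow> 'a \<Rightarrow> real"
  assumes "\<And>i j k. i \<in> I \<Longrightarrow> j \<in> J \<Longrightarrow> k \<in> K \<Longrightarrow> integrable M (F i j k)"
  shows "expectation (\<lambda>\<omega>. \<Sum>i\<in>I. \<Sum>j\<in>J. \<Sum>k\<in>K. F i j k \<omega>)
    = (\<Sum>i\<in>I. \<Sum>j\<in>J. \<Sum>k\<in>K. expectation (F i j k))"
proof -
  have "expectation (\<lambda>\<omega>. \<Sum>i\<in>I. \<Sum>j\<in>J. \<Sum>k\<in>K. F i j k \<omega>)
      = (\<Sum>i\<in>I. \<Sum>j\<in>J. expectation (\<lambda>\<omega>. \<Sum>k\<in>K. F i j k \<omega>))"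
    by (rule expectation_double_sum[OF Bochner_Integration.integrable_sum[OF assms]])
  also have "\<dots> = (\<Sum>i\<in>I. \<Sum>j\<in>J. \<Sum>k\<in>K. expectation (F i j k))"
    by (rule sum.cong[OF refl sum.cong[OF refl Bochner_Integration.integral_sum[OF assms]]])
  finally show ?thesis .
qed

context local_dependence
begin

text \<open>
  This is at least 1 because the second moment of \<open>W\<close> is 1, and at most a multiple of \<open>\<lambda>\<^sub>1\<close>.
\<close>

definition \<Lambda> :: real where
  "\<Lambda> = (\<Sum>i\<in>V. \<Sum>j\<in>A i. expectation (\<lambda>\<omega>. \<bar>\<xi> i \<omega> * \<xi> j \<omega>\<bar>))"

abbreviation "Q \<equiv> \<lambda>\<omega>. \<Sum>i\<in>V. \<Sum>j\<in>A i. \<xi> i \<omega> * \<xi> j \<omega>"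

lemma xi_pair_generated:
  "\<xi> i \<in> borel_measurable (generated {i, j})" "\<xi> j \<in> borel_measurable (generated {i, j})"
  by (auto intro: xi_generated)

lemma weighted_pair_sum:
  fixes c :: "'v \<Rightarrow> real"
  assumes c: "\<And>i. i \<in> V \<Longrightarrow> \<bar>c i\<bar> \<le> 1"
  defines "T \<equiv> \<lambda>\<omega>. \<Sum>i\<in>V. \<Sum>j\<in>A i. c i * c j * (\<xi> i \<omega> * \<xi> j \<omega>)"
  shows "T \<in> borel_measurable M" "integrable M T" "integrable M (\<lambda>\<omega>. (T \<omega>)\<^sup>2)"
    and "expectation (\<lambda>\<omega>. (T \<omega> - expectation T)\<^sup>2) \<le> (3 * \<beta>)\<^sup>2"
    and "\<bar>expectation T\<bar> \<le> \<Lambda>"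
proof -
  have gen: "(\<lambda>\<omega>. c i * c j * (\<xi> i \<omega> * \<xi> j \<omega>)) \<in> borel_measurable (generated {i, j})" for i j
    by (intro borel_measurable_times borel_measurable_const xi_pair_generated)
  have cc: "\<bar>c i * c j\<bar> \<le> 1" if "i \<in> V" "j \<in> A i" for i j
    using mult_mono[OF c c, of i j] that in_A by (auto simp: abs_mult)
  have bound: "\<bar>c i * c j * (\<xi> i \<omega> * \<xi> j \<omega>)\<bar> \<le> 1 * \<bar>\<xi> i \<omega> * \<xi> j \<omega>\<bar>" if "i \<in> V" "j \<in> A i" for i j \<omega>
    using mult_right_mono[OF cc[OF that], of "\<bar>\<xi> i \<omega> * \<xi> j \<omega>\<bar>"] by (simp add: abs_mult)
  note v = pair_sum_variance[of "\<lambda>i j \<omega>. c i * c j * (\<xi> i \<omega> * \<xi> j \<omega>)" 1, OF gen bound]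
  show "T \<in> borel_measurable M" "integrable M T" "integrable M (\<lambda>\<omega>. (T \<omega>)\<^sup>2)"
    using v(1-3) unfolding T_def by simp_all
  have "expectation (\<lambda>\<omega>. (T \<omega> - expectation T)\<^sup>2) \<le> 8 * T4" using v(4) unfolding T_def by simp
  also have "\<dots> \<le> (3 * \<beta>)\<^sup>2" using beta_bounds T4_nonneg by (simp add: power_mult_distrib)
  finally show "expectation (\<lambda>\<omega>. (T \<omega> - expectation T)\<^sup>2) \<le> (3 * \<beta>)\<^sup>2" .
  have i: "integrable M (\<lambda>\<omega>. \<xi> i \<omega> * \<xi> j \<omega>)" if "i \<in> V" "j \<in> A i" for i j
    using that in_A by (intro L4_holder2(1) L4_xi) auto
  have "expectation T = (\<Sum>i\<in>V. \<Sum>j\<in>A i. expectation (\<lambda>\<omega>. c i * c j * (\<xi> i \<omega> * \<xi> j \<omega>)))"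
    unfolding T_def by (rule expectation_sum_pairs(2)) (use i in auto)
  also have "\<bar>\<dots>\<bar> \<le> (\<Sum>i\<in>V. \<Sum>j\<in>A i. \<bar>expectation (\<lambda>\<omega>. c i * c j * (\<xi> i \<omega> * \<xi> j \<omega>))\<bar>)"
    by (rule order_trans[OF sum_abs sum_mono[OF sum_abs]])
  also have "\<dots> \<le> \<Lambda>"
    unfolding \<Lambda>_def
  proof (intro sum_mono)
    fix i j assume ij: "i \<in> V" "j \<in> A i"
    have "\<bar>expectation (\<lambda>\<omega>. c i * c j * (\<xi> i \<omega> * \<xi> j \<omega>))\<bar>
        \<le> expectation (\<lambda>\<omega>. \<bar>c i * c j * (\<xi> i \<omega> * \<xi> j \<omega>)\<bar>)" by (rule integral_abs_bound)
    also have "\<dots> \<le> expectation (\<lambda>\<omega>. \<bar>\<xi> i \<omega> * \<xi> j \<omega>\<bar>)"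
      using i[OF ij] bound[OF ij] by (intro integral_mono) auto
    finally show "\<bar>expectation (\<lambda>\<omega>. c i * c j * (\<xi> i \<omega> * \<xi> j \<omega>))\<bar> \<le> expectation (\<lambda>\<omega>. \<bar>\<xi> i \<omega> * \<xi> j \<omega>\<bar>)" .
  qed
  finally show "\<bar>expectation T\<bar> \<le> \<Lambda>" .
qed

lemma sum_minus_nbhd:
  assumes "k \<in> V" shows "(\<Sum>i\<in>V. f i) - (\<Sum>i\<in>A k. f i) = (\<Sum>i\<in>V - A k. f i :: real)"
  using sum_diff[OF finite_V A_subset[OF assms], of f] by simp

text \<open>
  \<open>E W\<^sup>2 = \<Sum> E \<xi>\<^sub>i W\<close>, and in each term \<open>W\<close> may be replaced by \<open>\<eta>\<^sub>i\<close>.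
\<close>

lemma expectation_Q: "expectation Q = 1"
proof -
  have L: "\<xi> i \<in> L4" if "i \<in> V" for i using L4_xi that .
  have i1: "integrable M (\<lambda>\<omega>. \<xi> i \<omega> * \<eta> i \<omega>)" if "i \<in> V" for i
    using that by (intro L4_holder2(1) L4_xi L4_eta)
  have i2: "integrable M (\<lambda>\<omega>. \<xi> i \<omega> * (W \<omega> - \<eta> i \<omega>))" "expectation (\<lambda>\<omega>. \<xi> i \<omega> * (W \<omega> - \<eta> i \<omega>)) = 0"
    if "i \<in> V" for i
  proof -
    have "(\<lambda>\<omega>. W \<omega> - \<eta> i \<omega>) \<in> borel_measurable (generated (V - A i))"
      unfolding sum_minus_nbhd[OF that] by (intro borel_measurable_sum xi_generated)
    then show "integrable M (\<lambda>\<omega>. \<xi> i \<omega> * (W \<omega> - \<eta> i \<omega>))" "expectation (\<lambda>\<omega>. \<xi> i \<omega> * (W \<omega> - \<eta> i \<omega>)) = 0"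
      using leave_out_zero[OF that] L4_holder1(1)[OF L4_diff[OF L4_W L4_eta[OF that]]] by auto
  qed
  have "(W \<omega>)\<^sup>2 = Q \<omega> + (\<Sum>i\<in>V. \<xi> i \<omega> * (W \<omega> - \<eta> i \<omega>))" for \<omega>
  proof -
    have "Q \<omega> = (\<Sum>i\<in>V. \<xi> i \<omega> * \<eta> i \<omega>)" by (simp only: sum_distrib_left)
    then have "Q \<omega> + (\<Sum>i\<in>V. \<xi> i \<omega> * (W \<omega> - \<eta> i \<omega>)) = (\<Sum>i\<in>V. \<xi> i \<omega> * W \<omega>)"
      by (simp only: sum.distrib[symmetric] distrib_left[symmetric]) simp
    then show ?thesis by (simp only: power2_eq_square sum_distrib_right)
  qed
  moreover have "integrable M Q"
    using weighted_pair_sum(2)[of "\<lambda>_. 1"] by simp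
  moreover have "integrable M (\<lambda>\<omega>. \<Sum>i\<in>V. \<xi> i \<omega> * (W \<omega> - \<eta> i \<omega>))"
    by (rule Bochner_Integration.integrable_sum[OF i2(1)])
  moreover have "expectation (\<lambda>\<omega>. \<Sum>i\<in>V. \<xi> i \<omega> * (W \<omega> - \<eta> i \<omega>)) = 0"
    by (subst Bochner_Integration.integral_sum[OF i2(1)]) (simp_all add: i2(2))
  ultimately show ?thesis using unit_variance by simp
qed

lemma Q_L1_error: "expectation (\<lambda>\<omega>. \<bar>Q \<omega> - 1\<bar>) \<le> 3 * \<beta>"
  and Q_error_integrable: "integrable M (\<lambda>\<omega>. \<bar>Q \<omega> - 1\<bar>)"
proof -
  note w = weighted_pair_sum[of "\<lambda>_. 1", simplified, unfolded expectation_Q]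
  show "integrable M (\<lambda>\<omega>. \<bar>Q \<omega> - 1\<bar>)" using w(2) by (intro integrable_abs) auto
  have "integrable M (\<lambda>\<omega>. (Q \<omega> - 1)\<^sup>2)" using w(2,3) by (simp add: power2_diff)
  then have "expectation (\<lambda>\<omega>. \<bar>Q \<omega> - 1\<bar>) \<le> sqrt (expectation (\<lambda>\<omega>. (Q \<omega> - 1)\<^sup>2))"
    using w(1) by (intro expectation_abs_le_L2) auto
  also have "\<dots> \<le> sqrt ((3 * \<beta>)\<^sup>2)"
    using w(4) by (intro real_sqrt_le_mono) (simp add: power_mult_distrib)
  finally show "expectation (\<lambda>\<omega>. \<bar>Q \<omega> - 1\<bar>) \<le> 3 * \<beta>" using beta_bounds by (simp add: real_sqrt_mult)
qed

lemma Lambda_ge_1: "1 \<le> \<Lambda>"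
  using weighted_pair_sum(5)[of "\<lambda>_. 1"] expectation_Q by simp

lemma abs_pair_sum:
  defines "L \<equiv> \<lambda>\<omega>. \<Sum>i\<in>V. \<Sum>j\<in>A i. \<bar>\<xi> i \<omega> * \<xi> j \<omega>\<bar>"
  assumes "\<beta> \<le> 1"
  shows "L \<in> borel_measurable M" "integrable M (\<lambda>\<omega>. (L \<omega>)\<^sup>2)"
    and "sqrt (expectation (\<lambda>\<omega>. (L \<omega>)\<^sup>2)) \<le> 4 * \<Lambda>" "expectation L = \<Lambda>"
proof -
  have gen: "(\<lambda>\<omega>. \<bar>\<xi> i \<omega> * \<xi> j \<omega>\<bar>) \<in> borel_measurable (generated {i, j})" for i j
    by (intro borel_measurable_abs borel_measurable_times xi_pair_generated)
  note v = pair_sum_variance[of "\<lambda>i j \<omega>. \<bar>\<xi> i \<omega> * \<xi> j \<omega>\<bar>" 1, OF gen]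
  show 1: "L \<in> borel_measurable M" "integrable M (\<lambda>\<omega>. (L \<omega>)\<^sup>2)" unfolding L_def using v(1,3) by auto
  have i: "integrable M (\<lambda>\<omega>. \<bar>\<xi> i \<omega> * \<xi> j \<omega>\<bar>)" if "i \<in> V" "j \<in> A i" for i j
    using that in_A by (intro integrable_abs L4_holder2(1) L4_xi) auto
  show EL: "expectation L = \<Lambda>" unfolding L_def \<Lambda>_def by (rule expectation_sum_pairs(2)[OF i])
  have "expectation (\<lambda>\<omega>. (L \<omega> - expectation L)\<^sup>2) \<le> 8 * T4" using v(4) unfolding L_def by simp
  also have "\<dots> \<le> (3 * \<beta>)\<^sup>2" using beta_bounds T4_nonneg by (simp add: power_mult_distrib)
  finally have "expectation (\<lambda>\<omega>. (L \<omega> - expectation L)\<^sup>2) \<le> (3 * \<beta>)\<^sup>2" .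
  then have "sqrt (expectation (\<lambda>\<omega>. (L \<omega>)\<^sup>2)) \<le> \<Lambda> + 3 * \<beta>"
    using 1 EL Lambda_ge_1 beta_bounds by (intro L2_norm_triangle_mean) auto
  then show "sqrt (expectation (\<lambda>\<omega>. (L \<omega>)\<^sup>2)) \<le> 4 * \<Lambda>" using assms Lambda_ge_1 by linarith
qed

text \<open>
  Stein's argument for the test function \<open>s\<^sup>3\<close>: with \<open>\<tau>\<^sub>k\<close> the part of \<open>S\<close> in the neighbourhood of \<open>k\<close>, \<open>E \<xi>\<^sub>k (S - \<tau>\<^sub>k)\<^sup>3 = 0\<close>, so \<open>E S\<^sup>4\<close> is a
  sum of terms \<open>c\<^sub>k \<xi>\<^sub>k (S\<^sup>3 - (S - \<tau>\<^sub>k)\<^sup>3)\<close>. The leading part \<open>3 S\<^sup>2 \<Sum> c\<^sub>k \<xi>\<^sub>k \<tau>\<^sub>k\<close> contains a sum over pairs whose second moment is known, and the rest is of the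
  orders of \<open>T3\<close> and \<open>T4\<close>. The weights make it possible to treat \<open>W\<close>, \<open>W - \<eta>\<^sub>k\<close> and the sum of all \<open>\<eta>\<^sub>k\<close> at once.
\<close>

lemma weighted_sum_fourth_moment:
  fixes c :: "'v \<Rightarrow> real"
  assumes c: "\<And>i. i \<in> V \<Longrightarrow> \<bar>c i\<bar> \<le> 1"
  defines "S \<equiv> \<lambda>\<omega>. \<Sum>i\<in>V. c i * \<xi> i \<omega>"
    and "q \<equiv> sqrt (expectation (\<lambda>\<omega>. (\<Sum>i\<in>V. \<Sum>j\<in>A i. c i * c j * (\<xi> i \<omega> * \<xi> j \<omega>))\<^sup>2))"
  shows "L4_norm S ^ 4 \<le> 3 * (L4_norm S)\<^sup>2 * q + 3 * T3 * L4_norm S + T4"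
proof -
  define \<tau> where "\<tau> k \<omega> = (\<Sum>j\<in>A k. c j * \<xi> j \<omega>)" for k \<omega>
  let ?T = "\<lambda>\<omega>. \<Sum>i\<in>V. \<Sum>j\<in>A i. c i * c j * (\<xi> i \<omega> * \<xi> j \<omega>)"
  note Tp = weighted_pair_sum[of c, OF c, simplified]
  have LS: "S \<in> L4" unfolding S_def by (intro L4_sum L4_cmult L4_xi)
  have L\<tau>: "\<tau> k \<in> L4" if "k \<in> V" for k
    unfolding \<tau>_def using that in_A by (intro L4_sum L4_cmult L4_xi)
  have zero: "integrable M (\<lambda>\<omega>. \<xi> k \<omega> * (S \<omega> - \<tau> k \<omega>) ^ 3)" "expectation (\<lambda>\<omega>. \<xi> k \<omega> * (S \<omega> - \<tau> k \<omega>) ^ 3) = 0"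
    if k: "k \<in> V" for k
  proof -
    have "(\<lambda>\<omega>. S \<omega> - \<tau> k \<omega>) \<in> borel_measurable (generated (V - A k))"
      unfolding S_def \<tau>_def sum_minus_nbhd[OF k]
      by (intro borel_measurable_sum borel_measurable_times borel_measurable_const xi_generated)
    then have m: "(\<lambda>\<omega>. (S \<omega> - \<tau> k \<omega>) ^ 3) \<in> borel_measurable (generated (V - A k))" by measurable
    have L: "(\<lambda>\<omega>. S \<omega> - \<tau> k \<omega>) \<in> L4" by (intro L4_diff LS L\<tau> k)
    have "integrable M (\<lambda>\<omega>. (S \<omega> - \<tau> k \<omega>) ^ 3)"
      using L4_holder3(1)[OF L L L] by (simp add: power3_eq_cube)
    from leave_out_zero[OF k m this]
    show "integrable M (\<lambda>\<omega>. \<xi> k \<omega> * (S \<omega> - \<tau> k \<omega>) ^ 3)" "expectation (\<lambda>\<omega>. \<xi> k \<omega> * (S \<omega> - \<tau> k \<omega>) ^ 3) = 0" .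
  qed
  let ?Z = "\<lambda>\<omega>. \<Sum>k\<in>V. c k * (\<xi> k \<omega> * (S \<omega> - \<tau> k \<omega>) ^ 3)"
  let ?R3 = "\<lambda>\<omega>. \<Sum>k\<in>V. \<Sum>i\<in>A k. \<Sum>j\<in>A k. \<bar>\<xi> k \<omega> * \<xi> i \<omega> * \<xi> j \<omega> * S \<omega>\<bar>"
  let ?R4 = "\<lambda>\<omega>. \<Sum>k\<in>V. \<Sum>i\<in>A k. \<Sum>j\<in>A k. \<Sum>l\<in>A k. \<bar>\<xi> k \<omega> * \<xi> i \<omega> * \<xi> j \<omega> * \<xi> l \<omega>\<bar>"
  have R3i: "integrable M (\<lambda>\<omega>. \<Sum>i\<in>A k. \<Sum>j\<in>A k. \<bar>\<xi> k \<omega> * \<xi> i \<omega> * \<xi> j \<omega> * S \<omega>\<bar>)" if "k \<in> V" for k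
    using that in_A by (intro Bochner_Integration.integrable_sum integrable_abs L4_holder(1) L4_xi LS) auto
  have R4i: "integrable M (\<lambda>\<omega>. \<Sum>i\<in>A k. \<Sum>j\<in>A k. \<Sum>l\<in>A k. \<bar>\<xi> k \<omega> * \<xi> i \<omega> * \<xi> j \<omega> * \<xi> l \<omega>\<bar>)" if "k \<in> V" for k
    using that in_A by (intro Bochner_Integration.integrable_sum integrable_abs L4_holder(1) L4_xi) auto
  have ER3: "expectation ?R3 \<le> T3 * L4_norm S"
  proof -
    have "expectation ?R3 = (\<Sum>k\<in>V. \<Sum>i\<in>A k. \<Sum>j\<in>A k. expectation (\<lambda>\<omega>. \<bar>\<xi> k \<omega> * \<xi> i \<omega> * \<xi> j \<omega> * S \<omega>\<bar>))"
      by (subst Bochner_Integration.integral_sum[OF R3i], assumption)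
         (intro sum.cong refl expectation_double_sum integrable_abs L4_holder(1) L4_xi LS; auto dest: A_memD)
    then show ?thesis using sum_expectation_triple[OF LS] by simp
  qed
  have ER4: "expectation ?R4 \<le> T4"
  proof -
    have "expectation ?R4 = (\<Sum>k\<in>V. \<Sum>i\<in>A k. \<Sum>j\<in>A k. \<Sum>l\<in>A k. expectation (\<lambda>\<omega>. \<bar>\<xi> k \<omega> * \<xi> i \<omega> * \<xi> j \<omega> * \<xi> l \<omega>\<bar>))"
      by (subst Bochner_Integration.integral_sum[OF R4i], assumption)
         (intro sum.cong refl expectation_triple_sum integrable_abs L4_holder(1) L4_xi; auto dest: A_memD)
    then show ?thesis using sum_expectation_star4 by simp
  qed
  have point: "S \<omega> ^ 4 \<le> ?Z \<omega> + (3 * ((S \<omega>)\<^sup>2 * ?T \<omega>) + 3 * ?R3 \<omega> + ?R4 \<omega>)" for \<omega>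
  proof -
    have key: "c k * \<xi> k \<omega> * S \<omega> ^ 3 \<le> c k * (\<xi> k \<omega> * (S \<omega> - \<tau> k \<omega>) ^ 3)
        + 3 * ((S \<omega>)\<^sup>2 * (c k * \<xi> k \<omega> * \<tau> k \<omega>))
        + 3 * (\<Sum>i\<in>A k. \<Sum>j\<in>A k. \<bar>\<xi> k \<omega> * \<xi> i \<omega> * \<xi> j \<omega> * S \<omega>\<bar>)
        + (\<Sum>i\<in>A k. \<Sum>j\<in>A k. \<Sum>l\<in>A k. \<bar>\<xi> k \<omega> * \<xi> i \<omega> * \<xi> j \<omega> * \<xi> l \<omega>\<bar>)"
      if k: "k \<in> V" for k
    proof -
      define a where "a = (\<Sum>j\<in>A k. \<bar>\<xi> j \<omega>\<bar>)"
      have a0: "0 \<le> a" by (simp add: a_def sum_nonneg)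
      have ta: "\<bar>\<tau> k \<omega>\<bar> \<le> a"
        unfolding \<tau>_def a_def
        by (rule order_trans[OF sum_abs sum_mono])
           (use c in_A k in \<open>auto simp: abs_mult intro!: mult_left_le_one_le\<close>)
      have t2: "(\<tau> k \<omega>)\<^sup>2 \<le> a\<^sup>2" and t3: "\<bar>\<tau> k \<omega>\<bar> ^ 3 \<le> a ^ 3"
        using power_mono[OF ta, of 2] power_mono[OF ta, of 3] by auto
      have ck: "\<bar>c k * \<xi> k \<omega>\<bar> \<le> \<bar>\<xi> k \<omega>\<bar>" using c[OF k] by (simp add: abs_mult mult_left_le_one_le)
      have e: "c k * \<xi> k \<omega> * S \<omega> ^ 3 = c k * (\<xi> k \<omega> * (S \<omega> - \<tau> k \<omega>) ^ 3)
        + 3 * ((S \<omega>)\<^sup>2 * (c k * \<xi> k \<omega> * \<tau> k \<omega>)) - 3 * ((c k * \<xi> k \<omega>) * ((\<tau> k \<omega>)\<^sup>2 * S \<omega>))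
        + (c k * \<xi> k \<omega>) * (\<tau> k \<omega>) ^ 3"
        by (simp add: power2_eq_square power3_eq_cube algebra_simps)
      have "\<bar>(c k * \<xi> k \<omega>) * ((\<tau> k \<omega>)\<^sup>2 * S \<omega>)\<bar> \<le> \<bar>\<xi> k \<omega>\<bar> * (a\<^sup>2 * \<bar>S \<omega>\<bar>)"
        unfolding abs_mult[of "c k * \<xi> k \<omega>"] abs_mult[of "(\<tau> k \<omega>)\<^sup>2"] using t2
        by (intro mult_mono ck) auto
      also have "\<dots> = (\<Sum>i\<in>A k. \<Sum>j\<in>A k. \<bar>\<xi> k \<omega> * \<xi> i \<omega> * \<xi> j \<omega> * S \<omega>\<bar>)"
        unfolding a_def power2_eq_square sum_product sum_distrib_left sum_distrib_right abs_mult
        by (simp only: mult_ac)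
      finally have b1: "\<bar>(c k * \<xi> k \<omega>) * ((\<tau> k \<omega>)\<^sup>2 * S \<omega>)\<bar> \<le> (\<Sum>i\<in>A k. \<Sum>j\<in>A k. \<bar>\<xi> k \<omega> * \<xi> i \<omega> * \<xi> j \<omega> * S \<omega>\<bar>)" .
      have "\<bar>(c k * \<xi> k \<omega>) * (\<tau> k \<omega>) ^ 3\<bar> \<le> \<bar>\<xi> k \<omega>\<bar> * a ^ 3"
        unfolding abs_mult[of "c k * \<xi> k \<omega>"] power_abs[symmetric] using t3
        by (intro mult_mono ck) (auto simp: power_abs)
      also have "\<dots> = \<bar>\<xi> k \<omega>\<bar> * (a * (a * a))" by (simp add: power3_eq_cube)
      also have "\<dots> = (\<Sum>i\<in>A k. \<Sum>j\<in>A k. \<Sum>l\<in>A k. \<bar>\<xi> k \<omega> * \<xi> i \<omega> * \<xi> j \<omega> * \<xi> l \<omega>\<bar>)"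
        unfolding a_def sum_product sum_distrib_left sum_distrib_right abs_mult
        by (simp only: mult_ac)
      finally have b2: "\<bar>(c k * \<xi> k \<omega>) * (\<tau> k \<omega>) ^ 3\<bar> \<le> (\<Sum>i\<in>A k. \<Sum>j\<in>A k. \<Sum>l\<in>A k. \<bar>\<xi> k \<omega> * \<xi> i \<omega> * \<xi> j \<omega> * \<xi> l \<omega>\<bar>)" .
      show ?thesis unfolding e using b1 b2 by linarith
    qed
    have "S \<omega> ^ 4 = (\<Sum>k\<in>V. c k * \<xi> k \<omega> * S \<omega> ^ 3)"
      unfolding sum_distrib_right[symmetric] S_def[symmetric] by (simp add: S_def eval_nat_numeral)
    also have "\<dots> \<le> (\<Sum>k\<in>V. c k * (\<xi> k \<omega> * (S \<omega> - \<tau> k \<omega>) ^ 3)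
        + 3 * ((S \<omega>)\<^sup>2 * (c k * \<xi> k \<omega> * \<tau> k \<omega>))
        + 3 * (\<Sum>i\<in>A k. \<Sum>j\<in>A k. \<bar>\<xi> k \<omega> * \<xi> i \<omega> * \<xi> j \<omega> * S \<omega>\<bar>)
        + (\<Sum>i\<in>A k. \<Sum>j\<in>A k. \<Sum>l\<in>A k. \<bar>\<xi> k \<omega> * \<xi> i \<omega> * \<xi> j \<omega> * \<xi> l \<omega>\<bar>))"
      by (intro sum_mono key)
    also have "\<dots> = ?Z \<omega> + 3 * ((S \<omega>)\<^sup>2 * (\<Sum>k\<in>V. c k * \<xi> k \<omega> * \<tau> k \<omega>)) + 3 * ?R3 \<omega> + ?R4 \<omega>"
      by (simp only: sum.distrib sum_distrib_left)
    also have "(\<Sum>k\<in>V. c k * \<xi> k \<omega> * \<tau> k \<omega>) = ?T \<omega>"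
      unfolding \<tau>_def sum_distrib_left by (simp only: mult_ac)
    finally show ?thesis by simp
  qed
  have iZ: "integrable M ?Z" "expectation ?Z = 0"
  proof -
    show "integrable M ?Z" by (intro Bochner_Integration.integrable_sum Bochner_Integration.integrable_mult_right zero(1))
    show "expectation ?Z = 0"
      by (subst Bochner_Integration.integral_sum) (auto intro!: zero sum.neutral)
  qed
  have S2: "S \<in> borel_measurable M" "integrable M (\<lambda>\<omega>. ((S \<omega>)\<^sup>2)\<^sup>2)"
    using LS L4_measurable[OF LS] L4_integrable[OF LS] by auto
  note cs = cauchy_schwarz_expectation[OF _ Tp(1) S2(2) Tp(3)]
  have iST: "integrable M (\<lambda>\<omega>. (S \<omega>)\<^sup>2 * ?T \<omega>)" using cs(1) S2(1) by simp
  have "expectation (\<lambda>\<omega>. (S \<omega>)\<^sup>2 * ?T \<omega>) \<le> expectation (\<lambda>\<omega>. \<bar>(S \<omega>)\<^sup>2 * ?T \<omega>\<bar>)"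
    using iST by (intro integral_mono) auto
  also have "\<dots> \<le> (L4_norm S)\<^sup>2 * q"
    using cs(2) S2(1) unfolding q_def L4_norm_sq by simp
  finally have eST: "expectation (\<lambda>\<omega>. (S \<omega>)\<^sup>2 * ?T \<omega>) \<le> (L4_norm S)\<^sup>2 * q" .
  have iR3: "integrable M ?R3" and iR4: "integrable M ?R4"
    using R3i R4i by (auto intro!: Bochner_Integration.integrable_sum)
  have "L4_norm S ^ 4 \<le> expectation (\<lambda>\<omega>. ?Z \<omega> + (3 * ((S \<omega>)\<^sup>2 * ?T \<omega>) + 3 * ?R3 \<omega> + ?R4 \<omega>))"
    unfolding L4_norm_pow4
    by (intro integral_mono L4_integrable LS point Bochner_Integration.integrable_add
        Bochner_Integration.integrable_mult_right iZ iST iR3 iR4)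
  also have "\<dots> = expectation ?Z + (3 * expectation (\<lambda>\<omega>. (S \<omega>)\<^sup>2 * ?T \<omega>) + 3 * expectation ?R3 + expectation ?R4)"
    using iZ(1) iST iR3 iR4
    by (simp only: Bochner_Integration.integral_add Bochner_Integration.integrable_add
          Bochner_Integration.integrable_mult_right Bochner_Integration.integral_mult_right simp_thms)
  also have "\<dots> \<le> 0 + (3 * ((L4_norm S)\<^sup>2 * q) + 3 * (T3 * L4_norm S) + T4)"
    using eST ER3 ER4 iZ(2) by linarith
  finally show ?thesis by simp
qed

text \<open>
  The preceding inequality is self-bounding: its right-hand side is quadratic in the norm and its left-hand side quartic.
\<close>

lemma weighted_sum_L4_norm:
  fixes c :: "'v \<Rightarrow> real"
  assumes c: "\<And>i. i \<in> V \<Longrightarrow> \<bar>c i\<bar> \<le> 1" and b: "\<beta> \<le> 1" and l: "1 \<le> l"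
    and E: "\<bar>expectation (\<lambda>\<omega>. \<Sum>i\<in>V. \<Sum>j\<in>A i. c i * c j * (\<xi> i \<omega> * \<xi> j \<omega>))\<bar> \<le> l"
  shows "(L4_norm (\<lambda>\<omega>. \<Sum>i\<in>V. c i * \<xi> i \<omega>))\<^sup>2 \<le> 16 * l"
proof -
  define m where "m = L4_norm (\<lambda>\<omega>. \<Sum>i\<in>V. c i * \<xi> i \<omega>)"
  define q where "q = sqrt (expectation (\<lambda>\<omega>. (\<Sum>i\<in>V. \<Sum>j\<in>A i. c i * c j * (\<xi> i \<omega> * \<xi> j \<omega>))\<^sup>2))"
  note w = weighted_pair_sum[of c, OF c, simplified]
  have "q \<le> l + 3 * \<beta>"
    unfolding q_def by (rule L2_norm_triangle_mean[OF w(1,3) E])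
      (use w(4) beta_bounds in \<open>auto simp: power_mult_distrib\<close>)
  then have q: "q \<le> 4 * l" using b l by linarith
  have m0: "0 \<le> m" by (simp add: m_def)
  have T: "T3 \<le> 1" "T4 \<le> 1"
    using beta_bounds b power_le_one[of \<beta> 2] by auto
  have "m ^ 4 \<le> 3 * m\<^sup>2 * q + 3 * T3 * m + T4"
    unfolding m_def q_def by (rule weighted_sum_fourth_moment[OF c])
  also have "\<dots> \<le> 3 * m\<^sup>2 * (4 * l) + 3 * 1 * m + 1"
    using q T m0 by (intro add_mono mult_left_mono mult_right_mono) auto
  finally have m4: "m ^ 4 \<le> 12 * l * m\<^sup>2 + 3 * m + 1" by (simp add: ac_simps)
  show ?thesis
  proof (rule ccontr)
    assume "\<not> ?thesis"
    then have g: "16 * l < m\<^sup>2" by (simp add: m_def)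
    then have g1: "1 < m\<^sup>2" using l by linarith
    then have "1 \<le> m" using m0 by (smt (verit) power_le_one)
    then have mm: "m \<le> m\<^sup>2" by (simp add: power2_eq_square)
    have "16 * l * m\<^sup>2 \<le> m\<^sup>2 * m\<^sup>2" using g by (intro mult_right_mono) auto
    moreover have "m\<^sup>2 * m\<^sup>2 = m ^ 4" by (simp add: power2_eq_square eval_nat_numeral)
    moreover have "4 * 1 * m\<^sup>2 \<le> 4 * l * m\<^sup>2" using l by (intro mult_right_mono) auto
    ultimately show False using m4 mm g1 by linarith
  qed
qed

lemma L4_norm_W:
  assumes "\<beta> \<le> 1" shows "L4_norm W \<le> 4"
proof -
  have "(L4_norm W)\<^sup>2 \<le> 16 * 1"
    using weighted_sum_L4_norm[of "\<lambda>_. 1" 1] assms expectation_Q by simp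
  then have "(L4_norm W)\<^sup>2 \<le> 4\<^sup>2" by simp
  then show ?thesis by (rule power2_le_imp_le) simp
qed

lemma L4_norm_weighted_sum:
  fixes c :: "'v \<Rightarrow> real"
  assumes c: "\<And>i. i \<in> V \<Longrightarrow> \<bar>c i\<bar> \<le> 1" and b: "\<beta> \<le> 1"
  shows "L4_norm (\<lambda>\<omega>. \<Sum>i\<in>V. c i * \<xi> i \<omega>) \<le> 4 * sqrt \<Lambda>"
proof -
  have "(L4_norm (\<lambda>\<omega>. \<Sum>i\<in>V. c i * \<xi> i \<omega>))\<^sup>2 \<le> 16 * \<Lambda>"
    by (rule weighted_sum_L4_norm[OF c b Lambda_ge_1 weighted_pair_sum(5)[OF c]])
  also have "\<dots> = (4 * sqrt \<Lambda>)\<^sup>2" using Lambda_ge_1 by (simp add: power_mult_distrib)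
  finally show ?thesis by (rule power2_le_imp_le) (use Lambda_ge_1 in simp)
qed

lemma Lambda_le: "\<Lambda> \<le> D * (\<Sum>i\<in>V. expectation (\<lambda>\<omega>. (\<xi> i \<omega>)\<^sup>2))"
proof -
  have "\<Lambda> \<le> (\<Sum>i\<in>V. \<Sum>j\<in>A i. (expectation (\<lambda>\<omega>. (\<xi> i \<omega>)\<^sup>2) + expectation (\<lambda>\<omega>. (\<xi> j \<omega>)\<^sup>2)) / 2)"
    unfolding \<Lambda>_def
  proof (intro sum_mono)
    fix i j assume ij: "i \<in> V" "j \<in> A i"
    then have L: "\<xi> i \<in> L4" "\<xi> j \<in> L4" using L4_xi in_A by auto
    have i: "integrable M (\<lambda>\<omega>. (\<xi> i \<omega>)\<^sup>2)" "integrable M (\<lambda>\<omega>. (\<xi> j \<omega>)\<^sup>2)"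
      using L4_holder2(1)[OF L(1) L(1)] L4_holder2(1)[OF L(2) L(2)] by (simp_all add: power2_eq_square)
    have "expectation (\<lambda>\<omega>. \<bar>\<xi> i \<omega> * \<xi> j \<omega>\<bar>) \<le> expectation (\<lambda>\<omega>. ((\<xi> i \<omega>)\<^sup>2 + (\<xi> j \<omega>)\<^sup>2) / 2)"
    proof (rule integral_mono)
      fix \<omega>
      show "\<bar>\<xi> i \<omega> * \<xi> j \<omega>\<bar> \<le> ((\<xi> i \<omega>)\<^sup>2 + (\<xi> j \<omega>)\<^sup>2) / 2"
        using sum_squares_bound[of "\<bar>\<xi> i \<omega>\<bar>" "\<bar>\<xi> j \<omega>\<bar>"] by (simp add: abs_mult)
    qed (use i L4_holder2(1)[OF L] in auto)
    then show "expectation (\<lambda>\<omega>. \<bar>\<xi> i \<omega> * \<xi> j \<omega>\<bar>)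
        \<le> (expectation (\<lambda>\<omega>. (\<xi> i \<omega>)\<^sup>2) + expectation (\<lambda>\<omega>. (\<xi> j \<omega>)\<^sup>2)) / 2"
      using i by simp
  qed
  also have "\<dots> = (\<Sum>i\<in>V. \<Sum>j\<in>A i. expectation (\<lambda>\<omega>. (\<xi> i \<omega>)\<^sup>2) + expectation (\<lambda>\<omega>. (\<xi> j \<omega>)\<^sup>2)) / 2"
    by (simp only: sum_divide_distrib)
  also have "\<dots> \<le> (2 * D * (\<Sum>i\<in>V. expectation (\<lambda>\<omega>. (\<xi> i \<omega>)\<^sup>2))) / 2"
    by (intro divide_right_mono sum_pairs_tree) auto
  finally show ?thesis by simp
qed

text \<open>
  Cauchy-Schwarz over the vertices. This makes \<open>D / card V\<close> small in terms of \<open>\<beta>\<close>, which controls the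
  centring term in the self-normaliser.
\<close>

lemma Lambda_density: "\<Lambda> * sqrt (D / real (card V)) \<le> \<beta>"
proof -
  let ?e = "\<lambda>i. expectation (\<lambda>\<omega>. (\<xi> i \<omega>)\<^sup>2)"
  let ?n = "real (card V)"
  have n: "0 < ?n" using finite_V V_nonempty by (simp add: card_gt_0_iff)
  have e: "(?e i)\<^sup>2 \<le> x i ^ 4" if "i \<in> V" for i
  proof -
    have "?e i \<le> x i * x i"
      using L4_holder2(2)[OF L4_xi[OF that] L4_xi[OF that]] by (simp add: power2_eq_square)
    then have "(?e i)\<^sup>2 \<le> (x i * x i)\<^sup>2" by (intro power_mono) auto
    then show ?thesis by (simp add: power2_eq_square eval_nat_numeral)
  qed
  have "\<Lambda>\<^sup>2 \<le> (D * (\<Sum>i\<in>V. ?e i))\<^sup>2"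
    using Lambda_le Lambda_ge_1 by (intro power_mono) auto
  also have "\<dots> = D\<^sup>2 * (\<Sum>i\<in>V. ?e i)\<^sup>2" by (simp add: power_mult_distrib)
  also have "\<dots> \<le> D\<^sup>2 * ((\<Sum>i\<in>V. (?e i)\<^sup>2) * ?n)"
    using Cauchy_Schwarz_ineq_sum[of ?e "\<lambda>_. 1" V] by (intro mult_left_mono) auto
  also have "\<dots> \<le> D\<^sup>2 * ((\<Sum>i\<in>V. x i ^ 4) * ?n)"
    using e by (intro mult_left_mono mult_right_mono sum_mono) auto
  finally have "\<Lambda>\<^sup>2 * (D / ?n) \<le> (D\<^sup>2 * ((\<Sum>i\<in>V. x i ^ 4) * ?n)) * (D / ?n)"
    using D_pos by (intro mult_right_mono) auto
  also have "\<dots> = T4" using n by (simp add: T4_def power2_eq_square power3_eq_cube)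
  also have "\<dots> \<le> \<beta>\<^sup>2" by (rule beta_bounds)
  finally have "(\<Lambda> * sqrt (D / ?n))\<^sup>2 \<le> \<beta>\<^sup>2" using D_pos by (simp add: power_mult_distrib)
  then show ?thesis by (rule power2_le_imp_le) (rule beta_bounds)
qed

end

section \<open>Errors of the smoothed indicator\<close>

lemma mean_value_bound:
  fixes g :: "real \<Rightarrow> real"
  assumes d: "\<And>w. (g has_real_derivative g' w) (at w)"
    and b: "\<And>w. min u v \<le> w \<Longrightarrow> w \<le> max u v \<Longrightarrow> \<bar>g' w\<bar> \<le> K"
  shows "\<bar>g u - g v\<bar> \<le> K * \<bar>u - v\<bar>"
proof -
  have *: "\<bar>g y - g x\<bar> \<le> K * \<bar>y - x\<bar>" if "x < y" "min u v = x" "max u v = y" for x y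
  proof -
    note xy = that
    obtain \<zeta> where z: "x < \<zeta>" "\<zeta> < y" "g y - g x = (y - x) * g' \<zeta>"
      using MVT2[OF xy(1), of g g'] d by auto
    then have "\<bar>g' \<zeta>\<bar> \<le> K" using b[of \<zeta>] xy by auto
    with z show ?thesis using xy(1) by (simp add: abs_mult mult.commute mult_left_mono)
  qed
  consider "u < v" | "u = v" | "v < u" by linarith
  then show ?thesis
    by cases (use *[of u v] *[of v u] in \<open>auto simp: abs_minus_commute\<close>)
qed

lemma stein_derivative_bound:
  assumes a: "0 < a" and f: "\<bar>w * f w\<bar> \<le> 6" and N: "0 \<le> N" "N \<le> 1"
  shows "\<bar>w * f w + (1 - ramp a z w) - N\<bar> \<le> 7"
  using ramp_bounds[OF a, of z w] f N by linarith

text \<open>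
  By Stein's equation \<open>f' w = w f w + (1 - ramp a z w) - N\<close>. The part \<open>w f w\<close> is locally Lipschitz and gives the quadratic
  term; the ramp gives exactly \<open>ramp_error\<close>.
\<close>

lemma stein_taylor:
  assumes a: "0 < a"
    and df: "\<And>w. (f has_real_derivative (w * f w + (1 - ramp a z w) - N)) (at w)"
    and f6: "\<And>w. \<bar>f w\<bar> \<le> 6" and wf: "\<And>w. \<bar>w * f w\<bar> \<le> 6"
    and N: "0 \<le> N" "N \<le> 1"
  shows "\<bar>f u - f (u - t) - t * (u * f u + (1 - ramp a z u) - N)\<bar>
    \<le> 7 * t\<^sup>2 * (1 + \<bar>u\<bar> + \<bar>t\<bar>) + \<bar>ramp_error a z u t\<bar>"
proof -
  let ?L = "7 * (1 + \<bar>u\<bar> + \<bar>t\<bar>)"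
  define p where "p w = f w + ramp_integral a z w - (1 - N) * w" for w
  (* the derivative of p is w * f w, and s subtracts the linear function with slope u * f u *)
  define s where "s w = p w - w * (u * f u)" for w
  have dwf: "((\<lambda>w. w * f w) has_real_derivative (f w + w * (w * f w + (1 - ramp a z w) - N))) (at w)" for w
    by (auto intro!: derivative_eq_intros df)
  have lip: "\<bar>w * f w - u * f u\<bar> \<le> ?L * \<bar>t\<bar>" if "min u (u - t) \<le> w" "w \<le> max u (u - t)" for w
  proof -
    have "\<bar>w * f w - u * f u\<bar> \<le> ?L * \<bar>w - u\<bar>"
    proof (rule mean_value_bound[OF dwf])
      fix v assume "min w u \<le> v" "v \<le> max w u"
      then have v: "\<bar>v\<bar> \<le> \<bar>u\<bar> + \<bar>t\<bar>" using that by auto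
      have "\<bar>v * (v * f v + (1 - ramp a z v) - N)\<bar> \<le> (\<bar>u\<bar> + \<bar>t\<bar>) * 7"
        unfolding abs_mult[of v] by (intro mult_mono v stein_derivative_bound a wf N) auto
      then have "\<bar>f v + v * (v * f v + (1 - ramp a z v) - N)\<bar> \<le> 6 + (\<bar>u\<bar> + \<bar>t\<bar>) * 7"
        using f6[of v] by (intro order_trans[OF abs_triangle_ineq] add_mono)
      also have "\<dots> \<le> ?L" by simp
      finally show "\<bar>f v + v * (v * f v + (1 - ramp a z v) - N)\<bar> \<le> ?L" .
    qed
    also have "\<dots> \<le> ?L * \<bar>t\<bar>" using that by (intro mult_left_mono) auto
    finally show ?thesis .
  qed
  have ds: "(s has_real_derivative (w * f w - u * f u)) (at w)" for w
    unfolding s_def p_def by (auto intro!: derivative_eq_intros df ramp_integral_has_derivative[OF a])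
  have "\<bar>s u - s (u - t)\<bar> \<le> (?L * \<bar>t\<bar>) * \<bar>u - (u - t)\<bar>"
    by (rule mean_value_bound[OF ds]) (rule lip)
  then have "\<bar>s u - s (u - t)\<bar> \<le> 7 * t\<^sup>2 * (1 + \<bar>u\<bar> + \<bar>t\<bar>)"
    by (simp add: power2_eq_square mult_ac)
  moreover have "f u - f (u - t) - t * (u * f u + (1 - ramp a z u) - N)
      = s u - s (u - t) - ramp_error a z u t"
    by (simp add: s_def p_def ramp_error_def algebra_simps)
  ultimately show ?thesis by linarith
qed

lemma std_normal_cdf_increment:
  assumes "x \<le> y"
  shows "cdf std_normal_distribution y - cdf std_normal_distribution x \<le> y - x"
proof (cases "x < y")
  case True
  interpret real_distribution std_normal_distribution by (rule real_dist_normal_dist)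
  have le1: "std_normal_density u \<le> 1" for u
  proof -
    have "1 / sqrt (2 * pi) \<le> 1" using pi_gt3 by simp
    then have "1 / sqrt (2 * pi) * exp (- u\<^sup>2 / 2) \<le> 1 * 1" by (intro mult_mono) auto
    then show ?thesis by (simp add: std_normal_density_def)
  qed
  have "cdf std_normal_distribution y - cdf std_normal_distribution x
      = measure std_normal_distribution {x<..y}" using cdf_diff_eq[OF True] .
  also have "ennreal \<dots> = emeasure std_normal_distribution {x<..y}" by (simp add: emeasure_eq_measure)
  also have "\<dots> = (\<integral>\<^sup>+u. ennreal (std_normal_density u) * indicator {x<..y} u \<partial>lborel)"
    by (subst emeasure_density) auto
  also have "\<dots> \<le> (\<integral>\<^sup>+u. indicator {x<..y} u \<partial>lborel)"
    using le1 by (intro nn_integral_mono) (auto simp: indicator_def ennreal_le_1)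
  also have "\<dots> = ennreal (y - x)" using assms by simp
  finally show ?thesis using assms by (subst (asm) ennreal_le_iff) auto
qed (use assms in simp)

text \<open>
  Half-open intervals are convenient because their probabilities are differences of distribution functions. The right one
  is taken twice as long as the cell so that it includes both end points.
\<close>

lemma ramp_cell_subset:
  assumes "0 < a"
  shows "ramp_cell a z m \<subseteq> {z - real (Suc m) * a<..z - real m * a}
    \<union> {z + real m * a<..z + real m * a + 2 * a}"
proof
  fix u assume u: "u \<in> ramp_cell a z m"
  then have g: "real m * a \<le> ramp_gap a z u" "ramp_gap a z u < real (Suc m) * a"
    by (auto simp: ramp_cell_def)
  have S: "real (Suc m) * a = real m * a + a" by (simp add: algebra_simps)
  have "0 \<le> real m * a" using assms by simp
  then show "u \<in> {z - real (Suc m) * a<..z - real m * a}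
    \<union> {z + real m * a<..z + real m * a + 2 * a}"
    using g assms unfolding S ramp_gap_def by (auto simp: max_def split: if_splits)
qed

context local_dependence
begin

text \<open>
  The majorant of the ramp error in the cell \<open>m\<close>, a sum over pairs. The factor 2 absorbs \<open>\<bar>G\<bar> \<le> 2\<close>.
\<close>

definition cell_sum :: "real \<Rightarrow> nat \<Rightarrow> 'a \<Rightarrow> real" where
  "cell_sum a m \<omega> = (\<Sum>k\<in>V. \<Sum>j\<in>A k. \<bar>\<xi> k \<omega>\<bar> * split_weight (a / D) m (2 * \<bar>\<xi> j \<omega>\<bar>))"

lemma cell_sum_nonneg: "0 < a \<Longrightarrow> 0 \<le> cell_sum a m \<omega>"
  unfolding cell_sum_def using D_pos
  by (intro sum_nonneg mult_nonneg_nonneg split_weight_bounds) auto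

lemma cell_sum_moments:
  assumes a: "0 < a"
  shows "cell_sum a m \<in> borel_measurable M" "integrable M (cell_sum a m)"
    "integrable M (\<lambda>\<omega>. (cell_sum a m \<omega>)\<^sup>2)"
    "expectation (\<lambda>\<omega>. (cell_sum a m \<omega> - expectation (cell_sum a m))\<^sup>2) \<le> (12 * \<beta>)\<^sup>2"
proof -
  let ?Y = "\<lambda>k j \<omega>. \<bar>\<xi> k \<omega>\<bar> * split_weight (a / D) m (2 * \<bar>\<xi> j \<omega>\<bar>)"
  have gen: "?Y i j \<in> borel_measurable (generated {i, j})" for i j
    by (intro borel_measurable_times borel_measurable_abs xi_pair_generated
        measurable_compose[OF _ measurable_split_weight] borel_measurable_const)
  have bound: "\<bar>?Y i j \<omega>\<bar> \<le> 4 * \<bar>\<xi> i \<omega> * \<xi> j \<omega>\<bar>" for i j \<omega>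
  proof -
    have "0 \<le> split_weight (a / D) m (2 * \<bar>\<xi> j \<omega>\<bar>)" "split_weight (a / D) m (2 * \<bar>\<xi> j \<omega>\<bar>) \<le> 2 * (2 * \<bar>\<xi> j \<omega>\<bar>)"
      using split_weight_bounds[of "a / D" "2 * \<bar>\<xi> j \<omega>\<bar>" m] a D_pos by auto
    then show ?thesis
      using mult_left_mono[of "split_weight (a / D) m (2 * \<bar>\<xi> j \<omega>\<bar>)" "2 * (2 * \<bar>\<xi> j \<omega>\<bar>)" "\<bar>\<xi> i \<omega>\<bar>"]
      by (simp add: abs_mult)
  qed
  note v = pair_sum_variance[of ?Y 4, OF gen bound]
  have eq: "cell_sum a m = (\<lambda>\<omega>. \<Sum>k\<in>V. \<Sum>j\<in>A k. ?Y k j \<omega>)" by (simp add: fun_eq_iff cell_sum_def)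
  show "cell_sum a m \<in> borel_measurable M" "integrable M (cell_sum a m)"
    "integrable M (\<lambda>\<omega>. (cell_sum a m \<omega>)\<^sup>2)" unfolding eq using v(1-3) by auto
  have "expectation (\<lambda>\<omega>. (cell_sum a m \<omega> - expectation (cell_sum a m))\<^sup>2) \<le> 8 * 4\<^sup>2 * T4"
    unfolding eq by (rule v(4)) simp
  also have "\<dots> \<le> (12 * \<beta>)\<^sup>2" using beta_bounds T4_nonneg by (simp add: power_mult_distrib)
  finally show "expectation (\<lambda>\<omega>. (cell_sum a m \<omega> - expectation (cell_sum a m))\<^sup>2) \<le> (12 * \<beta>)\<^sup>2" .
qed

lemma sum_pairs_distrib:
  fixes F G :: "'v \<Rightarrow> 'v \<Rightarrow> real"
  shows "(\<Sum>i\<in>V. \<Sum>j\<in>A i. F i j + G i j) = (\<Sum>i\<in>V. \<Sum>j\<in>A i. F i j) + (\<Sum>i\<in>V. \<Sum>j\<in>A i. G i j)"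
  by (simp only: sum.distrib)

lemma sum_pairs_third_moment:
  "D * (\<Sum>k\<in>V. \<Sum>j\<in>A k. expectation (\<lambda>\<omega>. \<bar>\<xi> k \<omega> * \<xi> j \<omega> * \<xi> j \<omega>\<bar>)) \<le> T3"
proof -
  have "(\<Sum>k\<in>V. \<Sum>j\<in>A k. expectation (\<lambda>\<omega>. \<bar>\<xi> k \<omega> * \<xi> j \<omega> * \<xi> j \<omega>\<bar>))
      \<le> (\<Sum>k\<in>V. \<Sum>j\<in>A k. (x k ^ 3 + x j ^ 3) / 3 + x j ^ 3 / 3)"
  proof (intro sum_mono)
    fix k j assume "k \<in> V" "j \<in> A k"
    then have L: "\<xi> k \<in> L4" "\<xi> j \<in> L4" using L4_xi in_A by auto
    show "expectation (\<lambda>\<omega>. \<bar>\<xi> k \<omega> * \<xi> j \<omega> * \<xi> j \<omega>\<bar>) \<le> (x k ^ 3 + x j ^ 3) / 3 + x j ^ 3 / 3"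
      by (rule order_trans[OF L4_holder3(2)[OF L(1) L(2) L(2)]
            order_trans[OF am_gm_3[OF L4_norm_nonneg L4_norm_nonneg L4_norm_nonneg]]])
         (simp add: add_divide_distrib)
  qed
  also have "\<dots> = (\<Sum>k\<in>V. \<Sum>j\<in>A k. x k ^ 3 + x j ^ 3) / 3 + (\<Sum>k\<in>V. \<Sum>j\<in>A k. x j ^ 3) / 3"
    by (rule trans[OF sum_pairs_distrib]) (simp only: sum_divide_distrib)
  also have "\<dots> \<le> (2 * D * (\<Sum>k\<in>V. x k ^ 3)) / 3 + (D * (\<Sum>k\<in>V. x k ^ 3)) / 3"
    by (intro add_mono divide_right_mono sum_pairs_tree sum_pairs_le_snd) auto
  also have "\<dots> = D * (\<Sum>k\<in>V. x k ^ 3)" by simp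
  finally have "D * (\<Sum>k\<in>V. \<Sum>j\<in>A k. expectation (\<lambda>\<omega>. \<bar>\<xi> k \<omega> * \<xi> j \<omega> * \<xi> j \<omega>\<bar>))
      \<le> D * (D * (\<Sum>k\<in>V. x k ^ 3))"
    using D_pos by (intro mult_left_mono) auto
  then show ?thesis by (simp add: T3_def power2_eq_square)
qed

lemma sum_pairs_fourth_moment:
  "D\<^sup>2 * (\<Sum>k\<in>V. \<Sum>j\<in>A k. expectation (\<lambda>\<omega>. \<bar>\<xi> k \<omega> * \<xi> j \<omega> * \<xi> j \<omega> * \<xi> j \<omega>\<bar>)) \<le> T4"
proof -
  have "(\<Sum>k\<in>V. \<Sum>j\<in>A k. expectation (\<lambda>\<omega>. \<bar>\<xi> k \<omega> * \<xi> j \<omega> * \<xi> j \<omega> * \<xi> j \<omega>\<bar>))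
      \<le> (\<Sum>k\<in>V. \<Sum>j\<in>A k. (x k ^ 4 + x j ^ 4) / 4 + x j ^ 4 / 2)"
  proof (intro sum_mono)
    fix k j assume kj: "k \<in> V" "j \<in> A k"
    then have j: "j \<in> V" using in_A by auto
    show "expectation (\<lambda>\<omega>. \<bar>\<xi> k \<omega> * \<xi> j \<omega> * \<xi> j \<omega> * \<xi> j \<omega>\<bar>) \<le> (x k ^ 4 + x j ^ 4) / 4 + x j ^ 4 / 2"
      using expectation_quadruple_le[OF kj(1) j j j] by (simp add: field_simps)
  qed
  also have "\<dots> = (\<Sum>k\<in>V. \<Sum>j\<in>A k. x k ^ 4 + x j ^ 4) / 4 + (\<Sum>k\<in>V. \<Sum>j\<in>A k. x j ^ 4) / 2"
    by (rule trans[OF sum_pairs_distrib]) (simp only: sum_divide_distrib)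
  also have "\<dots> \<le> (2 * D * (\<Sum>k\<in>V. x k ^ 4)) / 4 + (D * (\<Sum>k\<in>V. x k ^ 4)) / 2"
    by (intro add_mono divide_right_mono sum_pairs_tree sum_pairs_le_snd) auto
  also have "\<dots> = D * (\<Sum>k\<in>V. x k ^ 4)" by simp
  finally have "D\<^sup>2 * (\<Sum>k\<in>V. \<Sum>j\<in>A k. expectation (\<lambda>\<omega>. \<bar>\<xi> k \<omega> * \<xi> j \<omega> * \<xi> j \<omega> * \<xi> j \<omega>\<bar>))
      \<le> D\<^sup>2 * (D * (\<Sum>k\<in>V. x k ^ 4))"
    by (intro mult_left_mono) auto
  then show ?thesis by (simp add: T4_def power2_eq_square power3_eq_cube mult.assoc)
qed

text \<open>
  The sum over all cells is of order \<open>D \<xi>\<^sub>j\<^sup>2 / a\<close> for each pair, so only third moments enter.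
\<close>

lemma cell_sum_total:
  assumes a: "0 < a"
  shows "(\<Sum>m<N. expectation (cell_sum a m)) \<le> 8 * \<beta> / a"
proof -
  have i3: "integrable M (\<lambda>\<omega>. \<bar>\<xi> k \<omega> * \<xi> j \<omega> * \<xi> j \<omega>\<bar>)" if "k \<in> V" "j \<in> A k" for k j
    using that in_A by (intro integrable_abs L4_holder3(1) L4_xi) auto
  have "(\<Sum>m<N. expectation (cell_sum a m)) = expectation (\<lambda>\<omega>. \<Sum>m<N. cell_sum a m \<omega>)"
    by (rule Bochner_Integration.integral_sum[symmetric]) (rule cell_sum_moments(2)[OF a])
  also have "\<dots> \<le> expectation (\<lambda>\<omega>. \<Sum>k\<in>V. \<Sum>j\<in>A k. 8 * D / a * \<bar>\<xi> k \<omega> * \<xi> j \<omega> * \<xi> j \<omega>\<bar>)"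
  proof (rule integral_mono)
    show "integrable M (\<lambda>\<omega>. \<Sum>m<N. cell_sum a m \<omega>)"
      by (intro Bochner_Integration.integrable_sum cell_sum_moments(2)[OF a])
    show "integrable M (\<lambda>\<omega>. \<Sum>k\<in>V. \<Sum>j\<in>A k. 8 * D / a * \<bar>\<xi> k \<omega> * \<xi> j \<omega> * \<xi> j \<omega>\<bar>)"
      by (intro Bochner_Integration.integrable_sum Bochner_Integration.integrable_mult_right i3)
    fix \<omega>
    have "(\<Sum>m<N. cell_sum a m \<omega>) = (\<Sum>k\<in>V. \<Sum>j\<in>A k. \<Sum>m<N. \<bar>\<xi> k \<omega>\<bar> * split_weight (a / D) m (2 * \<bar>\<xi> j \<omega>\<bar>))"
      unfolding cell_sum_def by (subst sum.swap, rule sum.cong[OF refl], rule sum.swap)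
    also have "\<dots> \<le> (\<Sum>k\<in>V. \<Sum>j\<in>A k. 8 * D / a * \<bar>\<xi> k \<omega> * \<xi> j \<omega> * \<xi> j \<omega>\<bar>)"
    proof (intro sum_mono)
      fix k j
      have "(\<Sum>m<N. split_weight (a / D) m (2 * \<bar>\<xi> j \<omega>\<bar>)) \<le> 2 * (2 * \<bar>\<xi> j \<omega>\<bar>)\<^sup>2 / (a / D)"
        using a D_pos by (intro sum_split_weight) auto
      also have "\<dots> = 8 * D / a * (\<bar>\<xi> j \<omega>\<bar> * \<bar>\<xi> j \<omega>\<bar>)" by (simp add: power2_eq_square)
      finally have "\<bar>\<xi> k \<omega>\<bar> * (\<Sum>m<N. split_weight (a / D) m (2 * \<bar>\<xi> j \<omega>\<bar>))
          \<le> \<bar>\<xi> k \<omega>\<bar> * (8 * D / a * (\<bar>\<xi> j \<omega>\<bar> * \<bar>\<xi> j \<omega>\<bar>))" by (intro mult_left_mono) auto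
      then show "(\<Sum>m<N. \<bar>\<xi> k \<omega>\<bar> * split_weight (a / D) m (2 * \<bar>\<xi> j \<omega>\<bar>)) \<le> 8 * D / a * \<bar>\<xi> k \<omega> * \<xi> j \<omega> * \<xi> j \<omega>\<bar>"
        by (simp add: sum_distrib_left abs_mult ac_simps)
    qed
    finally show "(\<Sum>m<N. cell_sum a m \<omega>) \<le> (\<Sum>k\<in>V. \<Sum>j\<in>A k. 8 * D / a * \<bar>\<xi> k \<omega> * \<xi> j \<omega> * \<xi> j \<omega>\<bar>)" .
  qed
  also have "\<dots> = (\<Sum>k\<in>V. \<Sum>j\<in>A k. expectation (\<lambda>\<omega>. 8 * D / a * \<bar>\<xi> k \<omega> * \<xi> j \<omega> * \<xi> j \<omega>\<bar>))"
    by (rule expectation_sum_pairs(2)) (intro Bochner_Integration.integrable_mult_right i3)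
  also have "\<dots> = 8 / a * (D * (\<Sum>k\<in>V. \<Sum>j\<in>A k. expectation (\<lambda>\<omega>. \<bar>\<xi> k \<omega> * \<xi> j \<omega> * \<xi> j \<omega>\<bar>)))"
    by (simp add: sum_distrib_left mult.assoc)
  also have "\<dots> \<le> 8 / a * \<beta>"
    using a order_trans[OF sum_pairs_third_moment beta_bounds(2)] by (intro mult_left_mono) auto
  finally show ?thesis by simp
qed

text \<open>
  Beyond distance \<open>sqrt a\<close> a step is so large that a fourth moment pays for it.
\<close>

lemma cell_sum_tail:
  assumes a: "0 < a" and m: "1 \<le> m" "1 \<le> (real m)\<^sup>2 * a"
  shows "expectation (cell_sum a m) \<le> 8 * \<beta>\<^sup>2 / a"
proof -
  have y: "0 < real m * (a / D)" using a D_pos m by simp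
  have i4: "integrable M (\<lambda>\<omega>. \<bar>\<xi> k \<omega> * \<xi> j \<omega> * \<xi> j \<omega> * \<xi> j \<omega>\<bar>)" if "k \<in> V" "j \<in> A k" for k j
    using that in_A by (intro integrable_abs L4_holder(1) L4_xi) auto
  have "expectation (cell_sum a m) \<le> expectation (\<lambda>\<omega>. \<Sum>k\<in>V. \<Sum>j\<in>A k. 8 * D\<^sup>2 / a * \<bar>\<xi> k \<omega> * \<xi> j \<omega> * \<xi> j \<omega> * \<xi> j \<omega>\<bar>)"
  proof (rule integral_mono)
    show "integrable M (cell_sum a m)" by (rule cell_sum_moments(2)[OF a])
    show "integrable M (\<lambda>\<omega>. \<Sum>k\<in>V. \<Sum>j\<in>A k. 8 * D\<^sup>2 / a * \<bar>\<xi> k \<omega> * \<xi> j \<omega> * \<xi> j \<omega> * \<xi> j \<omega>\<bar>)"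
      by (intro Bochner_Integration.integrable_sum Bochner_Integration.integrable_mult_right i4)
    fix \<omega>
    show "cell_sum a m \<omega> \<le> (\<Sum>k\<in>V. \<Sum>j\<in>A k. 8 * D\<^sup>2 / a * \<bar>\<xi> k \<omega> * \<xi> j \<omega> * \<xi> j \<omega> * \<xi> j \<omega>\<bar>)"
      unfolding cell_sum_def
    proof (intro sum_mono)
      fix k j
      have "split_weight (a / D) m (2 * \<bar>\<xi> j \<omega>\<bar>) \<le> (2 * \<bar>\<xi> j \<omega>\<bar>) ^ 3 / (real m * (a / D))\<^sup>2"
        using split_weight_tail[OF y, of "2 * \<bar>\<xi> j \<omega>\<bar>"] m by (simp add: split_weight_def)
      also have "\<dots> \<le> (2 * \<bar>\<xi> j \<omega>\<bar>) ^ 3 / (a / D\<^sup>2)"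
      proof (rule divide_left_mono)
        have "1 * (a / D\<^sup>2) \<le> ((real m)\<^sup>2 * a) * (a / D\<^sup>2)"
          using a m D_pos by (intro mult_right_mono) auto
        then show "a / D\<^sup>2 \<le> (real m * (a / D))\<^sup>2"
          by (simp add: power_mult_distrib power_divide power2_eq_square ac_simps)
        show "0 < (real m * (a / D))\<^sup>2 * (a / D\<^sup>2)"
          using a D_pos by (intro mult_pos_pos zero_less_power y divide_pos_pos)
      qed auto
      also have "\<dots> = 8 * D\<^sup>2 / a * (\<bar>\<xi> j \<omega>\<bar> * \<bar>\<xi> j \<omega>\<bar> * \<bar>\<xi> j \<omega>\<bar>)"
        by (simp add: power3_eq_cube)
      finally have "\<bar>\<xi> k \<omega>\<bar> * split_weight (a / D) m (2 * \<bar>\<xi> j \<omega>\<bar>)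
          \<le> \<bar>\<xi> k \<omega>\<bar> * (8 * D\<^sup>2 / a * (\<bar>\<xi> j \<omega>\<bar> * \<bar>\<xi> j \<omega>\<bar> * \<bar>\<xi> j \<omega>\<bar>))" by (intro mult_left_mono) auto
      then show "\<bar>\<xi> k \<omega>\<bar> * split_weight (a / D) m (2 * \<bar>\<xi> j \<omega>\<bar>) \<le> 8 * D\<^sup>2 / a * \<bar>\<xi> k \<omega> * \<xi> j \<omega> * \<xi> j \<omega> * \<xi> j \<omega>\<bar>"
        by (simp only: abs_mult mult_ac)
    qed
  qed
  also have "\<dots> = (\<Sum>k\<in>V. \<Sum>j\<in>A k. expectation (\<lambda>\<omega>. 8 * D\<^sup>2 / a * \<bar>\<xi> k \<omega> * \<xi> j \<omega> * \<xi> j \<omega> * \<xi> j \<omega>\<bar>))"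
    by (rule expectation_sum_pairs(2)) (intro Bochner_Integration.integrable_mult_right i4)
  also have "\<dots> = 8 / a * (D\<^sup>2 * (\<Sum>k\<in>V. \<Sum>j\<in>A k. expectation (\<lambda>\<omega>. \<bar>\<xi> k \<omega> * \<xi> j \<omega> * \<xi> j \<omega> * \<xi> j \<omega>\<bar>)))"
    by (simp add: sum_distrib_left mult.assoc)
  also have "\<dots> \<le> 8 / a * \<beta>\<^sup>2"
    using a order_trans[OF sum_pairs_fourth_moment beta_bounds(3)] by (intro mult_left_mono) auto
  finally show ?thesis by simp
qed

end

section \<open>Stein's method for a locally perturbed sum\<close>

context local_dependence
begin

lemma sum_square_nbhd:
  assumes Z: "Z \<in> L4"
  shows "\<And>k. k \<in> V \<Longrightarrow> integrable M (\<lambda>\<omega>. \<bar>\<xi> k \<omega>\<bar> * (\<eta> k \<omega>)\<^sup>2 * \<bar>Z \<omega>\<bar>)"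
    and "(\<Sum>k\<in>V. expectation (\<lambda>\<omega>. \<bar>\<xi> k \<omega>\<bar> * (\<eta> k \<omega>)\<^sup>2 * \<bar>Z \<omega>\<bar>)) \<le> T3 * L4_norm Z"
proof -
  have i: "integrable M (\<lambda>\<omega>. \<bar>\<xi> k \<omega>\<bar> * (\<eta> k \<omega>)\<^sup>2 * \<bar>Z \<omega>\<bar>)" if "k \<in> V" for k
  proof -
    have "\<bar>\<xi> k \<omega>\<bar> * (\<eta> k \<omega>)\<^sup>2 * \<bar>Z \<omega>\<bar> = \<bar>\<xi> k \<omega> * \<eta> k \<omega> * \<eta> k \<omega> * Z \<omega>\<bar>" for \<omega>
    proof -
      have "\<xi> k \<omega> * \<eta> k \<omega> * \<eta> k \<omega> * Z \<omega> = \<xi> k \<omega> * (\<eta> k \<omega>)\<^sup>2 * Z \<omega>"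
        by (simp add: power2_eq_square)
      then show ?thesis by (simp only: abs_mult abs_power2)
    qed
    then show ?thesis
      using integrable_abs[OF L4_holder(1)[OF L4_xi[OF that] L4_eta[OF that] L4_eta[OF that] Z]] by (simp only:)
  qed
  then show "\<And>k. k \<in> V \<Longrightarrow> integrable M (\<lambda>\<omega>. \<bar>\<xi> k \<omega>\<bar> * (\<eta> k \<omega>)\<^sup>2 * \<bar>Z \<omega>\<bar>)" .
  have "expectation (\<lambda>\<omega>. \<bar>\<xi> k \<omega>\<bar> * (\<eta> k \<omega>)\<^sup>2 * \<bar>Z \<omega>\<bar>)
      \<le> (\<Sum>i\<in>A k. \<Sum>j\<in>A k. expectation (\<lambda>\<omega>. \<bar>\<xi> k \<omega> * \<xi> i \<omega> * \<xi> j \<omega> * Z \<omega>\<bar>))" if k: "k \<in> V" for k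
  proof -
    have iF: "integrable M (\<lambda>\<omega>. \<bar>\<xi> k \<omega> * \<xi> i \<omega> * \<xi> j \<omega> * Z \<omega>\<bar>)" if "i \<in> A k" "j \<in> A k" for i j
      using that k in_A by (intro integrable_abs L4_holder(1) L4_xi Z) auto
    have "expectation (\<lambda>\<omega>. \<bar>\<xi> k \<omega>\<bar> * (\<eta> k \<omega>)\<^sup>2 * \<bar>Z \<omega>\<bar>)
        \<le> expectation (\<lambda>\<omega>. \<Sum>i\<in>A k. \<Sum>j\<in>A k. \<bar>\<xi> k \<omega> * \<xi> i \<omega> * \<xi> j \<omega> * Z \<omega>\<bar>)"
    proof (intro integral_mono i k Bochner_Integration.integrable_sum iF)
      fix \<omega>
      have "\<bar>\<eta> k \<omega>\<bar> \<le> (\<Sum>j\<in>A k. \<bar>\<xi> j \<omega>\<bar>)" by (rule sum_abs)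
      from power_mono[OF this, of 2] have e: "(\<eta> k \<omega>)\<^sup>2 \<le> (\<Sum>j\<in>A k. \<bar>\<xi> j \<omega>\<bar>)\<^sup>2" by simp
      have "\<bar>\<xi> k \<omega>\<bar> * (\<eta> k \<omega>)\<^sup>2 * \<bar>Z \<omega>\<bar> \<le> \<bar>\<xi> k \<omega>\<bar> * (\<Sum>j\<in>A k. \<bar>\<xi> j \<omega>\<bar>)\<^sup>2 * \<bar>Z \<omega>\<bar>"
        by (intro mult_right_mono mult_left_mono e) auto
      also have "\<dots> = (\<Sum>i\<in>A k. \<Sum>j\<in>A k. \<bar>\<xi> k \<omega> * \<xi> i \<omega> * \<xi> j \<omega> * Z \<omega>\<bar>)"
        unfolding power2_eq_square sum_product sum_distrib_left sum_distrib_right abs_mult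
        by (simp only: mult_ac)
      finally show "\<bar>\<xi> k \<omega>\<bar> * (\<eta> k \<omega>)\<^sup>2 * \<bar>Z \<omega>\<bar>
          \<le> (\<Sum>i\<in>A k. \<Sum>j\<in>A k. \<bar>\<xi> k \<omega> * \<xi> i \<omega> * \<xi> j \<omega> * Z \<omega>\<bar>)" .
    qed
    then show ?thesis by (subst (asm) expectation_double_sum) (use iF in auto)
  qed
  then have "(\<Sum>k\<in>V. expectation (\<lambda>\<omega>. \<bar>\<xi> k \<omega>\<bar> * (\<eta> k \<omega>)\<^sup>2 * \<bar>Z \<omega>\<bar>))
    \<le> (\<Sum>k\<in>V. \<Sum>i\<in>A k. \<Sum>j\<in>A k. expectation (\<lambda>\<omega>. \<bar>\<xi> k \<omega> * \<xi> i \<omega> * \<xi> j \<omega> * Z \<omega>\<bar>))"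
    by (rule sum_mono)
  also have "\<dots> \<le> T3 * L4_norm Z" by (rule sum_expectation_triple[OF Z])
  finally show "(\<Sum>k\<in>V. expectation (\<lambda>\<omega>. \<bar>\<xi> k \<omega>\<bar> * (\<eta> k \<omega>)\<^sup>2 * \<bar>Z \<omega>\<bar>)) \<le> T3 * L4_norm Z" .
qed

lemma sum_cube_nbhd:
  shows "\<And>k. k \<in> V \<Longrightarrow> integrable M (\<lambda>\<omega>. \<bar>\<xi> k \<omega>\<bar> * \<bar>\<eta> k \<omega>\<bar> ^ 3)"
    and "(\<Sum>k\<in>V. expectation (\<lambda>\<omega>. \<bar>\<xi> k \<omega>\<bar> * \<bar>\<eta> k \<omega>\<bar> ^ 3)) \<le> T4"
proof -
  have i: "integrable M (\<lambda>\<omega>. \<bar>\<xi> k \<omega>\<bar> * \<bar>\<eta> k \<omega>\<bar> ^ 3)" if "k \<in> V" for k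
    using integrable_abs[OF L4_holder(1)[OF L4_xi[OF that] L4_eta[OF that] L4_eta[OF that] L4_eta[OF that]]]
    unfolding abs_mult power3_eq_cube mult.assoc .
  then show "\<And>k. k \<in> V \<Longrightarrow> integrable M (\<lambda>\<omega>. \<bar>\<xi> k \<omega>\<bar> * \<bar>\<eta> k \<omega>\<bar> ^ 3)" .
  have "expectation (\<lambda>\<omega>. \<bar>\<xi> k \<omega>\<bar> * \<bar>\<eta> k \<omega>\<bar> ^ 3)
      \<le> (\<Sum>i\<in>A k. \<Sum>j\<in>A k. \<Sum>l\<in>A k. expectation (\<lambda>\<omega>. \<bar>\<xi> k \<omega> * \<xi> i \<omega> * \<xi> j \<omega> * \<xi> l \<omega>\<bar>))" if k: "k \<in> V" for k
  proof -
    have iF: "integrable M (\<lambda>\<omega>. \<bar>\<xi> k \<omega> * \<xi> i \<omega> * \<xi> j \<omega> * \<xi> l \<omega>\<bar>)"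
      if "i \<in> A k" "j \<in> A k" "l \<in> A k" for i j l
      using that k in_A by (intro integrable_abs L4_holder(1) L4_xi) auto
    have "expectation (\<lambda>\<omega>. \<bar>\<xi> k \<omega>\<bar> * \<bar>\<eta> k \<omega>\<bar> ^ 3)
        \<le> expectation (\<lambda>\<omega>. \<Sum>i\<in>A k. \<Sum>j\<in>A k. \<Sum>l\<in>A k. \<bar>\<xi> k \<omega> * \<xi> i \<omega> * \<xi> j \<omega> * \<xi> l \<omega>\<bar>)"
    proof (intro integral_mono i k Bochner_Integration.integrable_sum iF)
      fix \<omega>
      let ?a = "\<Sum>j\<in>A k. \<bar>\<xi> j \<omega>\<bar>"
      have e: "\<bar>\<eta> k \<omega>\<bar> ^ 3 \<le> ?a ^ 3" by (intro power_mono sum_abs) simp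
      have "\<bar>\<xi> k \<omega>\<bar> * \<bar>\<eta> k \<omega>\<bar> ^ 3 \<le> \<bar>\<xi> k \<omega>\<bar> * ?a ^ 3"
        by (intro mult_left_mono e) auto
      also have "\<dots> = \<bar>\<xi> k \<omega>\<bar> * (?a * (?a * ?a))" by (simp add: power3_eq_cube)
      also have "\<dots> = (\<Sum>i\<in>A k. \<Sum>j\<in>A k. \<Sum>l\<in>A k. \<bar>\<xi> k \<omega> * \<xi> i \<omega> * \<xi> j \<omega> * \<xi> l \<omega>\<bar>)"
        unfolding sum_product sum_distrib_left sum_distrib_right abs_mult
        by (simp only: mult_ac)
      finally show "\<bar>\<xi> k \<omega>\<bar> * \<bar>\<eta> k \<omega>\<bar> ^ 3
          \<le> (\<Sum>i\<in>A k. \<Sum>j\<in>A k. \<Sum>l\<in>A k. \<bar>\<xi> k \<omega> * \<xi> i \<omega> * \<xi> j \<omega> * \<xi> l \<omega>\<bar>)" .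
    qed
    then show ?thesis by (subst (asm) expectation_triple_sum) (use iF in auto)
  qed
  then have "(\<Sum>k\<in>V. expectation (\<lambda>\<omega>. \<bar>\<xi> k \<omega>\<bar> * \<bar>\<eta> k \<omega>\<bar> ^ 3))
    \<le> (\<Sum>k\<in>V. \<Sum>i\<in>A k. \<Sum>j\<in>A k. \<Sum>l\<in>A k. expectation (\<lambda>\<omega>. \<bar>\<xi> k \<omega> * \<xi> i \<omega> * \<xi> j \<omega> * \<xi> l \<omega>\<bar>))"
    by (rule sum_mono)
  also have "\<dots> \<le> T4" by (rule sum_expectation_star4)
  finally show "(\<Sum>k\<in>V. expectation (\<lambda>\<omega>. \<bar>\<xi> k \<omega>\<bar> * \<bar>\<eta> k \<omega>\<bar> ^ 3)) \<le> T4" .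
qed

lemma beta_pos: "0 < \<beta>"
proof -
  have "0 < \<Lambda> * sqrt (D / real (card V))"
    using Lambda_ge_1 D_pos finite_V V_nonempty by (intro mult_pos_pos) (auto simp: card_gt_0_iff)
  then show ?thesis using Lambda_density by linarith
qed

end

text \<open>
  The statistic is \<open>U = W G\<close> with a bounded random factor \<open>G\<close>, and \<open>G' k\<close> replaces \<open>G\<close> when the neighbourhood of \<open>k\<close> is
  left out. The distance to the normal law is controlled by \<open>\<beta>\<close> and two further errors: \<open>leave_error\<close> for passing from \<open>G\<close> to \<open>G' k\<close>, and
  \<open>scale_error\<close> for the deviation of \<open>G\<^sup>2 Q\<close> from 1.
\<close>

locale perturbed_sum = local_dependence +
  fixes G :: "'a \<Rightarrow> real" and G' :: "'b \<Rightarrow> 'a \<Rightarrow> real"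
  assumes G_measurable: "G \<in> borel_measurable M"
    and G_bound: "\<And>\<omega>. \<bar>G \<omega>\<bar> \<le> 2"
    and G'_generated: "\<And>k. k \<in> V \<Longrightarrow> G' k \<in> borel_measurable (generated (V - A k))"
    and G'_bound: "\<And>k \<omega>. \<bar>G' k \<omega>\<bar> \<le> 2"
    and beta_le_1: "\<beta> \<le> 1"
begin

abbreviation "U \<equiv> \<lambda>\<omega>. W \<omega> * G \<omega>"
abbreviation "rest \<equiv> \<lambda>k \<omega>. W \<omega> - \<eta> k \<omega>"

definition leave_error :: real where
  "leave_error = (\<Sum>k\<in>V. expectation (\<lambda>\<omega>. \<bar>\<xi> k \<omega>\<bar> * \<bar>G \<omega> - G' k \<omega>\<bar> * (1 + \<bar>rest k \<omega>\<bar>)))"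

definition scale_error :: real where
  "scale_error = expectation (\<lambda>\<omega>. \<bar>1 - (G \<omega>)\<^sup>2 * Q \<omega>\<bar>)"

text \<open>
  The Kolmogorov distance between \<open>U\<close> and the standard normal law.
\<close>

definition \<delta> :: real where
  "\<delta> = (SUP z. \<bar>prob {\<omega> \<in> space M. U \<omega> \<le> z} - cdf std_normal_distribution z\<bar>)"

lemma W_measurable [measurable]: "W \<in> borel_measurable M"
  using L4_measurable[OF L4_W] .

lemma eta_measurable: "k \<in> V \<Longrightarrow> \<eta> k \<in> borel_measurable M"
  using L4_measurable[OF L4_eta] .

lemma U_measurable [measurable]: "U \<in> borel_measurable M"
  using G_measurable by measurable

lemma G'_measurable: "k \<in> V \<Longrightarrow> G' k \<in> borel_measurable M"
  using generated_measurable[OF _ G'_generated] by auto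

lemma rest_L4: "k \<in> V \<Longrightarrow> rest k \<in> L4"
  by (intro L4_diff L4_W L4_eta)

lemma rest_generated: "k \<in> V \<Longrightarrow> rest k \<in> borel_measurable (generated (V - A k))"
  unfolding sum_minus_nbhd by (intro borel_measurable_sum xi_generated)

lemma leave_error_integrable:
  assumes k: "k \<in> V"
  shows "integrable M (\<lambda>\<omega>. \<bar>\<xi> k \<omega>\<bar> * \<bar>G \<omega> - G' k \<omega>\<bar> * (1 + \<bar>rest k \<omega>\<bar>))"
proof -
  have "integrable M (\<lambda>\<omega>. 4 * (\<bar>\<xi> k \<omega>\<bar> + \<bar>\<xi> k \<omega> * rest k \<omega>\<bar>))"
    using L4_holder1(1)[OF L4_xi[OF k]] L4_holder2(1)[OF L4_xi[OF k] rest_L4[OF k]] by auto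
  then show ?thesis
  proof (rule Bochner_Integration.integrable_bound)
    show "(\<lambda>\<omega>. \<bar>\<xi> k \<omega>\<bar> * \<bar>G \<omega> - G' k \<omega>\<bar> * (1 + \<bar>rest k \<omega>\<bar>)) \<in> borel_measurable M"
      using G_measurable G'_measurable[OF k] xi_measurable[OF k] L4_measurable[OF rest_L4[OF k]] by measurable
    show "AE \<omega> in M. norm (\<bar>\<xi> k \<omega>\<bar> * \<bar>G \<omega> - G' k \<omega>\<bar> * (1 + \<bar>rest k \<omega>\<bar>))
        \<le> norm (4 * (\<bar>\<xi> k \<omega>\<bar> + \<bar>\<xi> k \<omega> * rest k \<omega>\<bar>))"
    proof (rule AE_I2)
      fix \<omega>
      have "\<bar>G \<omega> - G' k \<omega>\<bar> \<le> 4" using G_bound[of \<omega>] G'_bound[of k \<omega>] by linarith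
      then have "\<bar>\<xi> k \<omega>\<bar> * \<bar>G \<omega> - G' k \<omega>\<bar> * (1 + \<bar>rest k \<omega>\<bar>) \<le> \<bar>\<xi> k \<omega>\<bar> * 4 * (1 + \<bar>rest k \<omega>\<bar>)"
        by (intro mult_right_mono mult_left_mono) auto
      also have "\<dots> = 4 * (\<bar>\<xi> k \<omega>\<bar> + \<bar>\<xi> k \<omega> * rest k \<omega>\<bar>)"
        unfolding abs_mult by (simp add: distrib_left mult_ac)
      finally have le: "\<bar>\<xi> k \<omega>\<bar> * \<bar>G \<omega> - G' k \<omega>\<bar> * (1 + \<bar>rest k \<omega>\<bar>)
        \<le> 4 * (\<bar>\<xi> k \<omega>\<bar> + \<bar>\<xi> k \<omega> * rest k \<omega>\<bar>)" .
      have nn: "0 \<le> \<bar>\<xi> k \<omega>\<bar> * \<bar>G \<omega> - G' k \<omega>\<bar> * (1 + \<bar>rest k \<omega>\<bar>)"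
        by (intro mult_nonneg_nonneg) auto
      show "norm (\<bar>\<xi> k \<omega>\<bar> * \<bar>G \<omega> - G' k \<omega>\<bar> * (1 + \<bar>rest k \<omega>\<bar>))
        \<le> norm (4 * (\<bar>\<xi> k \<omega>\<bar> + \<bar>\<xi> k \<omega> * rest k \<omega>\<bar>))"
        unfolding real_norm_def abs_of_nonneg[OF nn] by (rule order_trans[OF le abs_ge_self])
    qed
  qed
qed

lemma scale_error_integrable: "integrable M (\<lambda>\<omega>. \<bar>1 - (G \<omega>)\<^sup>2 * Q \<omega>\<bar>)"
proof -
  note q = weighted_pair_sum(1,2)[of "\<lambda>_. 1", simplified]
  have "integrable M (\<lambda>\<omega>. 1 + 4 * \<bar>Q \<omega>\<bar>)" using q by auto
  then show ?thesis
  proof (rule Bochner_Integration.integrable_bound)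
    show "AE \<omega> in M. norm \<bar>1 - (G \<omega>)\<^sup>2 * Q \<omega>\<bar> \<le> norm (1 + 4 * \<bar>Q \<omega>\<bar>)"
    proof (rule AE_I2)
      fix \<omega>
      have "(G \<omega>)\<^sup>2 \<le> 2\<^sup>2" using power_mono[OF G_bound[of \<omega>], of 2] by simp
      then have "(G \<omega>)\<^sup>2 * \<bar>Q \<omega>\<bar> \<le> 4 * \<bar>Q \<omega>\<bar>" by (intro mult_right_mono) auto
      moreover have "\<bar>1 - (G \<omega>)\<^sup>2 * Q \<omega>\<bar> \<le> 1 + (G \<omega>)\<^sup>2 * \<bar>Q \<omega>\<bar>"
        using abs_triangle_ineq4[of 1 "(G \<omega>)\<^sup>2 * Q \<omega>"] by (simp add: abs_mult)
      ultimately show "norm \<bar>1 - (G \<omega>)\<^sup>2 * Q \<omega>\<bar> \<le> norm (1 + 4 * \<bar>Q \<omega>\<bar>)" by simp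
    qed
  qed (use q(1) G_measurable in measurable)
qed

text \<open>
  The expansion of Stein's method before taking expectations. The sum on the left has expectation zero, and
  \<open>1 - ramp a z U - N\<close> is \<open>f'(U) - U f(U)\<close>.
\<close>

lemma stein_pointwise:
  assumes a: "0 < a"
    and df: "\<And>w. (f has_real_derivative (w * f w + (1 - ramp a z w) - N)) (at w)"
    and f6: "\<And>w. \<bar>f w\<bar> \<le> 6" and wf: "\<And>w. \<bar>w * f w\<bar> \<le> 6"
    and N: "0 \<le> N" "N \<le> 1"
  shows "\<bar>(1 - ramp a z (U \<omega>) - N) + (\<Sum>k\<in>V. \<xi> k \<omega> * (G' k \<omega> * f (rest k \<omega> * G' k \<omega>)))\<bar>
    \<le> 7 * \<bar>1 - (G \<omega>)\<^sup>2 * Q \<omega>\<bar>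
      + (\<Sum>k\<in>V. 14 * (\<bar>\<xi> k \<omega>\<bar> * \<bar>G \<omega> - G' k \<omega>\<bar> * (1 + \<bar>rest k \<omega>\<bar>))
         + 56 * (\<bar>\<xi> k \<omega>\<bar> * (\<eta> k \<omega>)\<^sup>2 * \<bar>1\<bar> + 2 * (\<bar>\<xi> k \<omega>\<bar> * (\<eta> k \<omega>)\<^sup>2 * \<bar>W \<omega>\<bar>)
                + 2 * (\<bar>\<xi> k \<omega>\<bar> * \<bar>\<eta> k \<omega>\<bar> ^ 3))
         + 2 * (\<bar>\<xi> k \<omega>\<bar> * \<bar>ramp_error a z (U \<omega>) (G \<omega> * \<eta> k \<omega>)\<bar>))"
proof -
  let ?u = "U \<omega>" and ?g = "G \<omega>"
  let ?d = "?u * f ?u + (1 - ramp a z ?u) - N"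
  have d7: "\<bar>w * f w + (1 - ramp a z w) - N\<bar> \<le> 7" for w
    by (intro stein_derivative_bound a wf N)
  (* the remainder of the first-order expansion at the index k *)
  define r where "r k = ?g * f ?u - G' k \<omega> * f (rest k \<omega> * G' k \<omega>) - ?g\<^sup>2 * \<eta> k \<omega> * ?d" for k
  have rk: "\<bar>r k\<bar> \<le> 14 * (\<bar>?g - G' k \<omega>\<bar> * (1 + \<bar>rest k \<omega>\<bar>))
      + 56 * ((\<eta> k \<omega>)\<^sup>2 + 2 * ((\<eta> k \<omega>)\<^sup>2 * \<bar>W \<omega>\<bar>) + 2 * \<bar>\<eta> k \<omega>\<bar> ^ 3)
      + 2 * \<bar>ramp_error a z ?u (?g * \<eta> k \<omega>)\<bar>" for k
  proof -
    let ?t = "?g * \<eta> k \<omega>" and ?w = "rest k \<omega>"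
    have ut: "?u - ?t = ?w * ?g" by (simp add: algebra_simps)
    define e where "e = f ?u - f (?u - ?t) - ?t * ?d"
    have e: "\<bar>e\<bar> \<le> 7 * ?t\<^sup>2 * (1 + \<bar>?u\<bar> + \<bar>?t\<bar>) + \<bar>ramp_error a z ?u ?t\<bar>"
      unfolding e_def by (rule stein_taylor[OF a df f6 wf N])
    (* first the step of U with G fixed, then the change of G inside f, then the change of the factor G *)
    have r: "r k = ?g * e + ?g * (f (?w * ?g) - f (?w * G' k \<omega>)) + (?g - G' k \<omega>) * f (?w * G' k \<omega>)"
      unfolding r_def e_def ut by (simp add: algebra_simps power2_eq_square)
    have lip: "\<bar>f (?w * ?g) - f (?w * G' k \<omega>)\<bar> \<le> 7 * \<bar>?w * ?g - ?w * G' k \<omega>\<bar>"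
      by (rule mean_value_bound[OF df]) (rule d7)
    have "\<bar>?w * ?g - ?w * G' k \<omega>\<bar> = \<bar>?w\<bar> * \<bar>?g - G' k \<omega>\<bar>"
      by (simp add: abs_mult[symmetric] right_diff_distrib)
    with lip have b2: "\<bar>?g * (f (?w * ?g) - f (?w * G' k \<omega>))\<bar> \<le> 2 * (7 * (\<bar>?w\<bar> * \<bar>?g - G' k \<omega>\<bar>))"
      unfolding abs_mult[of ?g] by (intro mult_mono G_bound) auto
    have b3: "\<bar>(?g - G' k \<omega>) * f (?w * G' k \<omega>)\<bar> \<le> \<bar>?g - G' k \<omega>\<bar> * 6"
      unfolding abs_mult by (intro mult_left_mono f6) auto
    have b1: "\<bar>?g * e\<bar> \<le> 2 * \<bar>e\<bar>"
      unfolding abs_mult by (intro mult_right_mono G_bound) auto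
    have e28: "\<bar>e\<bar> \<le> 28 * ((\<eta> k \<omega>)\<^sup>2 + 2 * ((\<eta> k \<omega>)\<^sup>2 * \<bar>W \<omega>\<bar>) + 2 * \<bar>\<eta> k \<omega>\<bar> ^ 3)
        + \<bar>ramp_error a z ?u ?t\<bar>"
    proof -
      have "\<bar>?t\<bar> \<le> 2 * \<bar>\<eta> k \<omega>\<bar>" "\<bar>?u\<bar> \<le> 2 * \<bar>W \<omega>\<bar>"
        using G_bound[of \<omega>] unfolding abs_mult by (auto intro: mult_right_mono simp: mult.commute[of _ "\<bar>G \<omega>\<bar>"])
      moreover from power_mono[OF this(1), of 2] have "?t\<^sup>2 \<le> 4 * (\<eta> k \<omega>)\<^sup>2" by (simp add: power_mult_distrib)
      ultimately have "7 * ?t\<^sup>2 * (1 + \<bar>?u\<bar> + \<bar>?t\<bar>) \<le> 7 * (4 * (\<eta> k \<omega>)\<^sup>2) * (1 + 2 * \<bar>W \<omega>\<bar> + 2 * \<bar>\<eta> k \<omega>\<bar>)"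
        by (intro mult_mono) auto
      also have "\<dots> = 28 * ((\<eta> k \<omega>)\<^sup>2 + 2 * ((\<eta> k \<omega>)\<^sup>2 * \<bar>W \<omega>\<bar>) + 2 * ((\<eta> k \<omega>)\<^sup>2 * \<bar>\<eta> k \<omega>\<bar>))"
        by (simp add: algebra_simps)
      also have "(\<eta> k \<omega>)\<^sup>2 * \<bar>\<eta> k \<omega>\<bar> = \<bar>\<eta> k \<omega>\<bar> ^ 3"
        by (simp add: power3_eq_cube power2_eq_square abs_mult_self_eq)
      finally show ?thesis using e by linarith
    qed
    have "\<bar>r k\<bar> \<le> \<bar>?g * e\<bar> + \<bar>?g * (f (?w * ?g) - f (?w * G' k \<omega>))\<bar> + \<bar>(?g - G' k \<omega>) * f (?w * G' k \<omega>)\<bar>"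
      unfolding r by (rule order_trans[OF abs_triangle_ineq add_mono[OF abs_triangle_ineq order_refl]])
    also have "\<dots> \<le> 2 * \<bar>e\<bar> + 2 * (7 * (\<bar>?w\<bar> * \<bar>?g - G' k \<omega>\<bar>)) + \<bar>?g - G' k \<omega>\<bar> * 6"
      by (intro add_mono b1 b2 b3)
    also have "\<dots> \<le> 2 * (28 * ((\<eta> k \<omega>)\<^sup>2 + 2 * ((\<eta> k \<omega>)\<^sup>2 * \<bar>W \<omega>\<bar>) + 2 * \<bar>\<eta> k \<omega>\<bar> ^ 3)
        + \<bar>ramp_error a z ?u ?t\<bar>) + 2 * (7 * (\<bar>?w\<bar> * \<bar>?g - G' k \<omega>\<bar>)) + \<bar>?g - G' k \<omega>\<bar> * 6"
      by (intro add_mono mult_left_mono e28) auto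
    also have "\<dots> \<le> 14 * (\<bar>?g - G' k \<omega>\<bar> * (1 + \<bar>?w\<bar>))
      + 56 * ((\<eta> k \<omega>)\<^sup>2 + 2 * ((\<eta> k \<omega>)\<^sup>2 * \<bar>W \<omega>\<bar>) + 2 * \<bar>\<eta> k \<omega>\<bar> ^ 3)
      + 2 * \<bar>ramp_error a z ?u ?t\<bar>"
      by (simp add: algebra_simps)
    finally show ?thesis .
  qed
  have eq: "(1 - ramp a z ?u - N) + (\<Sum>k\<in>V. \<xi> k \<omega> * (G' k \<omega> * f (rest k \<omega> * G' k \<omega>)))
      = (1 - ?g\<^sup>2 * Q \<omega>) * ?d - (\<Sum>k\<in>V. \<xi> k \<omega> * r k)"
  proof -
    have "(\<Sum>k\<in>V. \<xi> k \<omega> * r k) = (\<Sum>k\<in>V. \<xi> k \<omega> * (?g * f ?u))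
        - (\<Sum>k\<in>V. \<xi> k \<omega> * (G' k \<omega> * f (rest k \<omega> * G' k \<omega>))) - (\<Sum>k\<in>V. \<xi> k \<omega> * (?g\<^sup>2 * \<eta> k \<omega> * ?d))"
      unfolding r_def right_diff_distrib[of "\<xi> _ \<omega>"] by (simp only: sum_subtractf)
    moreover have "(\<Sum>k\<in>V. \<xi> k \<omega> * (?g * f ?u)) = ?u * f ?u"
      by (simp only: sum_distrib_right[symmetric] mult.assoc)
    moreover have "(\<Sum>k\<in>V. \<xi> k \<omega> * (?g\<^sup>2 * \<eta> k \<omega> * ?d)) = ?g\<^sup>2 * Q \<omega> * ?d"
    proof -
      have "Q \<omega> = (\<Sum>k\<in>V. \<xi> k \<omega> * \<eta> k \<omega>)" by (simp only: sum_distrib_left)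
      then have "?g\<^sup>2 * Q \<omega> * ?d = (\<Sum>k\<in>V. ?g\<^sup>2 * (\<xi> k \<omega> * \<eta> k \<omega>) * ?d)"
        by (simp only: sum_distrib_left sum_distrib_right)
      also have "\<dots> = (\<Sum>k\<in>V. \<xi> k \<omega> * (?g\<^sup>2 * \<eta> k \<omega> * ?d))"
        by (intro sum.cong refl) (simp only: mult_ac)
      finally show ?thesis by simp
    qed
    ultimately show ?thesis by (simp add: algebra_simps)
  qed
  have "\<bar>(1 - ?g\<^sup>2 * Q \<omega>) * ?d - (\<Sum>k\<in>V. \<xi> k \<omega> * r k)\<bar> \<le> \<bar>1 - ?g\<^sup>2 * Q \<omega>\<bar> * \<bar>?d\<bar> + \<bar>\<Sum>k\<in>V. \<xi> k \<omega> * r k\<bar>"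
    unfolding abs_mult[symmetric] by (rule abs_triangle_ineq4)
  also have "\<dots> \<le> \<bar>1 - ?g\<^sup>2 * Q \<omega>\<bar> * 7 + (\<Sum>k\<in>V. \<bar>\<xi> k \<omega>\<bar> * (14 * (\<bar>?g - G' k \<omega>\<bar> * (1 + \<bar>rest k \<omega>\<bar>))
      + 56 * ((\<eta> k \<omega>)\<^sup>2 + 2 * ((\<eta> k \<omega>)\<^sup>2 * \<bar>W \<omega>\<bar>) + 2 * \<bar>\<eta> k \<omega>\<bar> ^ 3)
      + 2 * \<bar>ramp_error a z ?u (?g * \<eta> k \<omega>)\<bar>))"
  proof (rule add_mono)
    show "\<bar>1 - ?g\<^sup>2 * Q \<omega>\<bar> * \<bar>?d\<bar> \<le> \<bar>1 - ?g\<^sup>2 * Q \<omega>\<bar> * 7" by (intro mult_left_mono d7) auto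
    show "\<bar>\<Sum>k\<in>V. \<xi> k \<omega> * r k\<bar> \<le> (\<Sum>k\<in>V. \<bar>\<xi> k \<omega>\<bar> * (14 * (\<bar>?g - G' k \<omega>\<bar> * (1 + \<bar>rest k \<omega>\<bar>))
      + 56 * ((\<eta> k \<omega>)\<^sup>2 + 2 * ((\<eta> k \<omega>)\<^sup>2 * \<bar>W \<omega>\<bar>) + 2 * \<bar>\<eta> k \<omega>\<bar> ^ 3)
      + 2 * \<bar>ramp_error a z ?u (?g * \<eta> k \<omega>)\<bar>))"
      by (rule order_trans[OF sum_abs sum_mono], unfold abs_mult[of "\<xi> _ \<omega>"], intro mult_left_mono rk) auto
  qed
  also have "\<dots> = 7 * \<bar>1 - (G \<omega>)\<^sup>2 * Q \<omega>\<bar>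
      + (\<Sum>k\<in>V. 14 * (\<bar>\<xi> k \<omega>\<bar> * \<bar>G \<omega> - G' k \<omega>\<bar> * (1 + \<bar>rest k \<omega>\<bar>))
         + 56 * (\<bar>\<xi> k \<omega>\<bar> * (\<eta> k \<omega>)\<^sup>2 * \<bar>1\<bar> + 2 * (\<bar>\<xi> k \<omega>\<bar> * (\<eta> k \<omega>)\<^sup>2 * \<bar>W \<omega>\<bar>)
                + 2 * (\<bar>\<xi> k \<omega>\<bar> * \<bar>\<eta> k \<omega>\<bar> ^ 3))
         + 2 * (\<bar>\<xi> k \<omega>\<bar> * \<bar>ramp_error a z (U \<omega>) (G \<omega> * \<eta> k \<omega>)\<bar>))"
    by (intro arg_cong2[where f = "(+)"] sum.cong refl) (simp_all add: distrib_left mult_ac)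
  finally show ?thesis unfolding eq .
qed

end

lemma ramp_cell_measurable [measurable]: "ramp_cell a z m \<in> sets borel"
  unfolding ramp_cell_def ramp_gap_def by measurable

lemma ramp_measurable [measurable]: "ramp a z \<in> borel_measurable borel"
  unfolding ramp_def by measurable

context perturbed_sum
begin

lemma ramp_error_integrable:
  assumes a: "0 < a" and k: "k \<in> V"
  shows "integrable M (\<lambda>\<omega>. \<bar>\<xi> k \<omega>\<bar> * \<bar>ramp_error a z (U \<omega>) (G \<omega> * \<eta> k \<omega>)\<bar>)"
proof -
  have "integrable M (\<lambda>\<omega>. 2 * \<bar>\<xi> k \<omega> * \<eta> k \<omega>\<bar>)"
    using L4_holder2(1)[OF L4_xi[OF k] L4_eta[OF k]] by auto
  then show ?thesis
  proof (rule Bochner_Integration.integrable_bound)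
    show "(\<lambda>\<omega>. \<bar>\<xi> k \<omega>\<bar> * \<bar>ramp_error a z (U \<omega>) (G \<omega> * \<eta> k \<omega>)\<bar>) \<in> borel_measurable M"
      unfolding ramp_error_def ramp_def ramp_integral_def
      using G_measurable xi_measurable[OF k] eta_measurable[OF k] by measurable
    show "AE \<omega> in M. norm (\<bar>\<xi> k \<omega>\<bar> * \<bar>ramp_error a z (U \<omega>) (G \<omega> * \<eta> k \<omega>)\<bar>) \<le> norm (2 * \<bar>\<xi> k \<omega> * \<eta> k \<omega>\<bar>)"
    proof (rule AE_I2)
      fix \<omega>
      have "\<bar>ramp_error a z (U \<omega>) (G \<omega> * \<eta> k \<omega>)\<bar> \<le> \<bar>G \<omega> * \<eta> k \<omega>\<bar>" by (rule ramp_error_le_linear[OF a])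
      also have "\<dots> \<le> 2 * \<bar>\<eta> k \<omega>\<bar>" unfolding abs_mult by (intro mult_right_mono G_bound) auto
      finally have "\<bar>\<xi> k \<omega>\<bar> * \<bar>ramp_error a z (U \<omega>) (G \<omega> * \<eta> k \<omega>)\<bar> \<le> \<bar>\<xi> k \<omega>\<bar> * (2 * \<bar>\<eta> k \<omega>\<bar>)"
        by (intro mult_left_mono) auto
      then show "norm (\<bar>\<xi> k \<omega>\<bar> * \<bar>ramp_error a z (U \<omega>) (G \<omega> * \<eta> k \<omega>)\<bar>) \<le> norm (2 * \<bar>\<xi> k \<omega> * \<eta> k \<omega>\<bar>)"
        by (simp add: abs_mult mult_ac)
    qed
  qed
qed

lemma stein_expectation:
  assumes a: "0 < a"
  shows "\<bar>expectation (\<lambda>\<omega>. 1 - ramp a z (U \<omega>)) - (LINT x|std_normal_distribution. 1 - ramp a z x)\<bar>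
    \<le> 7 * scale_error + 14 * leave_error + 616 * \<beta>
    + 2 * (\<Sum>k\<in>V. expectation (\<lambda>\<omega>. \<bar>\<xi> k \<omega>\<bar> * \<bar>ramp_error a z (U \<omega>) (G \<omega> * \<eta> k \<omega>)\<bar>))"
proof -
  interpret N: real_distribution std_normal_distribution by (rule real_dist_normal_dist)
  define N where "N = (LINT x|std_normal_distribution. 1 - ramp a z x)"
  have rb: "\<bar>1 - ramp a z x\<bar> \<le> 1" for x using ramp_bounds[OF a, of z x] by linarith
  have iN: "integrable std_normal_distribution (\<lambda>x. 1 - ramp a z x)"
    by (rule N.integrable_const_bound[where B = 1]) (use rb in auto)
  have N01: "0 \<le> N" "N \<le> 1"
  proof -
    show "0 \<le> N" unfolding N_def using ramp_bounds[OF a]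
      by (intro Bochner_Integration.integral_nonneg) auto
    have "N \<le> (LINT x|std_normal_distribution. 1)"
      unfolding N_def using ramp_bounds[OF a] by (intro integral_mono iN) auto
    then show "N \<le> 1" using N.prob_space by simp
  qed
  obtain f where df: "\<And>w. (f has_real_derivative (w * f w + (1 - ramp a z w) - N)) (at w)"
    and f6: "\<And>w. \<bar>f w\<bar> \<le> 6" and wf: "\<And>w. \<bar>w * f w\<bar> \<le> 6"
  proof (rule stein_solution[of "\<lambda>x. 1 - ramp a z x", folded N_def])
    show "continuous_on UNIV (\<lambda>x. 1 - ramp a z x)"
      by (intro continuous_on_diff continuous_on_const continuous_ramp)
    show "0 \<le> 1 - ramp a z x" "1 - ramp a z x \<le> 1" for x
      using ramp_bounds[OF a, of z x] by auto
  qed (rule that)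
  have "continuous_on UNIV f"
    using df by (intro continuous_at_imp_continuous_on ballI DERIV_isCont) blast
  then have fm: "f \<in> borel_measurable borel" by (rule borel_measurable_continuous_onI)
  define g where "g k \<omega> = G' k \<omega> * f (rest k \<omega> * G' k \<omega>)" for k \<omega>
  have g: "integrable M (\<lambda>\<omega>. \<xi> k \<omega> * g k \<omega>)" "expectation (\<lambda>\<omega>. \<xi> k \<omega> * g k \<omega>) = 0" if k: "k \<in> V" for k
  proof -
    have gm: "g k \<in> borel_measurable (generated (V - A k))"
      unfolding g_def
      by (intro borel_measurable_times measurable_compose[OF _ fm] rest_generated G'_generated k)
    have "\<bar>g k \<omega>\<bar> \<le> 2 * 6" for \<omega>
      unfolding g_def abs_mult[of "G' k \<omega>"] by (intro mult_mono G'_bound f6) auto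
    then have "integrable M (g k)"
      using generated_measurable[OF _ gm] by (intro integrable_const_bound[where B = 12]) auto
    from leave_out_zero[OF k gm this]
    show "integrable M (\<lambda>\<omega>. \<xi> k \<omega> * g k \<omega>)" "expectation (\<lambda>\<omega>. \<xi> k \<omega> * g k \<omega>) = 0" .
  qed
  have ih: "integrable M (\<lambda>\<omega>. 1 - ramp a z (U \<omega>))"
    by (rule integrable_const_bound[where B = 1]) (use rb in \<open>auto intro!: measurable_compose[OF U_measurable]\<close>)
  let ?S = "\<lambda>\<omega>. (1 - ramp a z (U \<omega>) - N) + (\<Sum>k\<in>V. \<xi> k \<omega> * g k \<omega>)"
  let ?e1 = "\<lambda>k \<omega>. \<bar>\<xi> k \<omega>\<bar> * \<bar>G \<omega> - G' k \<omega>\<bar> * (1 + \<bar>rest k \<omega>\<bar>)"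
  let ?e2 = "\<lambda>k \<omega>. \<bar>\<xi> k \<omega>\<bar> * (\<eta> k \<omega>)\<^sup>2 * \<bar>1\<bar>"
  let ?e3 = "\<lambda>k \<omega>. \<bar>\<xi> k \<omega>\<bar> * (\<eta> k \<omega>)\<^sup>2 * \<bar>W \<omega>\<bar>"
  let ?e4 = "\<lambda>k \<omega>. \<bar>\<xi> k \<omega>\<bar> * \<bar>\<eta> k \<omega>\<bar> ^ 3"
  let ?e5 = "\<lambda>k \<omega>. \<bar>\<xi> k \<omega>\<bar> * \<bar>ramp_error a z (U \<omega>) (G \<omega> * \<eta> k \<omega>)\<bar>"
  let ?e = "\<lambda>k \<omega>. 14 * ?e1 k \<omega> + 56 * (?e2 k \<omega> + 2 * ?e3 k \<omega> + 2 * ?e4 k \<omega>) + 2 * ?e5 k \<omega>"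
  note i = leave_error_integrable sum_square_nbhd(1)[OF L4_const[of 1]] sum_square_nbhd(1)[OF L4_W]
    sum_cube_nbhd(1) ramp_error_integrable[OF a]
  have ie: "integrable M (?e k)" if "k \<in> V" for k
    by (intro Bochner_Integration.integrable_add Bochner_Integration.integrable_mult_right i that)
  have Ee: "expectation (?e k) = 14 * expectation (?e1 k)
      + 56 * (expectation (?e2 k) + 2 * expectation (?e3 k) + 2 * expectation (?e4 k)) + 2 * expectation (?e5 k)"
    if "k \<in> V" for k
    by (simp only: Bochner_Integration.integral_add Bochner_Integration.integral_mult_right
          Bochner_Integration.integrable_add Bochner_Integration.integrable_mult_right i[OF that] simp_thms)
  have iS: "integrable M (\<lambda>\<omega>. \<Sum>k\<in>V. \<xi> k \<omega> * g k \<omega>)"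
    by (rule Bochner_Integration.integrable_sum[OF g(1)])
  have "expectation ?S = expectation (\<lambda>\<omega>. 1 - ramp a z (U \<omega>)) - N + expectation (\<lambda>\<omega>. \<Sum>k\<in>V. \<xi> k \<omega> * g k \<omega>)"
    using ih iS by (simp add: prob_space)
  also have "expectation (\<lambda>\<omega>. \<Sum>k\<in>V. \<xi> k \<omega> * g k \<omega>) = 0"
    by (subst Bochner_Integration.integral_sum[OF g(1)]) (simp_all add: g(2))
  finally have "\<bar>expectation (\<lambda>\<omega>. 1 - ramp a z (U \<omega>)) - N\<bar> = \<bar>expectation ?S\<bar>" by simp
  also have "\<dots> \<le> expectation (\<lambda>\<omega>. \<bar>?S \<omega>\<bar>)" by (rule integral_abs_bound)
  also have "\<dots> \<le> expectation (\<lambda>\<omega>. 7 * \<bar>1 - (G \<omega>)\<^sup>2 * Q \<omega>\<bar> + (\<Sum>k\<in>V. ?e k \<omega>))"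
  proof (rule integral_mono)
    show "integrable M (\<lambda>\<omega>. \<bar>?S \<omega>\<bar>)" using ih iS by auto
    show "integrable M (\<lambda>\<omega>. 7 * \<bar>1 - (G \<omega>)\<^sup>2 * Q \<omega>\<bar> + (\<Sum>k\<in>V. ?e k \<omega>))"
      by (intro Bochner_Integration.integrable_add Bochner_Integration.integrable_mult_right
          scale_error_integrable Bochner_Integration.integrable_sum ie)
    show "\<bar>?S \<omega>\<bar> \<le> 7 * \<bar>1 - (G \<omega>)\<^sup>2 * Q \<omega>\<bar> + (\<Sum>k\<in>V. ?e k \<omega>)" for \<omega>
      unfolding g_def by (rule stein_pointwise[OF a df f6 wf N01])
  qed
  also have "\<dots> = 7 * scale_error + (\<Sum>k\<in>V. expectation (?e k))"
  proof -
    have "integrable M (\<lambda>\<omega>. 7 * \<bar>1 - (G \<omega>)\<^sup>2 * Q \<omega>\<bar>)"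
      by (intro Bochner_Integration.integrable_mult_right scale_error_integrable)
    moreover have "integrable M (\<lambda>\<omega>. \<Sum>k\<in>V. ?e k \<omega>)"
      by (rule Bochner_Integration.integrable_sum) (rule ie)
    ultimately have "expectation (\<lambda>\<omega>. 7 * \<bar>1 - (G \<omega>)\<^sup>2 * Q \<omega>\<bar> + (\<Sum>k\<in>V. ?e k \<omega>))
      = expectation (\<lambda>\<omega>. 7 * \<bar>1 - (G \<omega>)\<^sup>2 * Q \<omega>\<bar>) + expectation (\<lambda>\<omega>. \<Sum>k\<in>V. ?e k \<omega>)"
      by (rule Bochner_Integration.integral_add)
    moreover have "expectation (\<lambda>\<omega>. \<Sum>k\<in>V. ?e k \<omega>) = (\<Sum>k\<in>V. expectation (?e k))"
      by (rule Bochner_Integration.integral_sum) (rule ie)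
    ultimately show ?thesis
      by (simp only: Bochner_Integration.integral_mult_right_zero scale_error_def)
  qed
  also have "(\<Sum>k\<in>V. expectation (?e k)) = 14 * leave_error
      + 56 * ((\<Sum>k\<in>V. expectation (?e2 k)) + 2 * (\<Sum>k\<in>V. expectation (?e3 k)) + 2 * (\<Sum>k\<in>V. expectation (?e4 k)))
      + 2 * (\<Sum>k\<in>V. expectation (?e5 k))"
    by (rule trans[OF sum.cong[OF refl Ee]], assumption)
       (simp only: sum.distrib sum_distrib_left[symmetric] leave_error_def)
  also have "(\<Sum>k\<in>V. expectation (?e2 k)) \<le> \<beta>"
    using sum_square_nbhd(2)[OF L4_const[of 1]] beta_bounds by simp
  also have "(\<Sum>k\<in>V. expectation (?e3 k)) \<le> 4 * \<beta>"
  proof -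
    have "T3 * L4_norm W \<le> \<beta> * 4"
      using beta_bounds L4_norm_W[OF beta_le_1] by (intro mult_mono) auto
    then show ?thesis using sum_square_nbhd(2)[OF L4_W] by simp
  qed
  also have "(\<Sum>k\<in>V. expectation (?e4 k)) \<le> \<beta>"
  proof -
    have "\<beta>\<^sup>2 \<le> \<beta>" using beta_bounds beta_le_1 by (simp add: power2_eq_square mult_left_le)
    then show ?thesis using sum_cube_nbhd(2) beta_bounds by linarith
  qed
  finally show ?thesis by (simp add: N_def)
qed

text \<open>
  Cells \<open>0, ..., m - 1\<close> are recorded with their indicators, and \<open>cell_sum a m\<close> covers everything farther away.
\<close>

lemma ramp_error_sum_le:
  assumes a: "0 < a" and m: "1 \<le> m"
  shows "(\<Sum>k\<in>V. \<bar>\<xi> k \<omega>\<bar> * \<bar>ramp_error a z (U \<omega>) (G \<omega> * \<eta> k \<omega>)\<bar>)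
    \<le> (\<Sum>i<m. indicator (ramp_cell a z i) (U \<omega>) * cell_sum a i \<omega>) + cell_sum a m \<omega>"
proof -
  let ?s = "\<lambda>i k. \<Sum>j\<in>A k. split_weight (a / D) i (2 * \<bar>\<xi> j \<omega>\<bar>)"
  let ?I = "\<lambda>i. indicator (ramp_cell a z i) (U \<omega>) :: real"
  have "\<bar>ramp_error a z (U \<omega>) (G \<omega> * \<eta> k \<omega>)\<bar> \<le> (\<Sum>i<m. ?I i * ?s i k) + ?s m k" if k: "k \<in> V" for k
  proof -
    let ?b = "\<Sum>j\<in>A k. 2 * \<bar>\<xi> j \<omega>\<bar>"
    have "\<bar>G \<omega> * \<eta> k \<omega>\<bar> \<le> 2 * \<bar>\<eta> k \<omega>\<bar>" unfolding abs_mult by (intro mult_right_mono G_bound) auto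
    also have "\<dots> \<le> ?b" unfolding sum_distrib_left[symmetric] by (intro mult_left_mono sum_abs) auto
    finally have b: "\<bar>G \<omega> * \<eta> k \<omega>\<bar> \<le> ?b" .
    have cw: "cell_weight a i ?b \<le> ?s i k" for i
      by (intro cell_weight_le_split a D_pos finite_A A_card k) auto
    have "\<bar>ramp_error a z (U \<omega>) (G \<omega> * \<eta> k \<omega>)\<bar>
        \<le> (\<Sum>i<m. ?I i * cell_weight a i ?b) + max (?b - real m * a) 0"
      by (rule ramp_error_le_cells[OF a b])
    also have "max (?b - real m * a) 0 = cell_weight a m ?b" using m by (simp add: cell_weight_def)
    also have "(\<Sum>i<m. ?I i * cell_weight a i ?b) + cell_weight a m ?b \<le> (\<Sum>i<m. ?I i * ?s i k) + ?s m k"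
      by (intro add_mono sum_mono mult_left_mono cw) auto
    finally show ?thesis .
  qed
  then have "(\<Sum>k\<in>V. \<bar>\<xi> k \<omega>\<bar> * \<bar>ramp_error a z (U \<omega>) (G \<omega> * \<eta> k \<omega>)\<bar>)
      \<le> (\<Sum>k\<in>V. \<bar>\<xi> k \<omega>\<bar> * ((\<Sum>i<m. ?I i * ?s i k) + ?s m k))"
    by (intro sum_mono mult_left_mono) auto
  also have "\<dots> = (\<Sum>k\<in>V. \<Sum>i<m. \<bar>\<xi> k \<omega>\<bar> * (?I i * ?s i k)) + (\<Sum>k\<in>V. \<bar>\<xi> k \<omega>\<bar> * ?s m k)"
    by (simp only: distrib_left sum.distrib sum_distrib_left)
  also have "(\<Sum>k\<in>V. \<Sum>i<m. \<bar>\<xi> k \<omega>\<bar> * (?I i * ?s i k)) = (\<Sum>i<m. \<Sum>k\<in>V. \<bar>\<xi> k \<omega>\<bar> * (?I i * ?s i k))"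
    by (rule sum.swap)
  also have "\<dots> = (\<Sum>i<m. ?I i * cell_sum a i \<omega>)"
    unfolding cell_sum_def sum_distrib_left by (simp only: mult_ac)
  also have "(\<Sum>k\<in>V. \<bar>\<xi> k \<omega>\<bar> * ?s m k) = cell_sum a m \<omega>"
    unfolding cell_sum_def sum_distrib_left ..
  finally show ?thesis .
qed

lemma kolmogorov_delta:
  "\<bar>prob {\<omega> \<in> space M. U \<omega> \<le> z} - cdf std_normal_distribution z\<bar> \<le> \<delta>"
proof -
  interpret N: real_distribution std_normal_distribution by (rule real_dist_normal_dist)
  have "\<bar>prob {\<omega> \<in> space M. U \<omega> \<le> z} - cdf std_normal_distribution z\<bar> \<le> 1" for z
    using prob_le_1[of "{\<omega> \<in> space M. U \<omega> \<le> z}"] N.cdf_bounded_prob[of z] N.cdf_nonneg[of z]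
      measure_nonneg[of M "{\<omega> \<in> space M. U \<omega> \<le> z}"] by linarith
  then show ?thesis unfolding \<delta>_def
    by (intro cSUP_upper) (auto intro!: bdd_aboveI[where M = 1])
qed

lemma delta_nonneg: "0 \<le> \<delta>"
  using kolmogorov_delta[of 0] by linarith

lemma prob_interval:
  assumes "u \<le> v"
  shows "prob {\<omega> \<in> space M. U \<omega> \<in> {u<..v}} \<le> v - u + 2 * \<delta>"
proof -
  have "prob {\<omega> \<in> space M. U \<omega> \<in> {u<..v}} = prob ({\<omega> \<in> space M. U \<omega> \<le> v} - {\<omega> \<in> space M. U \<omega> \<le> u})"
    by (rule arg_cong[of _ _ prob]) auto
  also have "\<dots> = prob {\<omega> \<in> space M. U \<omega> \<le> v} - prob {\<omega> \<in> space M. U \<omega> \<le> u}"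
    using assms by (intro finite_measure_Diff) auto
  finally show ?thesis
    using kolmogorov_delta[of u] kolmogorov_delta[of v] std_normal_cdf_increment[OF assms] by linarith
qed

lemma prob_ramp_cell:
  assumes a: "0 < a"
  shows "prob {\<omega> \<in> space M. U \<omega> \<in> ramp_cell a z m} \<le> 3 * a + 4 * \<delta>"
proof -
  let ?I = "{z - real (Suc m) * a<..z - real m * a}" and ?J = "{z + real m * a<..z + real m * a + 2 * a}"
  have "prob {\<omega> \<in> space M. U \<omega> \<in> ramp_cell a z m}
      \<le> prob ({\<omega> \<in> space M. U \<omega> \<in> ?I} \<union> {\<omega> \<in> space M. U \<omega> \<in> ?J})"
    using ramp_cell_subset[OF a, of z m] by (intro finite_measure_mono) auto
  also have "\<dots> \<le> prob {\<omega> \<in> space M. U \<omega> \<in> ?I} + prob {\<omega> \<in> space M. U \<omega> \<in> ?J}"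
    by (intro measure_Un_le) auto
  also have "\<dots> \<le> (a + 2 * \<delta>) + (2 * a + 2 * \<delta>)"
    using prob_interval[of "z - real (Suc m) * a" "z - real m * a"]
      prob_interval[of "z + real m * a" "z + real m * a + 2 * a"] a
    by (intro add_mono) (auto simp: algebra_simps)
  finally show ?thesis by simp
qed

text \<open>
  The cell sum may be replaced by its mean at the price of its standard deviation times the square root of the probability of
  the cell.
\<close>

lemma cell_expectation:
  assumes a: "0 < a"
  defines "p \<equiv> 3 * a + 4 * \<delta>"
  shows "integrable M (\<lambda>\<omega>. indicator (ramp_cell a z m) (U \<omega>) * cell_sum a m \<omega>)"
    and "expectation (\<lambda>\<omega>. indicator (ramp_cell a z m) (U \<omega>) * cell_sum a m \<omega>)
      \<le> expectation (cell_sum a m) * p + 12 * \<beta> * sqrt p"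
proof -
  let ?I = "\<lambda>\<omega>. indicator (ramp_cell a z m) (U \<omega>) :: real"
  let ?R = "cell_sum a m" and ?E = "expectation (cell_sum a m)"
  note R = cell_sum_moments[OF a, of m]
  have [measurable]: "?I \<in> borel_measurable M"
    by (rule measurable_compose[OF U_measurable borel_measurable_indicator[OF ramp_cell_measurable]])
  have Isq: "(?I \<omega>)\<^sup>2 = ?I \<omega>" for \<omega> by (simp add: indicator_def)
  have iI: "integrable M ?I" by (rule integrable_const_bound[where B = 1]) (auto simp: indicator_def)
  have iI2: "integrable M (\<lambda>\<omega>. (?I \<omega>)\<^sup>2)" unfolding Isq by (rule iI)
  have iR2: "integrable M (\<lambda>\<omega>. (?R \<omega> - ?E)\<^sup>2)" using R(2,3) by (simp add: power2_diff)
  have EI: "expectation ?I \<le> p"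
  proof -
    have "expectation ?I = expectation (indicator {\<omega> \<in> space M. U \<omega> \<in> ramp_cell a z m})"
      by (intro Bochner_Integration.integral_cong) (auto simp: indicator_def)
    also have "\<dots> = prob {\<omega> \<in> space M. U \<omega> \<in> ramp_cell a z m}" by simp
    finally show ?thesis using prob_ramp_cell[OF a] by (simp add: p_def)
  qed
  have Rm: "(\<lambda>\<omega>. ?R \<omega> - ?E) \<in> borel_measurable M" using R(1) by measurable
  note cs = cauchy_schwarz_expectation[OF _ Rm iI2 iR2]
  have c: "integrable M (\<lambda>\<omega>. ?I \<omega> * (?R \<omega> - ?E))" by (rule cs(1)) simp
  have split: "?I \<omega> * ?R \<omega> = ?I \<omega> * ?E + ?I \<omega> * (?R \<omega> - ?E)" for \<omega> by (simp add: algebra_simps)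
  show "integrable M (\<lambda>\<omega>. ?I \<omega> * ?R \<omega>)"
    unfolding split using iI c by (intro Bochner_Integration.integrable_add) auto
  have "expectation (\<lambda>\<omega>. ?I \<omega> * ?R \<omega>) = expectation ?I * ?E + expectation (\<lambda>\<omega>. ?I \<omega> * (?R \<omega> - ?E))"
    unfolding split using iI c by simp
  also have "expectation ?I * ?E \<le> p * ?E"
    using cell_sum_nonneg[OF a] by (intro mult_right_mono EI Bochner_Integration.integral_nonneg)
  also have "expectation (\<lambda>\<omega>. ?I \<omega> * (?R \<omega> - ?E)) \<le> expectation (\<lambda>\<omega>. \<bar>?I \<omega> * (?R \<omega> - ?E)\<bar>)"
    using c by (intro integral_mono) auto
  also have "\<dots> \<le> sqrt (expectation (\<lambda>\<omega>. (?I \<omega>)\<^sup>2)) * sqrt (expectation (\<lambda>\<omega>. (?R \<omega> - ?E)\<^sup>2))"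
    by (rule cs(2)) simp
  also have "\<dots> \<le> sqrt p * sqrt ((12 * \<beta>)\<^sup>2)"
    unfolding Isq using EI R(4) a delta_nonneg p_def by (intro mult_mono real_sqrt_le_mono) auto
  also have "sqrt ((12 * \<beta>)\<^sup>2) = 12 * \<beta>" using beta_bounds by (simp add: real_sqrt_mult)
  finally show "expectation (\<lambda>\<omega>. ?I \<omega> * ?R \<omega>) \<le> ?E * p + 12 * \<beta> * sqrt p" by (simp add: mult_ac)
qed

text \<open>
  With \<open>p = 3 a + 4 \<delta>\<close>, the means contribute \<open>(8 \<beta> / a) p\<close>, the \<open>m\<close> deviations contribute \<open>m \<cdot> 12 \<beta> \<cdot> sqrt p\<close>, and the tail
  contributes \<open>8 \<beta>\<^sup>2 / a\<close>. For \<open>m\<close> of order \<open>1 / sqrt a\<close> the second is of order \<open>\<beta> (1 + p / a)\<close>.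
\<close>

lemma ramp_error_expectation:
  assumes a: "0 < a" "a \<le> 1"
  shows "(\<Sum>k\<in>V. expectation (\<lambda>\<omega>. \<bar>\<xi> k \<omega>\<bar> * \<bar>ramp_error a z (U \<omega>) (G \<omega> * \<eta> k \<omega>)\<bar>))
    \<le> 72 * \<beta> + 80 * \<beta> * \<delta> / a + 8 * \<beta>\<^sup>2 / a"
proof -
  define p where "p = 3 * a + 4 * \<delta>"
  (* just enough cells to reach the distance sqrt a *)
  define m where "m = nat \<lceil>1 / sqrt a\<rceil>"
  have sa: "0 < sqrt a" "sqrt a \<le> 1" using a by auto
  have inv: "1 \<le> 1 / sqrt a" using sa by simp
  have m_lower: "1 / sqrt a \<le> real m" unfolding m_def using inv by linarith
  have m_upper: "real m \<le> 2 / sqrt a"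
  proof -
    have "real m \<le> 1 / sqrt a + 1" unfolding m_def using inv by linarith
    also have "\<dots> \<le> 2 / sqrt a" using inv by (simp add: field_simps)
    finally show ?thesis .
  qed
  have m1: "1 \<le> m" using m_lower inv by linarith
  have m2: "1 \<le> (real m)\<^sup>2 * a"
  proof -
    have "(1 / sqrt a)\<^sup>2 \<le> (real m)\<^sup>2" using m_lower sa by (intro power_mono) auto
    then have "1 / a \<le> (real m)\<^sup>2" using a by (simp add: power_divide)
    then show ?thesis using a by (simp add: field_simps)
  qed
  have p0: "0 \<le> p" using a delta_nonneg by (simp add: p_def)
  have pa: "p / a = 3 + 4 * \<delta> / a" using a by (simp add: p_def field_simps)
  have ms: "real m * sqrt p \<le> 1 + p / a"
  proof -
    have "real m * sqrt p \<le> 2 / sqrt a * sqrt p" using p0 by (intro mult_right_mono m_upper) auto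
    also have "\<dots> = 2 * (1 * sqrt (p / a))" by (simp add: real_sqrt_divide)
    also have "\<dots> \<le> 1\<^sup>2 + (sqrt (p / a))\<^sup>2" using sum_squares_bound[of 1 "sqrt (p / a)"] by simp
    also have "\<dots> = 1 + p / a" using p0 a by simp
    finally show ?thesis .
  qed
  let ?c = "\<lambda>i \<omega>. indicator (ramp_cell a z i) (U \<omega>) * cell_sum a i \<omega>"
  note ce = cell_expectation[OF a(1), of z, folded p_def]
  have "(\<Sum>k\<in>V. expectation (\<lambda>\<omega>. \<bar>\<xi> k \<omega>\<bar> * \<bar>ramp_error a z (U \<omega>) (G \<omega> * \<eta> k \<omega>)\<bar>))
      = expectation (\<lambda>\<omega>. \<Sum>k\<in>V. \<bar>\<xi> k \<omega>\<bar> * \<bar>ramp_error a z (U \<omega>) (G \<omega> * \<eta> k \<omega>)\<bar>)"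
    by (rule Bochner_Integration.integral_sum[symmetric]) (rule ramp_error_integrable[OF a(1)])
  also have "\<dots> \<le> expectation (\<lambda>\<omega>. (\<Sum>i<m. ?c i \<omega>) + cell_sum a m \<omega>)"
    by (intro integral_mono Bochner_Integration.integrable_sum Bochner_Integration.integrable_add
        ramp_error_integrable a ce(1) cell_sum_moments(2) ramp_error_sum_le m1)
  also have "\<dots> = (\<Sum>i<m. expectation (?c i)) + expectation (cell_sum a m)"
    unfolding Bochner_Integration.integral_add[OF Bochner_Integration.integrable_sum[OF ce(1)]
        cell_sum_moments(2)[OF a(1)]]
    by (simp only: Bochner_Integration.integral_sum[OF ce(1)])
  also have "\<dots> \<le> (\<Sum>i<m. expectation (cell_sum a i) * p + 12 * \<beta> * sqrt p) + 8 * \<beta>\<^sup>2 / a"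
    by (intro add_mono sum_mono ce(2) cell_sum_tail a m1 m2)
  also have "(\<Sum>i<m. expectation (cell_sum a i) * p + 12 * \<beta> * sqrt p)
      = (\<Sum>i<m. expectation (cell_sum a i)) * p + 12 * \<beta> * (real m * sqrt p)"
    by (simp add: sum.distrib sum_distrib_right)
  also have "\<dots> \<le> (8 * \<beta> / a) * p + 12 * \<beta> * (1 + p / a)"
    using p0 beta_bounds by (intro add_mono mult_right_mono mult_left_mono cell_sum_total a ms) auto
  also have "\<dots> = 12 * \<beta> + 20 * \<beta> * (p / a)" by (simp add: algebra_simps)
  also have "\<dots> = 72 * \<beta> + 80 * \<beta> * \<delta> / a" unfolding pa by (simp add: algebra_simps)
  finally show ?thesis by simp
qed

text \<open>
  The smoothing costs \<open>a\<close>, and the smoothed distance is bounded by the errors plus \<open>160 \<beta> \<delta> / a\<close>. With \<open>a = 640 \<beta>\<close> the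
  latter is \<open>\<delta> / 4\<close> and can be absorbed. The inequality is solved for \<open>\<delta>\<close> as a supremum over all \<open>z\<close>, since the cell
  probabilities involve \<open>\<delta>\<close> at other points.
\<close>

theorem kolmogorov_perturbed_sum:
  assumes b: "\<beta> \<le> 1 / 640"
  shows "\<delta> \<le> 1900 * (\<beta> + leave_error + scale_error)"
proof -
  interpret N: real_distribution std_normal_distribution by (rule real_dist_normal_dist)
  define a where "a = 640 * \<beta>"
  have a: "0 < a" "a \<le> 1" using beta_pos b by (auto simp: a_def)
  define K where "K = 7 * scale_error + 14 * leave_error + 761 * \<beta> + \<delta> / 4"
  let ?F = "\<lambda>z. prob {\<omega> \<in> space M. U \<omega> \<le> z}" and ?P = "cdf std_normal_distribution"
  let ?N = "\<lambda>z. LINT x|std_normal_distribution. 1 - ramp a z x"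
  let ?h = "\<lambda>z. expectation (\<lambda>\<omega>. 1 - ramp a z (U \<omega>))"
  have hN: "\<bar>?h z - ?N z\<bar> \<le> K" for z
  proof -
    have "80 * \<beta> * \<delta> / a = \<delta> / 8" "8 * \<beta>\<^sup>2 / a = \<beta> / 80"
      using beta_pos by (simp_all add: a_def power2_eq_square)
    then show ?thesis
      using stein_expectation[OF a(1), of z] ramp_error_expectation[OF a, of z] beta_bounds
      unfolding K_def by linarith
  qed
  have lo: "indicator {..z} x \<le> 1 - ramp a z x" and up: "1 - ramp a z x \<le> indicator {..z + a} x" for x z :: real
    using a ramp_bounds[OF a(1), of z x] by (auto simp: indicator_def ramp_def field_simps)
  have rb: "\<bar>1 - ramp a z x\<bar> \<le> 1" for x z using ramp_bounds[OF a(1), of z x] by linarith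
  have ih: "integrable M (\<lambda>\<omega>. 1 - ramp a z (U \<omega>))" for z
    by (rule integrable_const_bound[where B = 1]) (use rb in \<open>auto intro!: measurable_compose[OF U_measurable]\<close>)
  have iN: "integrable std_normal_distribution (\<lambda>x. 1 - ramp a z x)" for z
    by (rule N.integrable_const_bound[where B = 1]) (use rb in auto)
  have iI: "integrable M (\<lambda>\<omega>. indicator {..z} (U \<omega>) :: real)" for z
    by (rule integrable_const_bound[where B = 1]) (auto simp: indicator_def intro!: measurable_compose[OF U_measurable])
  have F: "expectation (\<lambda>\<omega>. indicator {..z} (U \<omega>) :: real) = ?F z" for z
  proof -
    have "expectation (\<lambda>\<omega>. indicator {..z} (U \<omega>) :: real) = expectation (indicator {\<omega> \<in> space M. U \<omega> \<le> z})"
      by (intro Bochner_Integration.integral_cong) (auto simp: indicator_def)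
    then show ?thesis by simp
  qed
  have P: "(LINT x|std_normal_distribution. indicator {..z} x) = ?P z" for z
    by (simp add: cdf_def)
  have iNI: "integrable std_normal_distribution (indicator {..z} :: real \<Rightarrow> real)" for z
    by (rule N.integrable_const_bound[where B = 1]) (auto simp: indicator_def)
  have Fh: "?F z \<le> ?h z" "?h z \<le> ?F (z + a)" for z
    unfolding F[symmetric] by (intro integral_mono ih iI lo up)+
  have PN: "?P z \<le> ?N z" "?N z \<le> ?P (z + a)" for z
    unfolding P[symmetric] by (intro integral_mono iN iNI lo up)+
  (* from above compare with the ramp that starts at z, from below with the ramp that ends at z *)
  have "\<bar>?F z - ?P z\<bar> \<le> a + K" for z
    using Fh[of z] Fh[of "z - a"] PN[of z] PN[of "z - a"] hN[of z] hN[of "z - a"]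
      std_normal_cdf_increment[of z "z + a"] std_normal_cdf_increment[of "z - a" z] a by auto
  then have "\<delta> \<le> a + K" unfolding \<delta>_def by (intro cSUP_least) auto
  moreover have "0 \<le> scale_error" by (simp add: scale_error_def)
  moreover have "0 \<le> leave_error" unfolding leave_error_def
    by (intro sum_nonneg Bochner_Integration.integral_nonneg mult_nonneg_nonneg) auto
  moreover note beta_pos
  ultimately show ?thesis unfolding K_def a_def distrib_left by linarith
qed

end

section \<open>Self-normalisation\<close>

context local_dependence
begin

text \<open>
  For \<open>G = 1\<close> nothing is lost by leaving out, and the scale error is \<open>E \<bar>1 - Q\<bar>\<close>. For large \<open>\<beta>\<close> the bound exceeds 1.
\<close>

lemma kolmogorov_W:
  "\<bar>prob {\<omega> \<in> space M. W \<omega> \<le> z} - cdf std_normal_distribution z\<bar> \<le> 7600 * \<beta>"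
proof (cases "\<beta> \<le> 1 / 640")
  case True
  interpret P: perturbed_sum M V A D \<xi> "\<lambda>_. 1" "\<lambda>_ _. 1"
    by unfold_locales (use True in auto)
  have "P.leave_error = 0" by (simp add: P.leave_error_def)
  moreover have "P.scale_error \<le> 3 * \<beta>"
    using Q_L1_error by (simp add: P.scale_error_def abs_minus_commute)
  ultimately have "P.\<delta> \<le> 7600 * \<beta>"
    using P.kolmogorov_perturbed_sum[OF True] unfolding distrib_left by linarith
  then show ?thesis using P.kolmogorov_delta[of z] by simp
next
  case False
  interpret N: real_distribution std_normal_distribution by (rule real_dist_normal_dist)
  have "\<bar>prob {\<omega> \<in> space M. W \<omega> \<le> z} - cdf std_normal_distribution z\<bar> \<le> 1"
    using prob_le_1[of "{\<omega> \<in> space M. W \<omega> \<le> z}"] N.cdf_bounded_prob[of z] N.cdf_nonneg[of z]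
      measure_nonneg[of M "{\<omega> \<in> space M. W \<omega> \<le> z}"] by linarith
  then show ?thesis using False by linarith
qed

end

definition clip :: "real \<Rightarrow> real" where
  "clip t = max (- 1 / 2) (min t (1 / 2))"

text \<open>
  The function \<open>1 / sqrt (1 + t)\<close>, truncated so that it is bounded and Lipschitz.
\<close>

definition inv_root :: "real \<Rightarrow> real" where
  "inv_root t = 1 / sqrt (1 + clip t)"

lemma clip_bounds: "1 / 2 \<le> 1 + clip t" "1 + clip t \<le> 3 / 2"
  by (auto simp: clip_def)

lemma inv_root_bound: "\<bar>inv_root t\<bar> \<le> 2"
proof -
  have "sqrt (1 / 4) \<le> sqrt (1 + clip t)" using clip_bounds(1)[of t] by (intro real_sqrt_le_mono) simp
  then have "1 / 2 \<le> sqrt (1 + clip t)" by (simp add: real_sqrt_divide)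
  then have "1 / sqrt (1 + clip t) \<le> 1 / (1 / 2)"
    using clip_bounds(1)[of t] by (intro divide_left_mono) auto
  also have "\<dots> = 2" by simp
  finally have le: "1 / sqrt (1 + clip t) \<le> 2" .
  have nn: "0 \<le> 1 / sqrt (1 + clip t)" using clip_bounds(1)[of t] by simp
  show ?thesis unfolding inv_root_def abs_of_nonneg[OF nn] by (rule le)
qed

lemma inv_root_sq: "(inv_root t)\<^sup>2 = 1 / (1 + clip t)"
  using clip_bounds(1)[of t] by (simp add: inv_root_def power_divide)

lemma inv_root_lipschitz: "\<bar>inv_root s - inv_root t\<bar> \<le> 2 * \<bar>s - t\<bar>"
proof -
  define p q where "p = sqrt (1 + clip s)" and "q = sqrt (1 + clip t)"
  have pq2: "1 / 2 \<le> p\<^sup>2" "1 / 2 \<le> q\<^sup>2" "p\<^sup>2 = 1 + clip s" "q\<^sup>2 = 1 + clip t"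
    using clip_bounds(1)[of s] clip_bounds(1)[of t] by (auto simp: p_def q_def)
  have "sqrt ((7 / 10)\<^sup>2) \<le> p" "sqrt ((7 / 10)\<^sup>2) \<le> q"
    unfolding p_def q_def using clip_bounds(1)[of s] clip_bounds(1)[of t]
    by (auto intro!: real_sqrt_le_mono simp: power2_eq_square simp del: real_sqrt_abs)
  then have pq: "7 / 10 \<le> p" "7 / 10 \<le> q" by simp_all
  have "(7 / 10) * (7 / 10) * (7 / 10 + 7 / 10) \<le> p * q * (p + q)"
    using pq by (intro mult_mono add_mono) auto
  then have k: "1 / 2 \<le> p * q * (p + q)" by simp
  have "inv_root s - inv_root t = (q\<^sup>2 - p\<^sup>2) / (p * q * (p + q))"
  proof -
    have "inv_root s - inv_root t = (q - p) / (p * q)"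
      unfolding inv_root_def p_def[symmetric] q_def[symmetric] using pq by (simp add: field_simps)
    also have "\<dots> = ((q - p) * (p + q)) / ((p * q) * (p + q))" using pq by simp
    also have "(q - p) * (p + q) = q\<^sup>2 - p\<^sup>2" by (simp add: power2_eq_square algebra_simps)
    finally show ?thesis .
  qed
  also have "\<bar>\<dots>\<bar> = \<bar>clip t - clip s\<bar> / (p * q * (p + q))"
    using k pq2 by (simp add: abs_divide)
  also have "\<dots> \<le> \<bar>clip t - clip s\<bar> / (1 / 2)" using k by (intro divide_left_mono) auto
  also have "\<dots> \<le> 2 * \<bar>s - t\<bar>" by (simp add: clip_def)
  finally show ?thesis .
qed

lemma inv_root_measurable [measurable]: "inv_root \<in> borel_measurable borel"
  unfolding inv_root_def clip_def by measurable

context local_dependence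
begin

text \<open>
  The average over the vertices of \<open>\<eta>\<close>, so that \<open>W \<Omega>\<close> is the centring term of the self-normaliser.
\<close>

definition \<Omega> :: "'a \<Rightarrow> real" where
  "\<Omega> \<omega> = (\<Sum>j\<in>V. real (card (A j)) * \<xi> j \<omega>) / real (card V)"

lemma Omega_eq: "\<Omega> \<omega> = (\<Sum>i\<in>V. \<eta> i \<omega>) / real (card V)"
proof -
  have "(\<Sum>i\<in>V. \<eta> i \<omega>) = (\<Sum>i\<in>V. \<Sum>j\<in>A i. \<xi> i \<omega>)" by (rule sum_pairs_swap)
  then show ?thesis by (simp add: \<Omega>_def)
qed

text \<open>
  With the normalised variables, \<open>V\<^sup>2 / \<sigma>\<^sup>2\<close> is \<open>1 + self_defect\<close> wherever this is nonnegative.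
\<close>

definition self_defect :: "'a \<Rightarrow> real" where
  "self_defect \<omega> = Q \<omega> - 1 - W \<omega> * \<Omega> \<omega>"

end

text \<open>
  For a graph, \<open>D\<close> is the maximal degree plus 1, and a vertex has at most \<open>card V - 1\<close> neighbours.
\<close>

locale dense_local_dependence = local_dependence +
  assumes D_le_card: "D \<le> real (card V)" and beta_le_1: "\<beta> \<le> 1"
begin

lemma card_V_pos: "0 < real (card V)"
  using D_pos D_le_card by linarith

lemma density_bounds:
  "\<Lambda> * (D / real (card V)) \<le> \<beta>" "sqrt \<Lambda> * (D / real (card V)) \<le> \<beta>"
proof -
  let ?r = "D / real (card V)"
  have r: "0 \<le> ?r" "?r \<le> 1" using D_pos D_le_card card_V_pos by auto
  have "?r = sqrt ?r * sqrt ?r" using r(1) by (simp only: real_sqrt_mult_self abs_of_nonneg)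
  also have "\<dots> \<le> 1 * sqrt ?r" using r by (intro mult_right_mono) auto
  finally have "?r \<le> sqrt ?r" by simp
  then have "\<Lambda> * ?r \<le> \<Lambda> * sqrt ?r" using Lambda_ge_1 by (intro mult_left_mono) auto
  then show 1: "\<Lambda> * ?r \<le> \<beta>" using Lambda_density by linarith
  have "sqrt \<Lambda> = 1 * sqrt \<Lambda>" by simp
  also have "\<dots> \<le> sqrt \<Lambda> * sqrt \<Lambda>" using Lambda_ge_1 by (intro mult_right_mono) auto
  also have "\<dots> = \<Lambda>" using Lambda_ge_1 by simp
  finally have "sqrt \<Lambda> * ?r \<le> \<Lambda> * ?r" using r by (intro mult_right_mono) auto
  then show "sqrt \<Lambda> * ?r \<le> \<beta>" using 1 by linarith
qed

text \<open>
  \<open>\<Omega>\<close> is \<open>D / card V\<close> times a weighted sum with weights at most 1, whose norm is of order \<open>sqrt \<Lambda>\<close>; the density bound absorbs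
  \<open>sqrt \<Lambda> D / card V\<close> into \<open>\<beta>\<close>.
\<close>

lemma L4_Omega: "\<Omega> \<in> L4" "L4_norm \<Omega> \<le> 4 * \<beta>"
proof -
  let ?c = "\<lambda>j. real (card (A j)) / D"
  have eq: "\<Omega> = (\<lambda>\<omega>. D / real (card V) * (\<Sum>j\<in>V. ?c j * \<xi> j \<omega>))"
    using D_pos by (auto simp: \<Omega>_def fun_eq_iff sum_distrib_left sum_divide_distrib intro!: sum.cong)
  have c: "\<bar>?c i\<bar> \<le> 1" if "i \<in> V" for i using A_card[OF that] D_pos by simp
  show "\<Omega> \<in> L4" unfolding eq by (intro L4_cmult L4_sum L4_xi)
  have "L4_norm \<Omega> = D / real (card V) * L4_norm (\<lambda>\<omega>. \<Sum>j\<in>V. ?c j * \<xi> j \<omega>)"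
    unfolding eq L4_norm_cmult using D_pos by simp
  also have "\<dots> \<le> D / real (card V) * (4 * sqrt \<Lambda>)"
    using D_pos by (intro mult_left_mono L4_norm_weighted_sum c beta_le_1) auto
  also have "\<dots> \<le> 4 * \<beta>" using mult_left_mono[OF density_bounds(2), of 4] by (simp add: mult_ac)
  finally show "L4_norm \<Omega> \<le> 4 * \<beta>" .
qed

lemma L4_norm_rest: "k \<in> V \<Longrightarrow> L4_norm (\<lambda>\<omega>. W \<omega> - \<eta> k \<omega>) \<le> 4 * \<Lambda>"
proof -
  assume k: "k \<in> V"
  let ?c = "\<lambda>i. if i \<in> V - A k then 1 else 0 :: real"
  have "(\<lambda>\<omega>. W \<omega> - \<eta> k \<omega>) = (\<lambda>\<omega>. \<Sum>i\<in>V. ?c i * \<xi> i \<omega>)"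
  proof
    fix \<omega>
    have "W \<omega> - \<eta> k \<omega> = (\<Sum>i\<in>V \<inter> (V - A k). \<xi> i \<omega>)"
      unfolding sum_minus_nbhd[OF k] by (rule sum.cong) auto
    also have "\<dots> = (\<Sum>i\<in>V. if i \<in> V - A k then \<xi> i \<omega> else 0)"
      by (rule sum.inter_restrict[OF finite_V])
    also have "\<dots> = (\<Sum>i\<in>V. ?c i * \<xi> i \<omega>)" by (intro sum.cong refl) auto
    finally show "W \<omega> - \<eta> k \<omega> = (\<Sum>i\<in>V. ?c i * \<xi> i \<omega>)" .
  qed
  then have "L4_norm (\<lambda>\<omega>. W \<omega> - \<eta> k \<omega>) \<le> 4 * sqrt \<Lambda>"
    using L4_norm_weighted_sum[of ?c] beta_le_1 by simp
  moreover have "sqrt \<Lambda> \<le> sqrt (\<Lambda>\<^sup>2)"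
    using Lambda_ge_1 by (intro real_sqrt_le_mono) (simp add: power2_eq_square)
  ultimately show ?thesis using Lambda_ge_1 by simp
qed

lemma correction_L1:
  "integrable M (\<lambda>\<omega>. \<bar>W \<omega> * \<Omega> \<omega>\<bar>)" "expectation (\<lambda>\<omega>. \<bar>W \<omega> * \<Omega> \<omega>\<bar>) \<le> 16 * \<beta>"
proof -
  show "integrable M (\<lambda>\<omega>. \<bar>W \<omega> * \<Omega> \<omega>\<bar>)" using L4_holder2(1)[OF L4_W L4_Omega(1)] by auto
  have "L4_norm W * L4_norm \<Omega> \<le> 4 * (4 * \<beta>)"
    using beta_bounds by (intro mult_mono L4_norm_W beta_le_1 L4_Omega) auto
  then show "expectation (\<lambda>\<omega>. \<bar>W \<omega> * \<Omega> \<omega>\<bar>) \<le> 16 * \<beta>"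
    using L4_holder2(2)[OF L4_W L4_Omega(1)] by simp
qed

lemma self_defect_L1:
  "self_defect \<in> borel_measurable M"
  "integrable M (\<lambda>\<omega>. \<bar>self_defect \<omega>\<bar>)" "expectation (\<lambda>\<omega>. \<bar>self_defect \<omega>\<bar>) \<le> 19 * \<beta>"
proof -
  have Qm: "Q \<in> borel_measurable M" and Qi: "integrable M Q"
    using weighted_pair_sum(1,2)[of "\<lambda>_. 1"] by simp_all
  have Wm: "W \<in> borel_measurable M" "\<Omega> \<in> borel_measurable M"
    using L4_measurable L4_W L4_Omega by auto
  show m: "self_defect \<in> borel_measurable M"
    unfolding self_defect_def using Qm Wm by measurable
  have le: "\<bar>self_defect \<omega>\<bar> \<le> \<bar>Q \<omega> - 1\<bar> + \<bar>W \<omega> * \<Omega> \<omega>\<bar>" for \<omega>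
    unfolding self_defect_def by (rule abs_triangle_ineq4)
  have i: "integrable M (\<lambda>\<omega>. \<bar>Q \<omega> - 1\<bar> + \<bar>W \<omega> * \<Omega> \<omega>\<bar>)"
    by (intro Bochner_Integration.integrable_add Q_error_integrable correction_L1)
  show i2: "integrable M (\<lambda>\<omega>. \<bar>self_defect \<omega>\<bar>)"
    by (rule Bochner_Integration.integrable_bound[OF i])
       (use m le in \<open>auto intro!: AE_I2 intro: order_trans[OF _ abs_ge_self]\<close>)
  have "expectation (\<lambda>\<omega>. \<bar>self_defect \<omega>\<bar>) \<le> expectation (\<lambda>\<omega>. \<bar>Q \<omega> - 1\<bar> + \<bar>W \<omega> * \<Omega> \<omega>\<bar>)"
    by (intro integral_mono i i2 le)
  also have "\<dots> = expectation (\<lambda>\<omega>. \<bar>Q \<omega> - 1\<bar>) + expectation (\<lambda>\<omega>. \<bar>W \<omega> * \<Omega> \<omega>\<bar>)"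
    by (intro Bochner_Integration.integral_add Q_error_integrable correction_L1)
  also have "\<dots> \<le> 19 * \<beta>" using Q_L1_error correction_L1(2) by linarith
  finally show "expectation (\<lambda>\<omega>. \<bar>self_defect \<omega>\<bar>) \<le> 19 * \<beta>" .
qed

text \<open>
  These are \<open>Q\<close>, \<open>\<Omega>\<close> and \<open>self_defect\<close> without the terms that involve the neighbourhood of \<open>k\<close>.
\<close>

definition local_Q :: "'b \<Rightarrow> 'a \<Rightarrow> real" where
  "local_Q k \<omega> = (\<Sum>i\<in>V. \<Sum>j\<in>A i. if i \<in> A k \<or> j \<in> A k then 0 else \<xi> i \<omega> * \<xi> j \<omega>)"

definition local_Omega :: "'b \<Rightarrow> 'a \<Rightarrow> real" where
  "local_Omega k \<omega> = (\<Sum>j\<in>V - A k. real (card (A j)) * \<xi> j \<omega>) / real (card V)"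

definition local_defect :: "'b \<Rightarrow> 'a \<Rightarrow> real" where
  "local_defect k \<omega> = local_Q k \<omega> - 1 - (W \<omega> - \<eta> k \<omega>) * local_Omega k \<omega>"

abbreviation "near k \<omega> \<equiv> \<Sum>j\<in>A k. \<bar>\<xi> j \<omega>\<bar>"

lemma local_defect_generated:
  assumes k: "k \<in> V" shows "local_defect k \<in> borel_measurable (generated (V - A k))"
proof -
  have x: "\<xi> i \<in> borel_measurable (generated (V - A k))" if "i \<in> V" "i \<notin> A k" for i
    using that by (intro xi_generated) auto
  have "(\<lambda>\<omega>. if i \<in> A k \<or> j \<in> A k then 0 else \<xi> i \<omega> * \<xi> j \<omega>) \<in> borel_measurable (generated (V - A k))"
    if "i \<in> V" "j \<in> A i" for i j
    using that in_A[OF that] by (cases "i \<in> A k \<or> j \<in> A k") (auto intro!: borel_measurable_times x)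
  then have "local_Q k \<in> borel_measurable (generated (V - A k))"
    unfolding local_Q_def by (intro borel_measurable_sum)
  moreover have "local_Omega k \<in> borel_measurable (generated (V - A k))"
    unfolding local_Omega_def by (intro borel_measurable_divide borel_measurable_sum borel_measurable_times borel_measurable_const x) auto
  moreover have "(\<lambda>\<omega>. W \<omega> - \<eta> k \<omega>) \<in> borel_measurable (generated (V - A k))"
    unfolding sum_minus_nbhd[OF k] by (intro borel_measurable_sum x) auto
  ultimately show ?thesis unfolding local_defect_def by measurable
qed

lemma Q_local_difference:
  assumes k: "k \<in> V"
  shows "\<bar>Q \<omega> - local_Q k \<omega>\<bar> \<le> 2 * (\<Sum>i\<in>A k. \<Sum>j\<in>A i. \<bar>\<xi> i \<omega> * \<xi> j \<omega>\<bar>)"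
proof -
  let ?a = "\<lambda>i j. if i \<in> A k then \<bar>\<xi> i \<omega> * \<xi> j \<omega>\<bar> else 0"
  have "Q \<omega> - local_Q k \<omega> = (\<Sum>i\<in>V. \<Sum>j\<in>A i. if i \<in> A k \<or> j \<in> A k then \<xi> i \<omega> * \<xi> j \<omega> else 0)"
    unfolding local_Q_def by (simp only: sum_subtractf[symmetric]) (intro sum.cong refl, simp)
  also have "\<bar>\<dots>\<bar> \<le> (\<Sum>i\<in>V. \<Sum>j\<in>A i. \<bar>if i \<in> A k \<or> j \<in> A k then \<xi> i \<omega> * \<xi> j \<omega> else 0\<bar>)"
    by (rule order_trans[OF sum_abs sum_mono[OF sum_abs]])
  also have "\<dots> \<le> (\<Sum>i\<in>V. \<Sum>j\<in>A i. ?a i j + ?a j i)"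
    by (intro sum_mono) (auto simp: mult.commute)
  also have "\<dots> = (\<Sum>i\<in>V. \<Sum>j\<in>A i. ?a i j) + (\<Sum>i\<in>V. \<Sum>j\<in>A i. ?a j i)"
    by (rule sum_pairs_distrib)
  also have "(\<Sum>i\<in>V. \<Sum>j\<in>A i. ?a j i) = (\<Sum>i\<in>V. \<Sum>j\<in>A i. ?a i j)"
    by (rule sum_pairs_swap)
  also have "(\<Sum>i\<in>V. \<Sum>j\<in>A i. ?a i j) = (\<Sum>i\<in>V. if i \<in> A k then (\<Sum>j\<in>A i. \<bar>\<xi> i \<omega> * \<xi> j \<omega>\<bar>) else 0)"
    by (intro sum.cong refl) auto
  also have "\<dots> = (\<Sum>i\<in>V \<inter> A k. \<Sum>j\<in>A i. \<bar>\<xi> i \<omega> * \<xi> j \<omega>\<bar>)"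
    by (rule sum.inter_restrict[OF finite_V, symmetric])
  also have "V \<inter> A k = A k" using A_subset[OF k] by auto
  finally show ?thesis by simp
qed

lemma correction_local_difference:
  assumes k: "k \<in> V"
  shows "\<bar>W \<omega> * \<Omega> \<omega> - (W \<omega> - \<eta> k \<omega>) * local_Omega k \<omega>\<bar>
    \<le> \<bar>\<eta> k \<omega>\<bar> * \<bar>\<Omega> \<omega>\<bar> + D / real (card V) * (\<bar>W \<omega> - \<eta> k \<omega>\<bar> * near k \<omega>)"
proof -
  have d: "\<Omega> \<omega> - local_Omega k \<omega> = (\<Sum>j\<in>A k. real (card (A j)) * \<xi> j \<omega>) / real (card V)"
    unfolding \<Omega>_def local_Omega_def sum_minus_nbhd[OF k, symmetric]
    by (simp add: diff_divide_distrib)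
  have "\<bar>\<Sum>j\<in>A k. real (card (A j)) * \<xi> j \<omega>\<bar> \<le> (\<Sum>j\<in>A k. D * \<bar>\<xi> j \<omega>\<bar>)"
    using in_A[OF k] A_card
    by (intro order_trans[OF sum_abs] sum_mono) (auto simp: abs_mult intro!: mult_right_mono)
  then have "\<bar>\<Omega> \<omega> - local_Omega k \<omega>\<bar> \<le> (D * near k \<omega>) / real (card V)"
    unfolding d abs_divide by (simp add: sum_distrib_left divide_right_mono)
  then have "\<bar>W \<omega> - \<eta> k \<omega>\<bar> * \<bar>\<Omega> \<omega> - local_Omega k \<omega>\<bar> \<le> \<bar>W \<omega> - \<eta> k \<omega>\<bar> * ((D * near k \<omega>) / real (card V))"
    by (intro mult_left_mono) auto
  moreover have "W \<omega> * \<Omega> \<omega> - (W \<omega> - \<eta> k \<omega>) * local_Omega k \<omega>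
      = \<eta> k \<omega> * \<Omega> \<omega> + (W \<omega> - \<eta> k \<omega>) * (\<Omega> \<omega> - local_Omega k \<omega>)"
    by (simp add: algebra_simps)
  moreover have "\<bar>\<eta> k \<omega> * \<Omega> \<omega> + (W \<omega> - \<eta> k \<omega>) * (\<Omega> \<omega> - local_Omega k \<omega>)\<bar>
      \<le> \<bar>\<eta> k \<omega>\<bar> * \<bar>\<Omega> \<omega>\<bar> + \<bar>W \<omega> - \<eta> k \<omega>\<bar> * \<bar>\<Omega> \<omega> - local_Omega k \<omega>\<bar>"
    unfolding abs_mult[symmetric] by (rule abs_triangle_ineq)
  ultimately show ?thesis by (simp add: mult_ac)
qed

sublocale perturbed_sum M V A D \<xi> "\<lambda>\<omega>. inv_root (self_defect \<omega>)" "\<lambda>k \<omega>. inv_root (local_defect k \<omega>)"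
proof unfold_locales
  show "(\<lambda>\<omega>. inv_root (self_defect \<omega>)) \<in> borel_measurable M"
    using self_defect_L1(1) by measurable
  show "(\<lambda>\<omega>. inv_root (local_defect k \<omega>)) \<in> borel_measurable (generated (V - A k))" if "k \<in> V" for k
    using local_defect_generated[OF that] by measurable
qed (auto simp: inv_root_bound beta_le_1)

text \<open>
  As \<open>G\<^sup>2 = 1 / (1 + self_defect)\<close> and \<open>Q = 1 + self_defect + W \<Omega>\<close>, the first-order effect of the defect cancels in \<open>G\<^sup>2 Q\<close>.
\<close>

lemma scale_error_le: "scale_error \<le> 70 * \<beta>"
proof -
  have "scale_error \<le> expectation (\<lambda>\<omega>. 2 * \<bar>self_defect \<omega>\<bar> + 2 * \<bar>W \<omega> * \<Omega> \<omega>\<bar>)"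
    unfolding scale_error_def
  proof (rule integral_mono[OF scale_error_integrable])
    show "integrable M (\<lambda>\<omega>. 2 * \<bar>self_defect \<omega>\<bar> + 2 * \<bar>W \<omega> * \<Omega> \<omega>\<bar>)"
      by (intro Bochner_Integration.integrable_add Bochner_Integration.integrable_mult_right self_defect_L1 correction_L1)
    fix \<omega>
    let ?c = "clip (self_defect \<omega>)"
    have c: "1 / 2 \<le> 1 + ?c" by (rule clip_bounds)
    have "1 - (inv_root (self_defect \<omega>))\<^sup>2 * Q \<omega> = ((?c - self_defect \<omega>) - W \<omega> * \<Omega> \<omega>) / (1 + ?c)"
      unfolding inv_root_sq using c by (simp add: self_defect_def field_simps)
    also have "\<bar>\<dots>\<bar> = \<bar>(?c - self_defect \<omega>) - W \<omega> * \<Omega> \<omega>\<bar> / (1 + ?c)" using c by (simp add: abs_divide)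
    also have "\<dots> \<le> \<bar>(?c - self_defect \<omega>) - W \<omega> * \<Omega> \<omega>\<bar> / (1 / 2)"
      using c by (intro divide_left_mono) auto
    also have "\<dots> = 2 * \<bar>(?c - self_defect \<omega>) - W \<omega> * \<Omega> \<omega>\<bar>" by simp
    also have "\<dots> \<le> 2 * (\<bar>self_defect \<omega>\<bar> + \<bar>W \<omega> * \<Omega> \<omega>\<bar>)"
    proof -
      have "\<bar>?c - self_defect \<omega>\<bar> \<le> \<bar>self_defect \<omega>\<bar>" by (auto simp: clip_def)
      then have "\<bar>(?c - self_defect \<omega>) - W \<omega> * \<Omega> \<omega>\<bar> \<le> \<bar>self_defect \<omega>\<bar> + \<bar>W \<omega> * \<Omega> \<omega>\<bar>"
        by (rule order_trans[OF abs_triangle_ineq4 add_right_mono])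
      then show ?thesis by (rule mult_left_mono) simp
    qed
    finally show "\<bar>1 - (inv_root (self_defect \<omega>))\<^sup>2 * Q \<omega>\<bar> \<le> 2 * \<bar>self_defect \<omega>\<bar> + 2 * \<bar>W \<omega> * \<Omega> \<omega>\<bar>"
      by simp
  qed
  also have "\<dots> = 2 * expectation (\<lambda>\<omega>. \<bar>self_defect \<omega>\<bar>) + 2 * expectation (\<lambda>\<omega>. \<bar>W \<omega> * \<Omega> \<omega>\<bar>)"
    using self_defect_L1(2) correction_L1(1) by simp
  also have "\<dots> \<le> 70 * \<beta>" using self_defect_L1(3) correction_L1(2) by linarith
  finally show ?thesis .
qed

text \<open>
  The sum of the \<open>\<bar>\<xi>\<^sub>k \<xi>\<^sub>j\<bar>\<close> has second moment of order \<open>\<Lambda>\<^sup>2\<close>, so it can be separated from the other factors by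
  Cauchy-Schwarz with \<open>\<Lambda>\<close> instead of a sum of squared \<open>L\<^sub>4\<close> norms.
\<close>

lemma pair_sum_times_L4:
  assumes Y: "Y \<in> L4" and Z: "Z \<in> L4"
  shows "(\<Sum>k\<in>V. \<Sum>j\<in>A k. expectation (\<lambda>\<omega>. \<bar>\<xi> k \<omega> * \<xi> j \<omega> * Y \<omega> * Z \<omega>\<bar>)) \<le> 4 * \<Lambda> * L4_norm Y * L4_norm Z"
proof -
  let ?L = "\<lambda>\<omega>. \<Sum>i\<in>V. \<Sum>j\<in>A i. \<bar>\<xi> i \<omega> * \<xi> j \<omega>\<bar>"
  note L = abs_pair_sum[OF beta_le_1]
  have i: "integrable M (\<lambda>\<omega>. \<bar>\<xi> k \<omega> * \<xi> j \<omega> * Y \<omega> * Z \<omega>\<bar>)" if "k \<in> V" "j \<in> A k" for k j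
    using that in_A by (intro integrable_abs L4_holder(1) L4_xi Y Z) auto
  have m: "(\<lambda>\<omega>. Y \<omega> * Z \<omega>) \<in> borel_measurable M"
    using L4_measurable[OF Y] L4_measurable[OF Z] by measurable
  have "(\<Sum>k\<in>V. \<Sum>j\<in>A k. expectation (\<lambda>\<omega>. \<bar>\<xi> k \<omega> * \<xi> j \<omega> * Y \<omega> * Z \<omega>\<bar>))
      = expectation (\<lambda>\<omega>. \<Sum>k\<in>V. \<Sum>j\<in>A k. \<bar>\<xi> k \<omega> * \<xi> j \<omega> * Y \<omega> * Z \<omega>\<bar>)"
    by (rule expectation_sum_pairs(2)[symmetric]) (rule i)
  also have "\<dots> = expectation (\<lambda>\<omega>. \<bar>?L \<omega> * (Y \<omega> * Z \<omega>)\<bar>)"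
  proof (intro Bochner_Integration.integral_cong refl)
    fix \<omega>
    have "\<bar>?L \<omega>\<bar> = ?L \<omega>" by (intro abs_of_nonneg sum_nonneg) auto
    then have "\<bar>?L \<omega> * (Y \<omega> * Z \<omega>)\<bar> = ?L \<omega> * \<bar>Y \<omega> * Z \<omega>\<bar>"
      by (simp only: abs_mult[of "?L \<omega>"])
    also have "\<dots> = (\<Sum>k\<in>V. \<Sum>j\<in>A k. \<bar>\<xi> k \<omega> * \<xi> j \<omega> * Y \<omega> * Z \<omega>\<bar>)"
      by (simp only: sum_distrib_right abs_mult mult.assoc)
    finally show "(\<Sum>k\<in>V. \<Sum>j\<in>A k. \<bar>\<xi> k \<omega> * \<xi> j \<omega> * Y \<omega> * Z \<omega>\<bar>) = \<bar>?L \<omega> * (Y \<omega> * Z \<omega>)\<bar>" by simp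
  qed
  also have "\<dots> \<le> sqrt (expectation (\<lambda>\<omega>. (?L \<omega>)\<^sup>2)) * sqrt (expectation (\<lambda>\<omega>. (Y \<omega> * Z \<omega>)\<^sup>2))"
    by (rule cauchy_schwarz_expectation(2)[OF L(1) m L(2) L4_product_square(1)[OF Y Z]])
  also have "\<dots> \<le> (4 * \<Lambda>) * (L4_norm Y * L4_norm Z)"
    using Lambda_ge_1 by (intro mult_mono L(3) L4_product_square(2)[OF Y Z]) auto
  finally show ?thesis by (simp add: mult.assoc)
qed

lemma sum_path_triple:
  "(\<Sum>k\<in>V. \<Sum>i\<in>A k. \<Sum>j\<in>A i. (x k ^ 3 + x i ^ 3 + x j ^ 3) / 3) \<le> T3"
proof -
  have "(\<Sum>k\<in>V. \<Sum>i\<in>A k. \<Sum>j\<in>A i. (x k ^ 3 + x i ^ 3 + x j ^ 3) / 3)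
      = (\<Sum>k\<in>V. \<Sum>i\<in>A k. \<Sum>j\<in>A k. (x i ^ 3 + x k ^ 3 + x j ^ 3) / 3)"
    by (rule sum_pairs_swap)
  also have "\<dots> = (\<Sum>k\<in>V. \<Sum>i\<in>A k. \<Sum>j\<in>A k. x k ^ 3 + x i ^ 3 + x j ^ 3) / 3"
    by (simp only: sum_divide_distrib add.commute)
  also have "\<dots> \<le> (3 * D\<^sup>2 * (\<Sum>k\<in>V. x k ^ 3)) / 3"
    by (intro divide_right_mono sum_star3_le) auto
  finally show ?thesis by (simp add: T3_def)
qed

text \<open>
  Leaving out the neighbourhood of \<open>k\<close> changes \<open>Q\<close> by products of pairs near \<open>k\<close>, and \<open>W \<Omega>\<close> by \<open>\<eta>\<^sub>k \<Omega>\<close> plus \<open>(W - \<eta>\<^sub>k)\<close> times the local part of \<open>\<Omega>\<close>.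
  Then \<open>W - \<eta>\<^sub>k\<close> is expressed through \<open>W\<close> and \<open>\<eta>\<^sub>k\<close> wherever a sum over \<open>k\<close> has to be taken before the expectation.
\<close>

lemma leave_error_pointwise:
  assumes k: "k \<in> V"
  shows "\<bar>\<xi> k \<omega>\<bar> * \<bar>inv_root (self_defect \<omega>) - inv_root (local_defect k \<omega>)\<bar> * (1 + \<bar>rest k \<omega>\<bar>)
    \<le> 4 * (\<Sum>i\<in>A k. \<Sum>j\<in>A i. \<bar>\<xi> k \<omega> * \<xi> i \<omega> * \<xi> j \<omega> * 1\<bar> + \<bar>\<xi> k \<omega> * \<xi> i \<omega> * \<xi> j \<omega> * rest k \<omega>\<bar>)
      + 2 * (\<Sum>j\<in>A k. \<bar>\<xi> k \<omega> * \<xi> j \<omega> * \<Omega> \<omega> * 1\<bar> + \<bar>\<xi> k \<omega> * \<xi> j \<omega> * \<Omega> \<omega> * W \<omega>\<bar>)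
      + 2 * (\<bar>\<xi> k \<omega>\<bar> * (\<eta> k \<omega>)\<^sup>2 * \<bar>\<Omega> \<omega>\<bar>)
      + 2 * (D / real (card V)) * ((\<Sum>j\<in>A k. \<bar>\<xi> k \<omega> * \<xi> j \<omega> * 1 * 1\<bar> + 4 * \<bar>\<xi> k \<omega> * \<xi> j \<omega> * W \<omega> * W \<omega>\<bar>)
        + 4 * (\<Sum>i\<in>A k. \<Sum>j\<in>A k. \<Sum>l\<in>A k. \<bar>\<xi> k \<omega> * \<xi> i \<omega> * \<xi> j \<omega> * \<xi> l \<omega>\<bar>))"
proof -
  define X where "X = \<bar>\<xi> k \<omega>\<bar>"
  define q where "q = (\<Sum>i\<in>A k. \<Sum>j\<in>A i. \<bar>\<xi> i \<omega> * \<xi> j \<omega>\<bar>)"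
  define e where "e = \<bar>\<eta> k \<omega>\<bar>"
  define o' where "o' = \<bar>\<Omega> \<omega>\<bar>"
  define r where "r = \<bar>rest k \<omega>\<bar>"
  define w where "w = \<bar>W \<omega>\<bar>"
  define n where "n = near k \<omega>"
  define \<rho> where "\<rho> = D / real (card V)"
  have nn: "0 \<le> X" "0 \<le> q" "0 \<le> e" "0 \<le> o'" "0 \<le> r" "0 \<le> w" "0 \<le> n" "0 \<le> \<rho>"
    using D_pos by (auto simp: X_def q_def e_def o'_def r_def w_def n_def \<rho>_def intro!: sum_nonneg)
  have en: "e \<le> n" unfolding e_def n_def by (rule sum_abs)
  have rw: "r \<le> w + e" unfolding r_def w_def e_def by (rule abs_triangle_ineq4)
  have "\<bar>self_defect \<omega> - local_defect k \<omega>\<bar> \<le> 2 * q + (e * o' + \<rho> * (r * n))"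
  proof -
    have "self_defect \<omega> - local_defect k \<omega>
        = (Q \<omega> - local_Q k \<omega>) - (W \<omega> * \<Omega> \<omega> - (W \<omega> - \<eta> k \<omega>) * local_Omega k \<omega>)"
      by (simp add: self_defect_def local_defect_def)
    also have "\<bar>\<dots>\<bar> \<le> \<bar>Q \<omega> - local_Q k \<omega>\<bar> + \<bar>W \<omega> * \<Omega> \<omega> - (W \<omega> - \<eta> k \<omega>) * local_Omega k \<omega>\<bar>"
      by (rule abs_triangle_ineq4)
    also have "\<dots> \<le> 2 * q + (e * o' + \<rho> * (r * n))"
      unfolding q_def e_def o'_def r_def n_def \<rho>_def
      by (intro add_mono Q_local_difference correction_local_difference k)
    finally show ?thesis .
  qed
  then have g: "\<bar>inv_root (self_defect \<omega>) - inv_root (local_defect k \<omega>)\<bar> \<le> 2 * (2 * q + (e * o' + \<rho> * (r * n)))"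
    by (rule order_trans[OF inv_root_lipschitz mult_left_mono]) simp
  have r2: "r + r * r \<le> 1 + 4 * (w * w) + 4 * (e * e)"
  proof -
    have "0 \<le> (r - 1)\<^sup>2" by simp
    then have "2 * r \<le> 1 + r * r" by (simp add: power2_eq_square algebra_simps)
    moreover have "r * r \<le> (w + e) * (w + e)" using rw nn by (intro mult_mono) auto
    moreover have "(w + e) * (w + e) \<le> 2 * (w * w) + 2 * (e * e)"
      using sum_squares_bound[of w e] by (simp add: power2_eq_square algebra_simps)
    moreover have "0 \<le> r * r" using nn by simp
    ultimately show ?thesis using nn by linarith
  qed
  have "X * \<bar>inv_root (self_defect \<omega>) - inv_root (local_defect k \<omega>)\<bar> * (1 + r)
      \<le> X * (2 * (2 * q + (e * o' + \<rho> * (r * n)))) * (1 + r)"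
    using nn by (intro mult_right_mono mult_left_mono g) auto
  also have "\<dots> = 4 * (X * q + X * q * r) + 2 * (X * e * o' * (1 + r)) + 2 * \<rho> * (X * n * (r + r * r))"
    by (simp add: algebra_simps)
  also have "\<dots> \<le> 4 * (X * q + X * q * r) + 2 * (X * n * o' * (1 + w) + X * (e * e) * o')
      + 2 * \<rho> * (X * n * (1 + 4 * (w * w)) + 4 * (X * (n * (n * n))))"
  proof (intro add_mono mult_left_mono order_refl)
    have "X * e * o' * (1 + r) \<le> X * e * o' * (1 + (w + e))"
      using nn rw by (intro mult_left_mono) auto
    also have "\<dots> = X * e * o' * (1 + w) + X * (e * e) * o'" by (simp add: algebra_simps)
    also have "X * e * o' * (1 + w) \<le> X * n * o' * (1 + w)"
      using nn en by (intro mult_right_mono mult_left_mono) auto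
    finally show "X * e * o' * (1 + r) \<le> X * n * o' * (1 + w) + X * (e * e) * o'" by simp
    have "X * n * (r + r * r) \<le> X * n * (1 + 4 * (w * w) + 4 * (e * e))"
      using nn r2 by (intro mult_left_mono) auto
    also have "\<dots> = X * n * (1 + 4 * (w * w)) + 4 * (X * (n * (e * e)))" by (simp add: algebra_simps)
    also have "X * (n * (e * e)) \<le> X * (n * (n * n))"
      using nn en by (intro mult_left_mono mult_mono) auto
    finally show "X * n * (r + r * r) \<le> X * n * (1 + 4 * (w * w)) + 4 * (X * (n * (n * n)))" by simp
  qed (use nn in auto)
  also have "X * q + X * q * r
      = (\<Sum>i\<in>A k. \<Sum>j\<in>A i. \<bar>\<xi> k \<omega> * \<xi> i \<omega> * \<xi> j \<omega> * 1\<bar> + \<bar>\<xi> k \<omega> * \<xi> i \<omega> * \<xi> j \<omega> * rest k \<omega>\<bar>)"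
    unfolding X_def q_def r_def abs_mult abs_one mult_1_right sum.distrib sum_distrib_left sum_distrib_right
    by (simp only: mult.assoc)
  also have "X * n * o' * (1 + w) = (\<Sum>j\<in>A k. \<bar>\<xi> k \<omega> * \<xi> j \<omega> * \<Omega> \<omega> * 1\<bar> + \<bar>\<xi> k \<omega> * \<xi> j \<omega> * \<Omega> \<omega> * W \<omega>\<bar>)"
  proof -
    have "\<bar>\<xi> k \<omega> * \<xi> j \<omega> * \<Omega> \<omega> * 1\<bar> + \<bar>\<xi> k \<omega> * \<xi> j \<omega> * \<Omega> \<omega> * W \<omega>\<bar> = X * \<bar>\<xi> j \<omega>\<bar> * o' * (1 + w)" for j
      unfolding X_def o'_def w_def abs_mult by (simp only: distrib_left abs_one)
    then show ?thesis unfolding n_def by (simp only: sum_distrib_left sum_distrib_right)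
  qed
  also have "X * n * (1 + 4 * (w * w)) = (\<Sum>j\<in>A k. \<bar>\<xi> k \<omega> * \<xi> j \<omega> * 1 * 1\<bar> + 4 * \<bar>\<xi> k \<omega> * \<xi> j \<omega> * W \<omega> * W \<omega>\<bar>)"
  proof -
    have "\<bar>\<xi> k \<omega> * \<xi> j \<omega> * 1 * 1\<bar> + 4 * \<bar>\<xi> k \<omega> * \<xi> j \<omega> * W \<omega> * W \<omega>\<bar> = X * \<bar>\<xi> j \<omega>\<bar> * (1 + 4 * (w * w))" for j
      unfolding X_def w_def abs_mult by (simp only: distrib_left abs_one mult_1_right mult_ac)
    then show ?thesis unfolding n_def by (simp only: sum_distrib_left sum_distrib_right)
  qed
  also have "X * (n * (n * n)) = (\<Sum>i\<in>A k. \<Sum>j\<in>A k. \<Sum>l\<in>A k. \<bar>\<xi> k \<omega> * \<xi> i \<omega> * \<xi> j \<omega> * \<xi> l \<omega>\<bar>)"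
    unfolding X_def n_def sum_product sum_distrib_left sum_distrib_right abs_mult
    by (simp only: mult_ac)
  also have "X * (e * e) * o' = \<bar>\<xi> k \<omega>\<bar> * (\<eta> k \<omega>)\<^sup>2 * \<bar>\<Omega> \<omega>\<bar>"
    unfolding X_def e_def o'_def by (simp add: power2_eq_square)
  finally show ?thesis unfolding X_def r_def \<rho>_def by (simp only: distrib_left add.assoc)
qed

text \<open>
  The five sums are of order \<open>\<Lambda> \<beta>\<close>, except for those with the factor \<open>D / card V\<close>: they are of order \<open>\<Lambda> D / card V\<close>, which is at most \<open>\<beta>\<close>.
\<close>

lemma leave_error_le: "leave_error \<le> 716 * \<Lambda> * \<beta>"
proof -
  let ?\<rho> = "D / real (card V)"
  let ?a = "\<lambda>k \<omega>. \<Sum>i\<in>A k. \<Sum>j\<in>A i. \<bar>\<xi> k \<omega> * \<xi> i \<omega> * \<xi> j \<omega> * 1\<bar> + \<bar>\<xi> k \<omega> * \<xi> i \<omega> * \<xi> j \<omega> * rest k \<omega>\<bar>"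
  let ?b = "\<lambda>k \<omega>. \<Sum>j\<in>A k. \<bar>\<xi> k \<omega> * \<xi> j \<omega> * \<Omega> \<omega> * 1\<bar> + \<bar>\<xi> k \<omega> * \<xi> j \<omega> * \<Omega> \<omega> * W \<omega>\<bar>"
  let ?c = "\<lambda>k \<omega>. \<bar>\<xi> k \<omega>\<bar> * (\<eta> k \<omega>)\<^sup>2 * \<bar>\<Omega> \<omega>\<bar>"
  let ?d = "\<lambda>k \<omega>. \<Sum>j\<in>A k. \<bar>\<xi> k \<omega> * \<xi> j \<omega> * 1 * 1\<bar> + 4 * \<bar>\<xi> k \<omega> * \<xi> j \<omega> * W \<omega> * W \<omega>\<bar>"
  let ?f = "\<lambda>k \<omega>. \<Sum>i\<in>A k. \<Sum>j\<in>A k. \<Sum>l\<in>A k. \<bar>\<xi> k \<omega> * \<xi> i \<omega> * \<xi> j \<omega> * \<xi> l \<omega>\<bar>"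
  have r0: "0 \<le> ?\<rho>" using D_pos by simp
  have i4: "integrable M (\<lambda>\<omega>. \<bar>\<xi> k \<omega> * \<xi> i \<omega> * Y \<omega> * Z \<omega>\<bar>)"
    if "k \<in> V" "i \<in> V" "Y \<in> L4" "Z \<in> L4" for k i Y Z
    using that by (intro integrable_abs L4_holder(1) L4_xi)
  note one = L4_const[of 1]
  have ia: "integrable M (?a k)" and ib: "integrable M (?b k)" and ic: "integrable M (?c k)"
    and id: "integrable M (?d k)" and "if": "integrable M (?f k)" if k: "k \<in> V" for k
    using k
    by (intro Bochner_Integration.integrable_sum Bochner_Integration.integrable_add sum_square_nbhd(1)
        Bochner_Integration.integrable_mult_right i4 one L4_Omega(1) L4_W L4_xi rest_L4;
        auto dest: A_memD)+
  have Ea: "expectation (?a k) \<le> (\<Sum>i\<in>A k. \<Sum>j\<in>A i. (x k ^ 3 + x i ^ 3 + x j ^ 3) / 3 * (5 * \<Lambda>))" if k: "k \<in> V" for k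
  proof -
    have it: "integrable M (\<lambda>\<omega>. \<bar>\<xi> k \<omega> * \<xi> i \<omega> * \<xi> j \<omega> * 1\<bar> + \<bar>\<xi> k \<omega> * \<xi> i \<omega> * \<xi> j \<omega> * rest k \<omega>\<bar>)"
      if "i \<in> A k" "j \<in> A i" for i j
      using that k in_A by (intro Bochner_Integration.integrable_add i4 L4_xi one rest_L4) auto
    have "expectation (?a k) = (\<Sum>i\<in>A k. expectation (\<lambda>\<omega>. \<Sum>j\<in>A i. \<bar>\<xi> k \<omega> * \<xi> i \<omega> * \<xi> j \<omega> * 1\<bar> + \<bar>\<xi> k \<omega> * \<xi> i \<omega> * \<xi> j \<omega> * rest k \<omega>\<bar>))"
      by (rule Bochner_Integration.integral_sum) (rule Bochner_Integration.integrable_sum, rule it)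
    also have "\<dots> = (\<Sum>i\<in>A k. \<Sum>j\<in>A i. expectation (\<lambda>\<omega>. \<bar>\<xi> k \<omega> * \<xi> i \<omega> * \<xi> j \<omega> * 1\<bar> + \<bar>\<xi> k \<omega> * \<xi> i \<omega> * \<xi> j \<omega> * rest k \<omega>\<bar>))"
      by (rule sum.cong[OF refl], rule Bochner_Integration.integral_sum) (rule it)
    also have "\<dots> \<le> (\<Sum>i\<in>A k. \<Sum>j\<in>A i. (x k ^ 3 + x i ^ 3 + x j ^ 3) / 3 * (5 * \<Lambda>))"
    proof (intro sum_mono)
      fix i j assume "i \<in> A k" "j \<in> A i"
      then have ij: "i \<in> V" "j \<in> V" using in_A k by auto
      let ?m = "(x k ^ 3 + x i ^ 3 + x j ^ 3) / 3"
      have "expectation (\<lambda>\<omega>. \<bar>\<xi> k \<omega> * \<xi> i \<omega> * \<xi> j \<omega> * 1\<bar> + \<bar>\<xi> k \<omega> * \<xi> i \<omega> * \<xi> j \<omega> * rest k \<omega>\<bar>)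
          = expectation (\<lambda>\<omega>. \<bar>\<xi> k \<omega> * \<xi> i \<omega> * \<xi> j \<omega> * 1\<bar>) + expectation (\<lambda>\<omega>. \<bar>\<xi> k \<omega> * \<xi> i \<omega> * \<xi> j \<omega> * rest k \<omega>\<bar>)"
        using ij k by (intro Bochner_Integration.integral_add i4 L4_xi one rest_L4)
      also have "\<dots> \<le> ?m * L4_norm (\<lambda>_. 1) + ?m * L4_norm (rest k)"
        by (intro add_mono expectation_triple_le one rest_L4 k ij)
      also have "\<dots> \<le> ?m * 1 + ?m * (4 * \<Lambda>)"
        using L4_norm_rest[OF k] by (intro add_mono mult_left_mono) auto
      also have "\<dots> = ?m * (1 + 4 * \<Lambda>)" by (simp only: distrib_left)
      also have "\<dots> \<le> ?m * (5 * \<Lambda>)" using Lambda_ge_1 by (intro mult_left_mono) auto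
      finally show "expectation (\<lambda>\<omega>. \<bar>\<xi> k \<omega> * \<xi> i \<omega> * \<xi> j \<omega> * 1\<bar> + \<bar>\<xi> k \<omega> * \<xi> i \<omega> * \<xi> j \<omega> * rest k \<omega>\<bar>)
        \<le> ?m * (5 * \<Lambda>)" .
    qed
    finally show ?thesis .
  qed
  have SA: "(\<Sum>k\<in>V. expectation (?a k)) \<le> 5 * \<Lambda> * \<beta>"
  proof -
    have "(\<Sum>k\<in>V. expectation (?a k)) \<le> (\<Sum>k\<in>V. \<Sum>i\<in>A k. \<Sum>j\<in>A i. (x k ^ 3 + x i ^ 3 + x j ^ 3) / 3 * (5 * \<Lambda>))"
      by (intro sum_mono Ea)
    also have "\<dots> = (\<Sum>k\<in>V. \<Sum>i\<in>A k. \<Sum>j\<in>A i. (x k ^ 3 + x i ^ 3 + x j ^ 3) / 3) * (5 * \<Lambda>)"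
      by (simp only: sum_distrib_right)
    also have "\<dots> \<le> \<beta> * (5 * \<Lambda>)"
      using Lambda_ge_1 order_trans[OF sum_path_triple beta_bounds(2)] by (intro mult_right_mono) auto
    finally show ?thesis by (simp add: mult_ac)
  qed
  have WO: "L4_norm W \<le> 4" "L4_norm \<Omega> \<le> 4 * \<beta>" using L4_norm_W[OF beta_le_1] L4_Omega by auto
  have SB: "(\<Sum>k\<in>V. expectation (?b k)) \<le> 80 * \<Lambda> * \<beta>"
  proof -
    have "expectation (?b k) = (\<Sum>j\<in>A k. expectation (\<lambda>\<omega>. \<bar>\<xi> k \<omega> * \<xi> j \<omega> * \<Omega> \<omega> * 1\<bar>) + expectation (\<lambda>\<omega>. \<bar>\<xi> k \<omega> * \<xi> j \<omega> * \<Omega> \<omega> * W \<omega>\<bar>))"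
      if k: "k \<in> V" for k
    proof -
      have 1: "integrable M (\<lambda>\<omega>. \<bar>\<xi> k \<omega> * \<xi> j \<omega> * \<Omega> \<omega> * 1\<bar>)" if "j \<in> A k" for j
        by (rule i4[OF k in_A[OF k that] L4_Omega(1) one])
      have 2: "integrable M (\<lambda>\<omega>. \<bar>\<xi> k \<omega> * \<xi> j \<omega> * \<Omega> \<omega> * W \<omega>\<bar>)" if "j \<in> A k" for j
        by (rule i4[OF k in_A[OF k that] L4_Omega(1) L4_W])
      have "expectation (?b k) = (\<Sum>j\<in>A k. expectation (\<lambda>\<omega>. \<bar>\<xi> k \<omega> * \<xi> j \<omega> * \<Omega> \<omega> * 1\<bar> + \<bar>\<xi> k \<omega> * \<xi> j \<omega> * \<Omega> \<omega> * W \<omega>\<bar>))"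
        by (rule Bochner_Integration.integral_sum) (rule Bochner_Integration.integrable_add[OF 1 2])
      also have "\<dots> = (\<Sum>j\<in>A k. expectation (\<lambda>\<omega>. \<bar>\<xi> k \<omega> * \<xi> j \<omega> * \<Omega> \<omega> * 1\<bar>) + expectation (\<lambda>\<omega>. \<bar>\<xi> k \<omega> * \<xi> j \<omega> * \<Omega> \<omega> * W \<omega>\<bar>))"
        by (rule sum.cong[OF refl], rule Bochner_Integration.integral_add[OF 1 2])
      finally show ?thesis .
    qed
    then have "(\<Sum>k\<in>V. expectation (?b k)) = (\<Sum>k\<in>V. \<Sum>j\<in>A k. expectation (\<lambda>\<omega>. \<bar>\<xi> k \<omega> * \<xi> j \<omega> * \<Omega> \<omega> * 1\<bar>))
        + (\<Sum>k\<in>V. \<Sum>j\<in>A k. expectation (\<lambda>\<omega>. \<bar>\<xi> k \<omega> * \<xi> j \<omega> * \<Omega> \<omega> * W \<omega>\<bar>))"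
      by (simp only: sum.distrib cong: sum.cong)
    also have "\<dots> \<le> 4 * \<Lambda> * L4_norm \<Omega> * L4_norm (\<lambda>_. 1) + 4 * \<Lambda> * L4_norm \<Omega> * L4_norm W"
      by (intro add_mono pair_sum_times_L4 one L4_Omega L4_W)
    also have "\<dots> \<le> 4 * \<Lambda> * (4 * \<beta>) * 1 + 4 * \<Lambda> * (4 * \<beta>) * 4"
      using Lambda_ge_1 beta_bounds WO by (intro add_mono mult_mono) auto
    finally show ?thesis by (simp add: mult_ac)
  qed
  have SC: "(\<Sum>k\<in>V. expectation (?c k)) \<le> 4 * \<Lambda> * \<beta>"
  proof -
    have "(\<Sum>k\<in>V. expectation (?c k)) \<le> T3 * L4_norm \<Omega>" by (rule sum_square_nbhd(2)[OF L4_Omega(1)])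
    also have "\<dots> \<le> \<Lambda> * (4 * \<beta>)"
      using beta_bounds beta_le_1 Lambda_ge_1 WO by (intro mult_mono) auto
    finally show ?thesis by (simp add: mult_ac)
  qed
  have SD: "(\<Sum>k\<in>V. expectation (?d k)) \<le> 260 * \<Lambda>"
  proof -
    have "expectation (?d k) = (\<Sum>j\<in>A k. expectation (\<lambda>\<omega>. \<bar>\<xi> k \<omega> * \<xi> j \<omega> * 1 * 1\<bar>) + 4 * expectation (\<lambda>\<omega>. \<bar>\<xi> k \<omega> * \<xi> j \<omega> * W \<omega> * W \<omega>\<bar>))"
      if k: "k \<in> V" for k
    proof -
      have 1: "integrable M (\<lambda>\<omega>. \<bar>\<xi> k \<omega> * \<xi> j \<omega> * 1 * 1\<bar>)" if "j \<in> A k" for j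
        by (rule i4[OF k in_A[OF k that] one one])
      have 2: "integrable M (\<lambda>\<omega>. 4 * \<bar>\<xi> k \<omega> * \<xi> j \<omega> * W \<omega> * W \<omega>\<bar>)" if "j \<in> A k" for j
        by (rule Bochner_Integration.integrable_mult_right) (rule i4[OF k in_A[OF k that] L4_W L4_W])
      have "expectation (?d k) = (\<Sum>j\<in>A k. expectation (\<lambda>\<omega>. \<bar>\<xi> k \<omega> * \<xi> j \<omega> * 1 * 1\<bar> + 4 * \<bar>\<xi> k \<omega> * \<xi> j \<omega> * W \<omega> * W \<omega>\<bar>))"
        by (rule Bochner_Integration.integral_sum) (rule Bochner_Integration.integrable_add[OF 1 2])
      also have "\<dots> = (\<Sum>j\<in>A k. expectation (\<lambda>\<omega>. \<bar>\<xi> k \<omega> * \<xi> j \<omega> * 1 * 1\<bar>) + expectation (\<lambda>\<omega>. 4 * \<bar>\<xi> k \<omega> * \<xi> j \<omega> * W \<omega> * W \<omega>\<bar>))"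
        by (rule sum.cong[OF refl], rule Bochner_Integration.integral_add[OF 1 2])
      finally show ?thesis by (simp only: Bochner_Integration.integral_mult_right_zero)
    qed
    then have "(\<Sum>k\<in>V. expectation (?d k)) = (\<Sum>k\<in>V. \<Sum>j\<in>A k. expectation (\<lambda>\<omega>. \<bar>\<xi> k \<omega> * \<xi> j \<omega> * 1 * 1\<bar>))
        + 4 * (\<Sum>k\<in>V. \<Sum>j\<in>A k. expectation (\<lambda>\<omega>. \<bar>\<xi> k \<omega> * \<xi> j \<omega> * W \<omega> * W \<omega>\<bar>))"
      by (simp only: sum.distrib sum_distrib_left cong: sum.cong)
    also have "\<dots> \<le> 4 * \<Lambda> * L4_norm (\<lambda>_. 1) * L4_norm (\<lambda>_. 1) + 4 * (4 * \<Lambda> * L4_norm W * L4_norm W)"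
      by (intro add_mono mult_left_mono pair_sum_times_L4 one L4_W) simp
    also have "\<dots> \<le> 4 * \<Lambda> * 1 * 1 + 4 * (4 * \<Lambda> * 4 * 4)"
      using Lambda_ge_1 WO by (intro add_mono mult_mono) auto
    finally show ?thesis by simp
  qed
  have SF: "(\<Sum>k\<in>V. expectation (?f k)) \<le> \<Lambda>"
  proof -
    have "(\<Sum>k\<in>V. expectation (?f k)) = (\<Sum>k\<in>V. \<Sum>i\<in>A k. \<Sum>j\<in>A k. \<Sum>l\<in>A k. expectation (\<lambda>\<omega>. \<bar>\<xi> k \<omega> * \<xi> i \<omega> * \<xi> j \<omega> * \<xi> l \<omega>\<bar>))"
      by (rule sum.cong[OF refl], rule expectation_triple_sum) (intro i4 L4_xi; auto dest: A_memD)
    also have "\<dots> \<le> T4" by (rule sum_expectation_star4)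
    also have "\<dots> \<le> \<beta>\<^sup>2" by (rule beta_bounds)
    also have "\<dots> \<le> 1" using beta_bounds beta_le_1 by (simp add: power_le_one)
    finally show ?thesis using Lambda_ge_1 by linarith
  qed
  have "leave_error \<le> (\<Sum>k\<in>V. expectation (\<lambda>\<omega>. 4 * ?a k \<omega> + 2 * ?b k \<omega> + 2 * ?c k \<omega> + 2 * ?\<rho> * (?d k \<omega> + 4 * ?f k \<omega>)))"
    unfolding leave_error_def
    by (intro sum_mono integral_mono leave_error_integrable leave_error_pointwise
        Bochner_Integration.integrable_add Bochner_Integration.integrable_mult_right ia ib ic id "if")
  also have "\<dots> = (\<Sum>k\<in>V. 4 * expectation (?a k) + 2 * expectation (?b k) + 2 * expectation (?c k)
      + 2 * ?\<rho> * (expectation (?d k) + 4 * expectation (?f k)))"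
  proof (rule sum.cong[OF refl])
    fix k assume k: "k \<in> V"
    show "expectation (\<lambda>\<omega>. 4 * ?a k \<omega> + 2 * ?b k \<omega> + 2 * ?c k \<omega> + 2 * ?\<rho> * (?d k \<omega> + 4 * ?f k \<omega>))
      = 4 * expectation (?a k) + 2 * expectation (?b k) + 2 * expectation (?c k)
      + 2 * ?\<rho> * (expectation (?d k) + 4 * expectation (?f k))"
      by (simp only: Bochner_Integration.integral_add Bochner_Integration.integral_mult_right_zero
          Bochner_Integration.integrable_add Bochner_Integration.integrable_mult_right
          ia[OF k] ib[OF k] ic[OF k] id[OF k] "if"[OF k] simp_thms)
  qed
  also have "\<dots> = 4 * (\<Sum>k\<in>V. expectation (?a k)) + 2 * (\<Sum>k\<in>V. expectation (?b k)) + 2 * (\<Sum>k\<in>V. expectation (?c k))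
      + 2 * ?\<rho> * ((\<Sum>k\<in>V. expectation (?d k)) + 4 * (\<Sum>k\<in>V. expectation (?f k)))"
    by (simp only: sum.distrib sum_distrib_left[symmetric])
  also have "\<dots> \<le> 4 * (5 * \<Lambda> * \<beta>) + 2 * (80 * \<Lambda> * \<beta>) + 2 * (4 * \<Lambda> * \<beta>) + 2 * ?\<rho> * (260 * \<Lambda> + 4 * \<Lambda>)"
    using r0 by (intro add_mono mult_left_mono SA SB SC SD SF) auto
  also have "\<dots> = 188 * (\<Lambda> * \<beta>) + 528 * (\<Lambda> * ?\<rho>)" by simp
  also have "\<dots> \<le> 188 * (\<Lambda> * \<beta>) + 528 * \<beta>" using density_bounds(1) by linarith
  also have "\<dots> \<le> 188 * (\<Lambda> * \<beta>) + 528 * (\<Lambda> * \<beta>)"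
  proof -
    have "1 * \<beta> \<le> \<Lambda> * \<beta>" using Lambda_ge_1 beta_bounds by (intro mult_right_mono) auto
    then show ?thesis by (simp add: mult_ac)
  qed
  finally show ?thesis by (simp add: mult_ac)
qed

text \<open>
  \<open>T\<close> and \<open>U\<close> agree unless the defect exceeds 1/2, which has probability of order \<open>\<beta>\<close> by Markov's inequality.
\<close>

theorem kolmogorov_self_normalized:
  assumes b: "\<beta> \<le> 1 / 640" and T: "T \<in> borel_measurable M"
    and eq: "\<And>\<omega>. \<omega> \<in> space M \<Longrightarrow> \<bar>self_defect \<omega>\<bar> \<le> 1 / 2 \<Longrightarrow> T \<omega> = W \<omega> / sqrt (1 + self_defect \<omega>)"
  shows "\<bar>prob {\<omega> \<in> space M. T \<omega> \<le> z} - cdf std_normal_distribution z\<bar> \<le> 1500000 * \<Lambda> * \<beta>"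
proof -
  let ?B = "{\<omega> \<in> space M. 1 / 2 < \<bar>self_defect \<omega>\<bar>}"
  let ?T = "{\<omega> \<in> space M. T \<omega> \<le> z}" and ?U = "{\<omega> \<in> space M. U \<omega> \<le> z}"
  note [measurable] = self_defect_L1(1) T
  have TU: "T \<omega> = U \<omega>" if "\<omega> \<in> space M" "\<omega> \<notin> ?B" for \<omega>
  proof -
    have "clip (self_defect \<omega>) = self_defect \<omega>" using that by (auto simp: clip_def)
    then show ?thesis using eq[of \<omega>] that by (simp add: inv_root_def)
  qed
  have PB: "prob ?B \<le> 38 * \<beta>"
  proof -
    have "prob ?B = expectation (indicator ?B)" by simp
    also have "\<dots> \<le> expectation (\<lambda>\<omega>. 2 * \<bar>self_defect \<omega>\<bar>)"
      using self_defect_L1(2)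
      by (intro integral_mono integrable_real_indicator) (auto simp: indicator_def emeasure_eq_measure)
    also have "\<dots> \<le> 38 * \<beta>" using self_defect_L1(3) by simp
    finally show ?thesis .
  qed
  have 1: "prob ?T \<le> prob ?U + prob ?B"
  proof -
    have "prob ?T \<le> prob (?U \<union> ?B)" using TU by (intro finite_measure_mono) auto
    also have "\<dots> \<le> prob ?U + prob ?B" by (intro measure_Un_le) auto
    finally show ?thesis .
  qed
  have 2: "prob ?U \<le> prob ?T + prob ?B"
  proof -
    have "prob ?U \<le> prob (?T \<union> ?B)" using TU by (intro finite_measure_mono) auto
    also have "\<dots> \<le> prob ?T + prob ?B" by (intro measure_Un_le) auto
    finally show ?thesis .
  qed
  have "1 * \<beta> \<le> \<Lambda> * \<beta>" using Lambda_ge_1 beta_bounds by (intro mult_right_mono) auto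
  then have bl: "\<beta> \<le> \<Lambda> * \<beta>" by (simp only: mult_1_left)
  have "\<delta> \<le> 1900 * (\<beta> + leave_error + scale_error)" by (rule kolmogorov_perturbed_sum[OF b])
  also have "\<dots> \<le> 1900 * (\<Lambda> * \<beta> + 716 * \<Lambda> * \<beta> + 70 * (\<Lambda> * \<beta>))"
    using leave_error_le scale_error_le bl by (intro mult_left_mono add_mono) auto
  also have "\<dots> = 1495300 * (\<Lambda> * \<beta>)" by simp
  finally have d: "\<delta> \<le> 1495300 * (\<Lambda> * \<beta>)" .
  have "\<bar>prob ?T - cdf std_normal_distribution z\<bar> \<le> \<delta> + prob ?B"
    using 1 2 kolmogorov_delta[of z] by linarith
  also have "\<dots> \<le> 1495300 * (\<Lambda> * \<beta>) + 38 * (\<Lambda> * \<beta>)"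
    using d PB bl by (intro add_mono) auto
  also have "\<dots> = 1495338 * (\<Lambda> * \<beta>)" by simp
  also have "\<dots> \<le> 1500000 * (\<Lambda> * \<beta>)"
    using Lambda_ge_1 beta_bounds by (intro mult_right_mono) auto
  finally show ?thesis by (simp only: mult.assoc)
qed

end

section \<open>Dependency graphs\<close>

lemma kolmogorov_distance_le:
  assumes "\<And>z. \<bar>measure M {\<omega> \<in> space M. T \<omega> \<le> z} - cdf std_normal_distribution z\<bar> \<le> c"
  shows "kolmogorov_distance M T \<le> ennreal c"
  unfolding kolmogorov_distance_def by (intro SUP_least ennreal_leI assms)

lemma (in prob_space) kolmogorov_distance_le_1:
  assumes "T \<in> borel_measurable M" shows "kolmogorov_distance M T \<le> 1"
proof -
  interpret N: real_distribution std_normal_distribution by (rule real_dist_normal_dist)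
  have "\<bar>prob {\<omega> \<in> space M. T \<omega> \<le> z} - cdf std_normal_distribution z\<bar> \<le> 1" for z
    using prob_le_1[of "{\<omega> \<in> space M. T \<omega> \<le> z}"] N.cdf_bounded_prob[of z] N.cdf_nonneg[of z]
      measure_nonneg[of M "{\<omega> \<in> space M. T \<omega> \<le> z}"] by linarith
  from kolmogorov_distance_le[OF this] show ?thesis by simp
qed

text \<open>
  The connection between the extended norms of the statement and the real ones used in the proof.
\<close>

lemma (in prob_space) Lp_norm_4_eq:
  assumes "Z \<in> L4" shows "Lp_norm 4 M Z = ennreal (L4_norm Z)"
proof -
  have e: "\<bar>Z \<omega>\<bar> powr 4 = Z \<omega> ^ 4" for \<omega>
    by (cases "Z \<omega> = 0") (simp_all add: powr_numeral power_even_abs_numeral)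
  have "(\<integral>\<^sup>+\<omega>. ennreal (\<bar>Z \<omega>\<bar> powr 4) \<partial>M) = ennreal (expectation (\<lambda>\<omega>. Z \<omega> ^ 4))"
    unfolding e by (rule nn_integral_eq_integral[OF L4_integrable[OF assms]]) simp
  moreover have "0 \<le> expectation (\<lambda>\<omega>. Z \<omega> ^ 4)" by simp
  moreover have "v powr (1 / 4) = sqrt (sqrt v)" if "0 \<le> v" for v :: real
    using that by (simp add: powr_half_sqrt[symmetric] powr_powr)
  ultimately show ?thesis
    by (simp add: Lp_norm_def ennreal_powr_def L4_norm_def)
qed

lemma (in prob_space) not_L4_imp_Lp_norm_top:
  assumes "Z \<in> borel_measurable M" "Z \<notin> L4" shows "Lp_norm 4 M Z = \<infinity>"
proof -
  have e: "\<bar>Z \<omega>\<bar> powr 4 = Z \<omega> ^ 4" for \<omega>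
    by (cases "Z \<omega> = 0") (simp_all add: powr_numeral power_even_abs_numeral)
  have "(\<integral>\<^sup>+\<omega>. ennreal (Z \<omega> ^ 4) \<partial>M) = \<infinity>"
    using assms by (auto simp: L4_def integrable_iff_bounded less_top[symmetric])
  then show ?thesis by (simp add: Lp_norm_def ennreal_powr_def e)
qed

context centred_dependent_sum
begin

abbreviation "d \<equiv> max_degree V E"
abbreviation "\<sigma> \<equiv> sd M (total_sum V X)"
abbreviation "nbhd i \<equiv> insert i (neighbours V E i)"

lemma X_measurable: "i \<in> V \<Longrightarrow> X i \<in> borel_measurable M"
  using integrable by auto

lemma finite_graph: "finite_simple_graph V E"
  using dependency_graph by (simp add: dependency_graph_def)

lemma finite_V: "finite V"
  using finite_graph by (simp add: finite_simple_graph_def)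

lemma V_nonempty: "V \<noteq> {}"
  using variance_pos by (auto simp: total_sum_def[abs_def])

lemma sigma_pos: "0 < \<sigma>" and sigma_sq: "\<sigma>\<^sup>2 = variance (total_sum V X)"
  using variance_pos by (auto simp: sd_def)

lemma card_neighbours_le: "i \<in> V \<Longrightarrow> card (neighbours V E i) \<le> d"
  unfolding max_degree_def using finite_V by (intro Max_ge) auto

lemma not_self_neighbour: "i \<notin> neighbours V E i"
  using finite_graph by (auto simp: finite_simple_graph_def neighbours_def)

lemma degree_less_card: "d < card V"
proof -
  have "d \<in> (\<lambda>i. card (neighbours V E i)) ` V"
    unfolding max_degree_def using finite_V V_nonempty by (intro Max_in) auto
  then obtain i where i: "i \<in> V" "d = card (neighbours V E i)" by auto
  have "neighbours V E i \<subseteq> V - {i}" using not_self_neighbour[of i] by (auto simp: neighbours_def)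
  then have "d \<le> card (V - {i})" unfolding i(2) using finite_V by (intro card_mono) auto
  also have "\<dots> < card V" using i finite_V by (meson card_Diff1_less)
  finally show ?thesis .
qed

lemma expectation_total_sum: "expectation (total_sum V X) = 0"
  unfolding total_sum_def[abs_def]
  by (subst Bochner_Integration.integral_sum) (auto simp: integrable centred)

lemma normalised_local_dependence:
  assumes L4: "\<And>i. i \<in> V \<Longrightarrow> X i \<in> L4"
  shows "local_dependence M V nbhd (real d + 1) (\<lambda>i \<omega>. 1 / \<sigma> * X i \<omega>)"
proof unfold_locales
  fix i j assume i: "i \<in> V"
  show "nbhd i \<subseteq> V" using i by (auto simp: neighbours_def)
  show "i \<in> nbhd i" by simp
  show "i \<in> nbhd j" if "j \<in> nbhd i"
    using that i by (auto simp: neighbours_def insert_commute)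
  have "card (nbhd i) \<le> card (neighbours V E i) + 1"
    using finite_subset[OF _ finite_V, of "neighbours V E i"]
    by (auto simp: card_insert_if neighbours_def)
  then show "real (card (nbhd i)) \<le> real d + 1" using card_neighbours_le[OF i] by linarith
  show "(\<lambda>\<omega>. 1 / \<sigma> * X i \<omega>) \<in> L4" by (intro L4_cmult L4 i)
  show "expectation (\<lambda>\<omega>. 1 / \<sigma> * X i \<omega>) = 0" using centred[OF i] by simp
next
  have "(\<Sum>i\<in>V. 1 / \<sigma> * X i \<omega>)\<^sup>2 = (total_sum V X \<omega>)\<^sup>2 / \<sigma>\<^sup>2" for \<omega>
    by (simp add: total_sum_def sum_divide_distrib[symmetric] power_divide)
  then have "expectation (\<lambda>\<omega>. (\<Sum>i\<in>V. 1 / \<sigma> * X i \<omega>)\<^sup>2) = expectation (\<lambda>\<omega>. (total_sum V X \<omega>)\<^sup>2) / \<sigma>\<^sup>2"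
    by simp
  also have "expectation (\<lambda>\<omega>. (total_sum V X \<omega>)\<^sup>2) = \<sigma>\<^sup>2"
    unfolding sigma_sq by (simp add: expectation_total_sum)
  finally show "expectation (\<lambda>\<omega>. (\<Sum>i\<in>V. 1 / \<sigma> * X i \<omega>)\<^sup>2) = 1" using sigma_pos by simp
next
  fix \<Gamma> \<Delta> assume sub: "\<Gamma> \<subseteq> V" "\<Delta> \<subseteq> V" and sep: "\<And>i. i \<in> \<Gamma> \<Longrightarrow> nbhd i \<inter> \<Delta> = {}"
  have "\<Gamma> \<inter> \<Delta> = {}" "\<forall>i\<in>\<Gamma>. \<forall>j\<in>\<Delta>. {i, j} \<notin> E"
    using sep sub by (fastforce simp: neighbours_def)+
  then have ind: "indep_var (Pi\<^sub>M \<Gamma> (\<lambda>_. borel)) (\<lambda>\<omega>. \<lambda>i\<in>\<Gamma>. X i \<omega>) (Pi\<^sub>M \<Delta> (\<lambda>_. borel)) (\<lambda>\<omega>. \<lambda>i\<in>\<Delta>. X i \<omega>)"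
    using dependency_graph sub unfolding dependency_graph_def by blast
  let ?f = "\<lambda>\<Gamma> y. \<lambda>i\<in>\<Gamma>. 1 / \<sigma> * (y i :: real)"
  have m: "?f \<Gamma> \<in> measurable (Pi\<^sub>M \<Gamma> (\<lambda>_. borel)) (Pi\<^sub>M \<Gamma> (\<lambda>_. borel))" for \<Gamma> :: "'v set"
    by (intro measurable_restrict borel_measurable_times borel_measurable_const measurable_component_singleton)
  have eq: "?f \<Gamma> \<circ> (\<lambda>\<omega>. \<lambda>i\<in>\<Gamma>. X i \<omega>) = (\<lambda>\<omega>. \<lambda>i\<in>\<Gamma>. 1 / \<sigma> * X i \<omega>)" for \<Gamma>
    by (auto simp: fun_eq_iff restrict_def)
  show "indep_var (Pi\<^sub>M \<Gamma> (\<lambda>_. borel)) (\<lambda>\<omega>. \<lambda>i\<in>\<Gamma>. 1 / \<sigma> * X i \<omega>) (Pi\<^sub>M \<Delta> (\<lambda>_. borel)) (\<lambda>\<omega>. \<lambda>i\<in>\<Delta>. 1 / \<sigma> * X i \<omega>)"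
    using indep_var_compose[OF ind m m] unfolding eq .
qed (rule finite_V)

definition moment_bound :: real where
  "moment_bound = (real d)\<^sup>2 * (\<Sum>i\<in>V. L4_norm (X i) ^ 3 / \<sigma> ^ 3)
    + real d powr (3 / 2) * sqrt (\<Sum>i\<in>V. L4_norm (X i) ^ 4 / \<sigma> ^ 4)"

lemma beta_le_moment_bound:
  assumes L4: "\<And>i. i \<in> V \<Longrightarrow> X i \<in> L4"
  shows "local_dependence.\<beta> M V (real d + 1) (\<lambda>i \<omega>. 1 / \<sigma> * X i \<omega>) \<le> 4 * moment_bound"
proof -
  interpret N: local_dependence M V nbhd "real d + 1" "\<lambda>i \<omega>. 1 / \<sigma> * X i \<omega>"
    by (rule normalised_local_dependence[OF L4])
  have d: "1 \<le> real d" using max_degree by simp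
  have x: "L4_norm (\<lambda>\<omega>. 1 / \<sigma> * X i \<omega>) = L4_norm (X i) / \<sigma>" for i
    unfolding L4_norm_cmult using sigma_pos by simp
  let ?s3 = "\<Sum>i\<in>V. L4_norm (X i) ^ 3 / \<sigma> ^ 3" and ?s4 = "\<Sum>i\<in>V. L4_norm (X i) ^ 4 / \<sigma> ^ 4"
  have s: "0 \<le> ?s3" "0 \<le> ?s4" using sigma_pos by (auto intro!: sum_nonneg)
  have "N.T3 \<le> (2 * real d)\<^sup>2 * ?s3"
    unfolding N.T3_def x power_divide using d s by (intro mult_right_mono power_mono) auto
  then have "N.T3 \<le> 4 * ((real d)\<^sup>2 * ?s3)" by (simp add: power_mult_distrib)
  moreover have "sqrt N.T4 \<le> 4 * (real d powr (3 / 2) * sqrt ?s4)"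
  proof -
    have "N.T4 \<le> (2 * real d) ^ 3 * ?s4"
      unfolding N.T4_def x power_divide using d s by (intro mult_right_mono power_mono) auto
    also have "\<dots> \<le> 16 * (real d ^ 3 * ?s4)" using d s by (simp add: power_mult_distrib)
    also have "\<dots> = (4 * (real d powr (3 / 2) * sqrt ?s4))\<^sup>2"
    proof -
      have "(real d powr (3 / 2))\<^sup>2 = real d ^ 3"
        using d by (simp add: power2_eq_square powr_add[symmetric] powr_numeral)
      then show ?thesis using s by (simp add: power_mult_distrib)
    qed
    finally have "sqrt N.T4 \<le> sqrt ((4 * (real d powr (3 / 2) * sqrt ?s4))\<^sup>2)" by (rule real_sqrt_le_mono)
    moreover have "0 \<le> 4 * (real d powr (3 / 2) * sqrt ?s4)" using s by simp
    ultimately show ?thesis by (simp only: real_sqrt_abs abs_of_nonneg)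
  qed
  ultimately show ?thesis unfolding N.\<beta>_def moment_bound_def by simp
qed

lemma moment_bound_nonneg: "0 \<le> moment_bound"
  unfolding moment_bound_def using sigma_pos
  by (intro add_nonneg_nonneg mult_nonneg_nonneg sum_nonneg) (auto intro!: sum_nonneg)

lemma Lp_sums:
  assumes L4: "\<And>i. i \<in> V \<Longrightarrow> X i \<in> L4"
  shows "(\<Sum>i\<in>V. Lp_norm 4 M (X i) ^ 3 / ennreal (\<sigma> ^ 3)) = ennreal (\<Sum>i\<in>V. L4_norm (X i) ^ 3 / \<sigma> ^ 3)"
    and "ennreal_powr (\<Sum>i\<in>V. Lp_norm 4 M (X i) ^ 4 / ennreal (\<sigma> ^ 4)) (1 / 2)
      = ennreal (sqrt (\<Sum>i\<in>V. L4_norm (X i) ^ 4 / \<sigma> ^ 4))"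
proof -
  have "Lp_norm 4 M (X i) ^ n / ennreal (\<sigma> ^ n) = ennreal (L4_norm (X i) ^ n / \<sigma> ^ n)" if "i \<in> V" for i n
    unfolding Lp_norm_4_eq[OF L4[OF that]] using sigma_pos
    by (simp add: ennreal_power divide_ennreal)
  then have e: "(\<Sum>i\<in>V. Lp_norm 4 M (X i) ^ n / ennreal (\<sigma> ^ n)) = ennreal (\<Sum>i\<in>V. L4_norm (X i) ^ n / \<sigma> ^ n)" for n
    using sigma_pos by (simp add: sum_ennreal)
  show "(\<Sum>i\<in>V. Lp_norm 4 M (X i) ^ 3 / ennreal (\<sigma> ^ 3)) = ennreal (\<Sum>i\<in>V. L4_norm (X i) ^ 3 / \<sigma> ^ 3)" by (rule e)
  have "0 \<le> (\<Sum>i\<in>V. L4_norm (X i) ^ 4 / \<sigma> ^ 4)" using sigma_pos by (auto intro!: sum_nonneg)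
  then show "ennreal_powr (\<Sum>i\<in>V. Lp_norm 4 M (X i) ^ 4 / ennreal (\<sigma> ^ 4)) (1 / 2)
      = ennreal (sqrt (\<Sum>i\<in>V. L4_norm (X i) ^ 4 / \<sigma> ^ 4))"
    unfolding e by (simp add: ennreal_powr_def powr_half_sqrt)
qed

lemma bound_eq_ennreal:
  assumes L4: "\<And>i. i \<in> V \<Longrightarrow> X i \<in> L4"
  shows "of_nat d ^ 2 * (\<Sum>i\<in>V. Lp_norm 4 M (X i) ^ 3 / ennreal (\<sigma> ^ 3))
      + ennreal (real d powr (3 / 2)) * ennreal_powr (\<Sum>i\<in>V. Lp_norm 4 M (X i) ^ 4 / ennreal (\<sigma> ^ 4)) (1 / 2)
    = ennreal moment_bound"
proof -
  have "0 \<le> (\<Sum>i\<in>V. L4_norm (X i) ^ 3 / \<sigma> ^ 3)" "0 \<le> (\<Sum>i\<in>V. L4_norm (X i) ^ 4 / \<sigma> ^ 4)"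
    using sigma_pos by (auto intro!: sum_nonneg)
  moreover have "(\<Sum>i\<in>V. Lp_norm 4 M (X i) ^ 3 / ennreal (\<sigma> ^ 3)) = ennreal (\<Sum>i\<in>V. L4_norm (X i) ^ 3 / \<sigma> ^ 3)"
    "ennreal_powr (\<Sum>i\<in>V. Lp_norm 4 M (X i) ^ 4 / ennreal (\<sigma> ^ 4)) (1 / 2)
      = ennreal (sqrt (\<Sum>i\<in>V. L4_norm (X i) ^ 4 / \<sigma> ^ 4))"
    by (rule Lp_sums[OF L4], assumption)+
  ultimately show ?thesis
    unfolding moment_bound_def
    by (simp add: ennreal_of_nat_eq_real_of_nat ennreal_power ennreal_mult ennreal_plus)
qed

text \<open>
  If one fourth moment is infinite, the bound is trivial.
\<close>

lemma bound_eq_top: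
  assumes "j \<in> V" "X j \<notin> L4"
  shows "of_nat d ^ 2 * (\<Sum>i\<in>V. Lp_norm 4 M (X i) ^ 3 / ennreal (\<sigma> ^ 3)) = \<infinity>"
proof -
  have "Lp_norm 4 M (X j) ^ 3 / ennreal (\<sigma> ^ 3) = \<infinity>"
    unfolding not_L4_imp_Lp_norm_top[OF X_measurable[OF assms(1)] assms(2)]
    by (simp add: ennreal_top_divide top_power_ennreal)
  then have "(\<Sum>i\<in>V. Lp_norm 4 M (X i) ^ 3 / ennreal (\<sigma> ^ 3)) = \<infinity>"
    using assms(1) finite_V by (auto simp: infinity_ennreal_def)
  moreover have "(of_nat d ^ 2 :: ennreal) \<noteq> 0" using max_degree by simp
  ultimately show ?thesis by (simp add: ennreal_mult_top)
qed

theorem normal_approximation: "normal_approximation_bound 12000000 M V E X"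
proof (cases "\<forall>i\<in>V. X i \<in> L4")
  case False
  then obtain j where "j \<in> V" "X j \<notin> L4" by auto
  from bound_eq_top[OF this] show ?thesis
    unfolding normal_approximation_bound_def Let_def by (simp add: mult.assoc ennreal_mult_top)
next
  case True
  then have L4: "X i \<in> L4" if "i \<in> V" for i using that by auto
  interpret N: local_dependence M V nbhd "real d + 1" "\<lambda>i \<omega>. 1 / \<sigma> * X i \<omega>"
    by (rule normalised_local_dependence) (rule L4)
  have b: "N.\<beta> \<le> 4 * moment_bound" by (rule beta_le_moment_bound) (rule L4)
  have W: "(\<Sum>i\<in>V. 1 / \<sigma> * X i \<omega>) = total_sum V X \<omega> / \<sigma>" for \<omega>
    by (simp add: total_sum_def sum_divide_distrib)
  have "kolmogorov_distance M (\<lambda>\<omega>. total_sum V X \<omega> / \<sigma>) \<le> ennreal (7600 * N.\<beta>)"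
    using N.kolmogorov_W unfolding W by (intro kolmogorov_distance_le)
  also have "\<dots> \<le> ennreal (12000000 * moment_bound)"
    using b moment_bound_nonneg by (intro ennreal_leI) linarith
  also have "\<dots> = ennreal 12000000 * ennreal moment_bound"
    using moment_bound_nonneg by (intro ennreal_mult) auto
  also have "ennreal moment_bound = of_nat d ^ 2 * (\<Sum>i\<in>V. Lp_norm 4 M (X i) ^ 3 / ennreal (\<sigma> ^ 3))
      + ennreal (real d powr (3 / 2)) * ennreal_powr (\<Sum>i\<in>V. Lp_norm 4 M (X i) ^ 4 / ennreal (\<sigma> ^ 4)) (1 / 2)"
    by (rule bound_eq_ennreal[symmetric]) (rule L4)
  finally show ?thesis
    unfolding normal_approximation_bound_def Let_def by (simp only: distrib_left mult.assoc)
qed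

text \<open>
  Infinity times zero is zero for extended reals, so the self-normalised bound is trivial only if \<open>\<lambda>\<^sub>1\<close> is positive.
\<close>

lemma lambda1_nonzero:
  assumes j: "j \<in> V" "X j \<notin> L4" shows "lambda1 M V E X \<noteq> 0"
proof
  have [measurable]: "X j \<in> borel_measurable M" by (rule X_measurable[OF j(1)])
  assume "lambda1 M V E X = 0"
  then have "(\<Sum>i\<in>V. \<integral>\<^sup>+\<omega>. ennreal (\<bar>X i \<omega>\<bar>\<^sup>2) \<partial>M) = 0"
    using max_degree by (simp add: lambda1_def ennreal_divide_eq_0_iff)
  then have "(\<integral>\<^sup>+\<omega>. ennreal (\<bar>X j \<omega>\<bar>\<^sup>2) \<partial>M) = 0"
    using finite_V j by simp
  then have "AE \<omega> in M. X j \<omega> = 0"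
    by (subst (asm) nn_integral_0_iff_AE) auto
  then have "AE \<omega> in M. X j \<omega> ^ 4 = 0" by eventually_elim simp
  then have "integrable M (\<lambda>\<omega>. X j \<omega> ^ 4) \<longleftrightarrow> integrable M (\<lambda>\<omega>. 0 :: real)"
    by (intro integrable_cong_AE) auto
  then have "integrable M (\<lambda>\<omega>. X j \<omega> ^ 4)" by simp
  then show False using j by (simp add: L4_def)
qed

lemma self_normalizer_eq:
  "self_normalizer V E X \<omega> = sqrt (max ((\<Sum>i\<in>V. \<Sum>j\<in>nbhd i. X i \<omega> * X j \<omega>)
     - total_sum V X \<omega> * (\<Sum>i\<in>V. \<Sum>j\<in>nbhd i. X j \<omega>) / real (card V)) 0)"
proof -
  have "0 < real (card V)" using finite_V V_nonempty by (simp add: card_gt_0_iff)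
  then have "(\<Sum>i\<in>V. X i \<omega> * local_sum V E X i \<omega> - vertex_mean V X \<omega> * vertex_mean V (local_sum V E X) \<omega>)
      = (\<Sum>i\<in>V. X i \<omega> * local_sum V E X i \<omega>) - (\<Sum>i\<in>V. X i \<omega>) * (\<Sum>i\<in>V. local_sum V E X i \<omega>) / real (card V)"
    by (simp add: sum_subtractf vertex_mean_def)
  then show ?thesis
    unfolding self_normalizer_def total_sum_def local_sum_def sum_distrib_left by simp
qed

theorem self_normalized_approximation:
  assumes T: "self_normalized M V E X T"
  shows "self_normalized_bound 12000000 M V E X T"
proof (cases "\<forall>i\<in>V. X i \<in> L4")
  case False
  then obtain j where j: "j \<in> V" "X j \<notin> L4" by auto
  show ?thesis
    unfolding self_normalized_bound_def Let_def bound_eq_top[OF j]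
    using lambda1_nonzero[OF j] by (simp add: mult.assoc ennreal_mult_top)
next
  case True
  then have L4: "X i \<in> L4" if "i \<in> V" for i using that by auto
  interpret N: local_dependence M V nbhd "real d + 1" "\<lambda>i \<omega>. 1 / \<sigma> * X i \<omega>"
    by (rule normalised_local_dependence) (rule L4)
  have b: "N.\<beta> \<le> 4 * moment_bound" by (rule beta_le_moment_bound) (rule L4)
  define l where "l = real d * (\<Sum>i\<in>V. expectation (\<lambda>\<omega>. (X i \<omega>)\<^sup>2)) / \<sigma>\<^sup>2"
  have lambda: "lambda1 M V E X = ennreal l"
  proof -
    have "(\<integral>\<^sup>+\<omega>. ennreal (\<bar>X i \<omega>\<bar>\<^sup>2) \<partial>M) = ennreal (expectation (\<lambda>\<omega>. (X i \<omega>)\<^sup>2))" if "i \<in> V" for i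
    proof -
      have "integrable M (\<lambda>\<omega>. (X i \<omega>)\<^sup>2)"
        using L4_holder2(1)[OF L4[OF that] L4[OF that]] by (simp add: power2_eq_square)
      then show ?thesis by (subst nn_integral_eq_integral[symmetric]) auto
    qed
    then have "(\<Sum>i\<in>V. \<integral>\<^sup>+\<omega>. ennreal (\<bar>X i \<omega>\<bar>\<^sup>2) \<partial>M) = ennreal (\<Sum>i\<in>V. expectation (\<lambda>\<omega>. (X i \<omega>)\<^sup>2))"
      by (simp add: sum_ennreal)
    moreover have "0 \<le> (\<Sum>i\<in>V. expectation (\<lambda>\<omega>. (X i \<omega>)\<^sup>2))" by (auto intro!: sum_nonneg)
    ultimately show ?thesis
      using sigma_pos by (simp add: lambda1_def l_def ennreal_of_nat_eq_real_of_nat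
          ennreal_mult[symmetric] divide_ennreal)
  qed
  have l: "N.\<Lambda> \<le> 2 * l"
  proof -
    have "(\<Sum>i\<in>V. expectation (\<lambda>\<omega>. (1 / \<sigma> * X i \<omega>)\<^sup>2)) = (\<Sum>i\<in>V. expectation (\<lambda>\<omega>. (X i \<omega>)\<^sup>2)) / \<sigma>\<^sup>2"
      by (simp add: power_divide sum_divide_distrib)
    with N.Lambda_le have "N.\<Lambda> \<le> (real d + 1) * ((\<Sum>i\<in>V. expectation (\<lambda>\<omega>. (X i \<omega>)\<^sup>2)) / \<sigma>\<^sup>2)"
      by (simp only:)
    also have "\<dots> \<le> (2 * real d) * ((\<Sum>i\<in>V. expectation (\<lambda>\<omega>. (X i \<omega>)\<^sup>2)) / \<sigma>\<^sup>2)"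
      using max_degree by (intro mult_right_mono divide_nonneg_nonneg sum_nonneg) auto
    finally have "N.\<Lambda> \<le> (2 * real d) * ((\<Sum>i\<in>V. expectation (\<lambda>\<omega>. (X i \<omega>)\<^sup>2)) / \<sigma>\<^sup>2)" .
    then show ?thesis by (simp add: l_def)
  qed
  have L1: "1 \<le> N.\<Lambda>" and b0: "0 \<le> N.\<beta>" by (rule N.Lambda_ge_1, rule N.beta_bounds)
  have Tm: "T \<in> borel_measurable M" using T by (simp add: self_normalized_def)
  have "kolmogorov_distance M T \<le> ennreal (1500000 * N.\<Lambda> * N.\<beta>)"
  proof (cases "N.\<beta> \<le> 1 / 640")
    case False
    have "1 / 640 * 1 \<le> N.\<beta> * N.\<Lambda>" using False L1 by (intro mult_mono) auto
    then have "1 \<le> 1500000 * N.\<Lambda> * N.\<beta>" by (simp add: mult_ac)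
    then have "1 \<le> ennreal (1500000 * N.\<Lambda> * N.\<beta>)" using ennreal_leI by fastforce
    then show ?thesis using kolmogorov_distance_le_1[OF Tm] by (rule order_trans[rotated])
  next
    case True
    interpret P: dense_local_dependence M V nbhd "real d + 1" "\<lambda>i \<omega>. 1 / \<sigma> * X i \<omega>"
      by unfold_locales (use True degree_less_card in auto)
    have T_eq: "T \<omega> = (\<Sum>i\<in>V. 1 / \<sigma> * X i \<omega>) / sqrt (1 + N.self_defect \<omega>)"
      if \<omega>: "\<omega> \<in> space M" "\<bar>N.self_defect \<omega>\<bar> \<le> 1 / 2" for \<omega>
    proof -
      have pos: "0 < 1 + N.self_defect \<omega>" using \<omega>(2) by linarith
      have W: "(\<Sum>i\<in>V. 1 / \<sigma> * X i \<omega>) = total_sum V X \<omega> / \<sigma>"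
        by (simp add: total_sum_def sum_divide_distrib)
      have Om: "N.\<Omega> \<omega> = (\<Sum>i\<in>V. \<Sum>j\<in>nbhd i. X j \<omega>) / \<sigma> / real (card V)"
        unfolding N.Omega_eq sum_distrib_left[symmetric] by simp
      have Q: "(\<Sum>i\<in>V. \<Sum>j\<in>nbhd i. 1 / \<sigma> * X i \<omega> * (1 / \<sigma> * X j \<omega>))
          = (\<Sum>i\<in>V. \<Sum>j\<in>nbhd i. X i \<omega> * X j \<omega>) / \<sigma>\<^sup>2"
        unfolding sum_divide_distrib by (simp add: power2_eq_square)
      have "1 + N.self_defect \<omega> = ((\<Sum>i\<in>V. \<Sum>j\<in>nbhd i. X i \<omega> * X j \<omega>)
          - total_sum V X \<omega> * (\<Sum>i\<in>V. \<Sum>j\<in>nbhd i. X j \<omega>) / real (card V)) / \<sigma>\<^sup>2"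
        unfolding N.self_defect_def W Om Q by (simp add: diff_divide_distrib power2_eq_square)
      then have "(\<Sum>i\<in>V. \<Sum>j\<in>nbhd i. X i \<omega> * X j \<omega>)
          - total_sum V X \<omega> * (\<Sum>i\<in>V. \<Sum>j\<in>nbhd i. X j \<omega>) / real (card V) = \<sigma>\<^sup>2 * (1 + N.self_defect \<omega>)"
        using sigma_pos by (simp add: field_simps)
      then have V: "self_normalizer V E X \<omega> = \<sigma> * sqrt (1 + N.self_defect \<omega>)"
        unfolding self_normalizer_eq using pos sigma_pos by (simp add: real_sqrt_mult)
      then have "self_normalizer V E X \<omega> \<noteq> 0" using pos sigma_pos by simp
      then have "T \<omega> = total_sum V X \<omega> / self_normalizer V E X \<omega>"
        using T \<omega>(1) by (simp add: self_normalized_def)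
      then show ?thesis unfolding V W by simp
    qed
    show ?thesis by (intro kolmogorov_distance_le P.kolmogorov_self_normalized True Tm T_eq)
  qed
  also have "\<dots> \<le> ennreal (12000000 * (l * moment_bound))"
  proof (rule ennreal_leI)
    have "N.\<Lambda> * N.\<beta> \<le> (2 * l) * (4 * moment_bound)"
      using l b b0 L1 by (intro mult_mono) auto
    then show "1500000 * N.\<Lambda> * N.\<beta> \<le> 12000000 * (l * moment_bound)" by (simp add: mult_ac)
  qed
  also have "\<dots> = ennreal 12000000 * (ennreal l * ennreal moment_bound)"
    using moment_bound_nonneg l L1 by (simp add: ennreal_mult)
  also have "ennreal moment_bound = of_nat d ^ 2 * (\<Sum>i\<in>V. Lp_norm 4 M (X i) ^ 3 / ennreal (\<sigma> ^ 3))
      + ennreal (real d powr (3 / 2)) * ennreal_powr (\<Sum>i\<in>V. Lp_norm 4 M (X i) ^ 4 / ennreal (\<sigma> ^ 4)) (1 / 2)"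
    by (rule bound_eq_ennreal[symmetric]) (rule L4)
  finally show ?thesis
    unfolding self_normalized_bound_def Let_def lambda by (simp only: mult.assoc)
qed

end

section \<open>Transport to a fixed probability space\<close>

lemma (in prob_space) indep_var_distr:
  assumes T: "T \<in> measurable M N" and A: "A \<in> measurable N S" and B: "B \<in> measurable N S'"
    and ind: "indep_var S (A \<circ> T) S' (B \<circ> T)"
  shows "prob_space.indep_var (distr M N T) S A S' B"
proof -
  interpret D: prob_space "distr M N T" by (rule prob_space_distr[OF T])
  have "distr (distr M N T) S A \<Otimes>\<^sub>M distr (distr M N T) S' B
      = distr M S (A \<circ> T) \<Otimes>\<^sub>M distr M S' (B \<circ> T)"
    using T A B by (simp add: distr_distr)
  also have "\<dots> = distr M (S \<Otimes>\<^sub>M S') (\<lambda>\<omega>. ((A \<circ> T) \<omega>, (B \<circ> T) \<omega>))"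
    using ind unfolding indep_var_distribution_eq by simp
  also have "\<dots> = distr (distr M N T) (S \<Otimes>\<^sub>M S') (\<lambda>y. (A y, B y))"
    using T A B by (subst distr_distr) (auto simp: comp_def)
  finally show ?thesis
    unfolding D.indep_var_distribution_eq using A B by simp
qed

text \<open>
  The family \<open>X\<close> together with one more random variable \<open>R\<close> is realised as the coordinates of \<open>nat \<Rightarrow> real\<close>: the
  vertices are numbered below \<open>card V\<close>, and the coordinate \<open>card V\<close> carries \<open>R\<close>. The remaining coordinates are copies of \<open>R\<close> as well.
  The variable \<open>R\<close> is there to transport an arbitrary version of the self-normalised sum.
\<close>

locale realisation = centred_dependent_sum M V E X
  for M :: "'a measure" and V :: "'v set" and E :: "'v set set" and X :: "'v \<Rightarrow> 'a \<Rightarrow> real" +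
  fixes R :: "'a \<Rightarrow> real" and e :: "'v \<Rightarrow> nat"
  assumes R_measurable: "R \<in> borel_measurable M"
    and bij: "bij_betw e V {0..<card V}"
begin

abbreviation "n \<equiv> card V"
abbreviation "V' \<equiv> {0..<n}"
abbreviation "E' \<equiv> (\<lambda>s. e ` s) ` E"
abbreviation "N \<equiv> Pi\<^sub>M (UNIV :: nat set) (\<lambda>_. borel :: real measure)"
abbreviation "X' \<equiv> \<lambda>(m :: nat) (y :: nat \<Rightarrow> real). y m"

definition vertex_of :: "nat \<Rightarrow> 'v" where "vertex_of = inv_into V e"

definition real_point :: "'a \<Rightarrow> nat \<Rightarrow> real" where
  "real_point \<omega> m = (if m < n then X (vertex_of m) \<omega> else R \<omega>)"

definition law :: "(nat \<Rightarrow> real) measure" where "law = distr M N real_point"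

lemma inj_e: "inj_on e V" and image_e: "e ` V = V'"
  using bij by (auto simp: bij_betw_def)

lemma vertex_of_in: "m \<in> V' \<Longrightarrow> vertex_of m \<in> V"
  unfolding vertex_of_def using inv_into_into[of m e V] image_e by auto

lemma e_vertex_of: "m \<in> V' \<Longrightarrow> e (vertex_of m) = m"
  unfolding vertex_of_def using f_inv_into_f[of m e V] image_e by auto

lemma vertex_of_e: "i \<in> V \<Longrightarrow> vertex_of (e i) = i"
  unfolding vertex_of_def using inv_into_f_f[OF inj_e] by auto

lemma e_in: "i \<in> V \<Longrightarrow> e i \<in> V'" using image_e by auto

lemma real_point_e: "i \<in> V \<Longrightarrow> real_point \<omega> (e i) = X i \<omega>"
  using e_in[of i] by (simp add: real_point_def vertex_of_e)

lemma real_point_n: "real_point \<omega> n = R \<omega>"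
  by (simp add: real_point_def)

lemma real_point_measurable: "real_point \<in> measurable M N"
proof (rule measurable_PiM_single')
  fix m :: nat
  show "(\<lambda>\<omega>. real_point \<omega> m) \<in> borel_measurable M"
  proof (cases "m < n")
    case True
    then show ?thesis using X_measurable[OF vertex_of_in] by (simp add: real_point_def)
  qed (simp add: real_point_def R_measurable)
qed auto

lemma X'_measurable [measurable]: "X' m \<in> borel_measurable N"
  by (rule measurable_component_singleton) simp

lemma sum_transfer: "(\<Sum>m\<in>V'. f m) = (\<Sum>i\<in>V. f (e i))"
  using sum.reindex_bij_betw[OF bij, of f] by simp

lemma sum_transfer_real_point: "(\<Sum>m\<in>V'. real_point \<omega> m) = (\<Sum>i\<in>V. X i \<omega>)"
  unfolding sum_transfer by (intro sum.cong refl real_point_e)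

lemma E_subset: "s \<in> E \<Longrightarrow> s \<subseteq> V"
  using finite_graph by (auto simp: finite_simple_graph_def)

lemma edge_transfer:
  assumes "i \<in> V" "j \<in> V" shows "{e i, e j} \<in> E' \<longleftrightarrow> {i, j} \<in> E"
proof
  assume "{e i, e j} \<in> E'"
  then obtain s where s: "s \<in> E" "e ` {i, j} = e ` s" by auto
  then have "{i, j} = s"
    using inj_on_image_eq_iff[OF inj_e, of "{i, j}" s] assms E_subset by auto
  then show "{i, j} \<in> E" using s by simp
qed (auto intro!: image_eqI[of _ _ "{i, j}"])

lemma neighbours_transfer: "i \<in> V \<Longrightarrow> neighbours V' E' (e i) = e ` neighbours V E i"
proof (intro set_eqI iffI)
  fix m assume i: "i \<in> V" and "m \<in> neighbours V' E' (e i)"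
  then have m: "m \<in> V'" "{e i, m} \<in> E'" by (auto simp: neighbours_def)
  then have "{i, vertex_of m} \<in> E" using edge_transfer[OF i vertex_of_in[OF m(1)]] e_vertex_of[OF m(1)] by simp
  then have "vertex_of m \<in> neighbours V E i" using vertex_of_in[OF m(1)] by (simp add: neighbours_def)
  then show "m \<in> e ` neighbours V E i" using e_vertex_of[OF m(1)] by (metis imageI)
next
  fix m assume i: "i \<in> V" and "m \<in> e ` neighbours V E i"
  then obtain j where "j \<in> V" "{i, j} \<in> E" "m = e j" by (auto simp: neighbours_def)
  then show "m \<in> neighbours V' E' (e i)"
    using edge_transfer[OF i, of j] e_in[of j] by (simp add: neighbours_def)
qed

lemma neighbours_subset: "neighbours V E i \<subseteq> V"
  by (auto simp: neighbours_def)

lemma max_degree_transfer: "max_degree V' E' = max_degree V E"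
proof -
  have "(\<lambda>m. card (neighbours V' E' m)) ` V' = (\<lambda>i. card (neighbours V' E' (e i))) ` V"
    unfolding image_e[symmetric] by (simp add: image_image)
  also have "\<dots> = (\<lambda>i. card (neighbours V E i)) ` V"
    using card_image[OF inj_on_subset[OF inj_e neighbours_subset]] by (auto simp: neighbours_transfer)
  finally show ?thesis by (simp add: max_degree_def)
qed

lemma total_sum_transfer: "total_sum V' X' (real_point \<omega>) = total_sum V X \<omega>"
  unfolding total_sum_def by (rule sum_transfer_real_point)

lemma local_sum_transfer: "i \<in> V \<Longrightarrow> local_sum V' E' X' (e i) (real_point \<omega>) = local_sum V E X i \<omega>"
proof -
  assume i: "i \<in> V"
  have sub: "insert i (neighbours V E i) \<subseteq> V" using i neighbours_subset by auto
  have "insert (e i) (neighbours V' E' (e i)) = e ` insert i (neighbours V E i)"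
    by (simp add: neighbours_transfer[OF i])
  then have "local_sum V' E' X' (e i) (real_point \<omega>) = (\<Sum>j\<in>insert i (neighbours V E i). real_point \<omega> (e j))"
    unfolding local_sum_def by (simp only: sum.reindex[OF inj_on_subset[OF inj_e sub]] comp_def)
  also have "\<dots> = local_sum V E X i \<omega>"
    unfolding local_sum_def using sub by (intro sum.cong refl real_point_e) auto
  finally show ?thesis .
qed

lemma self_normalizer_transfer: "self_normalizer V' E' X' (real_point \<omega>) = self_normalizer V E X \<omega>"
  unfolding self_normalizer_def vertex_mean_def sum_transfer
  by (simp add: local_sum_transfer real_point_e cong: sum.cong)

lemma total_sum'_measurable [measurable]: "total_sum V' X' \<in> borel_measurable N"
  unfolding total_sum_def[abs_def] by measurable

lemma self_normalizer'_measurable [measurable]: "self_normalizer V' E' X' \<in> borel_measurable N"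
  unfolding self_normalizer_def[abs_def] vertex_mean_def local_sum_def[abs_def] by measurable

lemma space_law [simp]: "space law = UNIV" and sets_law: "sets law = sets N"
  by (auto simp: law_def space_PiM)

lemma law_measurable: "f \<in> borel_measurable N \<Longrightarrow> f \<in> borel_measurable law"
  unfolding law_def by (simp only: measurable_distr_eq1)

lemma integral_law: "f \<in> borel_measurable N \<Longrightarrow> (LINT y|law. f y :: real) = (LINT \<omega>|M. f (real_point \<omega>))"
  unfolding law_def by (rule integral_distr[OF real_point_measurable])

lemma integrable_law: "f \<in> borel_measurable N \<Longrightarrow> integrable law (f :: _ \<Rightarrow> real) \<longleftrightarrow> integrable M (\<lambda>\<omega>. f (real_point \<omega>))"
  unfolding law_def by (rule integrable_distr_eq[OF real_point_measurable])

lemma nn_integral_law: "f \<in> borel_measurable N \<Longrightarrow> (\<integral>\<^sup>+y. f y \<partial>law) = (\<integral>\<^sup>+\<omega>. f (real_point \<omega>) \<partial>M)"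
  unfolding law_def by (rule nn_integral_distr[OF real_point_measurable]) (simp only: measurable_distr_eq1)

lemma prob_space_law: "prob_space law"
  unfolding law_def by (rule prob_space_distr[OF real_point_measurable])

lemma variance_law: "prob_space.variance law (total_sum V' X') = variance (total_sum V X)"
  by (subst integral_law, measurable) (simp add: integral_law total_sum_transfer)

lemma sd_transfer: "sd law (total_sum V' X') = sd M (total_sum V X)"
  by (simp add: sd_def variance_law)

lemma dependency_graph_transfer: "dependency_graph law V' E' X'"
  unfolding dependency_graph_def
proof (intro conjI allI impI)
  show "finite_simple_graph V' E'"
    unfolding finite_simple_graph_def
  proof (intro conjI ballI)
    fix s assume "s \<in> E'"
    then obtain t where t: "t \<in> E" "s = e ` t" by auto
    have "inj_on e t" using inj_on_subset[OF inj_e E_subset[OF t(1)]] .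
    then show "card s = 2" using t finite_graph by (simp add: card_image finite_simple_graph_def)
    show "s \<subseteq> V'" using t E_subset[OF t(1)] e_in by auto
  qed simp
next
  fix \<Gamma> \<Delta> :: "nat set"
  assume sub: "\<Gamma> \<subseteq> V'" "\<Delta> \<subseteq> V'" and disj: "\<Gamma> \<inter> \<Delta> = {}"
    and edge: "\<forall>i\<in>\<Gamma>. \<forall>j\<in>\<Delta>. {i, j} \<notin> E'"
  have bsub: "vertex_of ` \<Gamma> \<subseteq> V" "vertex_of ` \<Delta> \<subseteq> V" using sub vertex_of_in by auto
  have bdisj: "vertex_of ` \<Gamma> \<inter> vertex_of ` \<Delta> = {}"
  proof -
    have "a = b" if "a \<in> \<Gamma>" "b \<in> \<Delta>" "vertex_of a = vertex_of b" for a b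
      using e_vertex_of[of a] e_vertex_of[of b] that sub by (metis subsetD)
    then show ?thesis using disj by fastforce
  qed
  have bedge: "\<forall>i\<in>vertex_of ` \<Gamma>. \<forall>j\<in>vertex_of ` \<Delta>. {i, j} \<notin> E"
  proof (intro ballI)
    fix i j assume "i \<in> vertex_of ` \<Gamma>" "j \<in> vertex_of ` \<Delta>"
    then obtain a b where "a \<in> \<Gamma>" "b \<in> \<Delta>" "i = vertex_of a" "j = vertex_of b" by auto
    then show "{i, j} \<notin> E"
      using edge edge_transfer[of i j] e_vertex_of[of a] e_vertex_of[of b] vertex_of_in[of a] vertex_of_in[of b] sub
      by (metis subsetD)
  qed
  have ind: "indep_var (Pi\<^sub>M (vertex_of ` \<Gamma>) (\<lambda>_. borel)) (\<lambda>\<omega>. \<lambda>i\<in>vertex_of ` \<Gamma>. X i \<omega>)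
      (Pi\<^sub>M (vertex_of ` \<Delta>) (\<lambda>_. borel)) (\<lambda>\<omega>. \<lambda>i\<in>vertex_of ` \<Delta>. X i \<omega>)"
    using dependency_graph bsub bdisj bedge unfolding dependency_graph_def by blast
  let ?f = "\<lambda>\<Gamma> y. \<lambda>m\<in>\<Gamma>. (y (vertex_of m) :: real)"
  have fm: "?f \<Gamma> \<in> measurable (Pi\<^sub>M (vertex_of ` \<Gamma>) (\<lambda>_. borel)) (Pi\<^sub>M \<Gamma> (\<lambda>_. borel))" for \<Gamma> :: "nat set"
    by (intro measurable_restrict measurable_component_singleton) auto
  have eq: "?f \<Gamma> \<circ> (\<lambda>\<omega>. \<lambda>i\<in>vertex_of ` \<Gamma>. X i \<omega>) = (\<lambda>y. \<lambda>m\<in>\<Gamma>. y m) \<circ> real_point" if "\<Gamma> \<subseteq> V'" for \<Gamma>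
    using that by (auto simp: fun_eq_iff restrict_def real_point_def)
  have rm: "(\<lambda>y. \<lambda>m\<in>\<Gamma>. y m) \<in> measurable N (Pi\<^sub>M \<Gamma> (\<lambda>_. borel))" for \<Gamma> :: "nat set"
    by (intro measurable_restrict measurable_component_singleton) auto
  have "indep_var (Pi\<^sub>M \<Gamma> (\<lambda>_. borel)) ((\<lambda>y. \<lambda>m\<in>\<Gamma>. y m) \<circ> real_point)
      (Pi\<^sub>M \<Delta> (\<lambda>_. borel)) ((\<lambda>y. \<lambda>m\<in>\<Delta>. y m) \<circ> real_point)"
    using indep_var_compose[OF ind fm fm] unfolding eq[OF sub(1)] eq[OF sub(2)] .
  then show "prob_space.indep_var law (Pi\<^sub>M \<Gamma> (\<lambda>_. borel)) (\<lambda>y. \<lambda>m\<in>\<Gamma>. y m)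
      (Pi\<^sub>M \<Delta> (\<lambda>_. borel)) (\<lambda>y. \<lambda>m\<in>\<Delta>. y m)"
    unfolding law_def by (intro indep_var_distr real_point_measurable rm)
qed

lemma centred_dependent_sum_transfer: "centred_dependent_sum law V' E' X'"
proof -
  interpret L: prob_space law by (rule prob_space_law)
  show ?thesis
  proof unfold_locales
    show "dependency_graph law V' E' X'" by (rule dependency_graph_transfer)
    show "1 \<le> max_degree V' E'" using max_degree by (simp add: max_degree_transfer)
    fix m assume m: "m \<in> V'"
    have eq: "real_point \<omega> m = X (vertex_of m) \<omega>" for \<omega> using m by (simp add: real_point_def)
    show "integrable law (X' m)" using integrable[OF vertex_of_in[OF m]] by (simp add: integrable_law eq)
    show "L.expectation (X' m) = 0" using centred[OF vertex_of_in[OF m]] by (simp add: integral_law eq)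
  next
    show "integrable law (\<lambda>y. (total_sum V' X' y)\<^sup>2)"
      using square_integrable by (subst integrable_law, measurable) (simp add: total_sum_transfer)
    show "0 < L.variance (total_sum V' X')" using variance_pos by (simp add: variance_law)
  qed
qed

lemma kolmogorov_distance_transfer:
  assumes [measurable]: "f \<in> borel_measurable N"
  shows "kolmogorov_distance law f = kolmogorov_distance M (\<lambda>\<omega>. f (real_point \<omega>))"
proof -
  have "measure law {y \<in> space law. f y \<le> z} = measure M {\<omega> \<in> space M. f (real_point \<omega>) \<le> z}" for z
  proof -
    have s: "{y \<in> space N. f y \<le> z} \<in> sets N" by measurable
    have "measure law {y \<in> space law. f y \<le> z} = measure M (real_point -` {y \<in> space N. f y \<le> z} \<inter> space M)"
      unfolding law_def space_distr by (rule measure_distr[OF real_point_measurable s])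
    also have "real_point -` {y \<in> space N. f y \<le> z} \<inter> space M = {\<omega> \<in> space M. f (real_point \<omega>) \<le> z}"
      by (auto simp: space_PiM)
    finally show ?thesis .
  qed
  then show ?thesis by (simp add: kolmogorov_distance_def)
qed

lemma Lp_norm_transfer: "i \<in> V \<Longrightarrow> Lp_norm p law (X' (e i)) = Lp_norm p M (X i)"
  unfolding Lp_norm_def by (subst nn_integral_law) (auto simp: real_point_e)

lemma lambda1_transfer: "lambda1 law V' E' X' = lambda1 M V E X"
proof -
  have "(\<integral>\<^sup>+y. ennreal (\<bar>X' (e i) y\<bar>\<^sup>2) \<partial>law) = (\<integral>\<^sup>+\<omega>. ennreal (\<bar>X i \<omega>\<bar>\<^sup>2) \<partial>M)" if "i \<in> V" for i
    using that by (subst nn_integral_law) (auto simp: real_point_e)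
  then show ?thesis
    unfolding lambda1_def sd_transfer max_degree_transfer sum_transfer by (simp cong: sum.cong)
qed

lemma Lp_sum_transfer:
  "(\<Sum>m\<in>V'. Lp_norm p law (X' m) ^ q / s) = (\<Sum>i\<in>V. Lp_norm p M (X i) ^ q / s)"
  unfolding sum_transfer by (intro sum.cong refl) (simp add: Lp_norm_transfer)

lemma normal_approximation_transfer:
  assumes "normal_approximation_bound C law V' E' X'"
  shows "normal_approximation_bound C M V E X"
proof -
  have "kolmogorov_distance law (\<lambda>y. total_sum V' X' y / sd M (total_sum V X))
      = kolmogorov_distance M (\<lambda>\<omega>. total_sum V X \<omega> / sd M (total_sum V X))"
    by (subst kolmogorov_distance_transfer, measurable) (simp add: total_sum_transfer)
  then show ?thesis
    using assms unfolding normal_approximation_bound_def Let_def max_degree_transfer sd_transfer Lp_sum_transfer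
    by simp
qed

lemma self_normalized_transfer:
  assumes R: "self_normalized M V E X R"
    and bound: "\<And>T. self_normalized law V' E' X' T \<Longrightarrow> self_normalized_bound C law V' E' X' T"
  shows "self_normalized_bound C M V E X R"
proof -
  (* a version of the quotient at every point of the new space, whose composition with
     real_point is the given version R *)
  define T where "T y = (if self_normalizer V' E' X' y \<noteq> 0
    then total_sum V' X' y / self_normalizer V' E' X' y else X' n y)" for y
  have Tm: "T \<in> borel_measurable N" unfolding T_def by measurable
  have "self_normalized law V' E' X' T"
    unfolding self_normalized_def using law_measurable[OF Tm] by (simp add: T_def)
  note b = bound[OF this]
  have "kolmogorov_distance law T = kolmogorov_distance M (\<lambda>\<omega>. T (real_point \<omega>))"
    by (rule kolmogorov_distance_transfer[OF Tm])
  also have "\<dots> = kolmogorov_distance M R"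
  proof -
    have "T (real_point \<omega>) = R \<omega>" if "\<omega> \<in> space M" for \<omega>
      using R that by (simp add: T_def self_normalizer_transfer total_sum_transfer real_point_n self_normalized_def)
    then have "{\<omega> \<in> space M. T (real_point \<omega>) \<le> z} = {\<omega> \<in> space M. R \<omega> \<le> z}" for z by auto
    then show ?thesis by (simp add: kolmogorov_distance_def)
  qed
  finally show ?thesis
    using b unfolding self_normalized_bound_def Let_def max_degree_transfer sd_transfer Lp_sum_transfer lambda1_transfer
    by simp
qed

end

theorem theorem3p1:
  shows "0 < absolute_constant \<and>
    (\<forall>(M :: 'a measure) (V :: 'v set) (E :: 'v set set) (X :: 'v \<Rightarrow> 'a \<Rightarrow> real).
       centred_dependent_sum M V E X \<longrightarrow>
         normal_approximation_bound absolute_constant M V E X \<and>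
         (\<forall>W. self_normalized M V E X W \<longrightarrow>
            self_normalized_bound absolute_constant M V E X W))"
proof -
  let ?P = "\<lambda>C. 0 < C \<and>
        (\<forall>(M :: (nat \<Rightarrow> real) measure) (V :: nat set) E X.
           centred_dependent_sum M V E X \<longrightarrow>
             normal_approximation_bound C M V E X \<and>
             (\<forall>W. self_normalized M V E X W \<longrightarrow> self_normalized_bound C M V E X W))"
  (* the bounds for arbitrary types, used for the pair of types in the definition *)
  have "?P 12000000"
    by (auto intro: centred_dependent_sum.normal_approximation
        centred_dependent_sum.self_normalized_approximation)
  then have C: "?P absolute_constant"
    unfolding absolute_constant_def by (rule someI)
  have "normal_approximation_bound absolute_constant M V E X \<and>
         (\<forall>W. self_normalized M V E X W \<longrightarrow> self_normalized_bound absolute_constant M V E X W)"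
    if sum: "centred_dependent_sum M V E X"
    for M :: "'a measure" and V :: "'v set" and E X
  proof -
    interpret centred_dependent_sum M V E X by (rule sum)
    obtain e where e: "bij_betw e V {0..<card V}"
      using ex_bij_betw_finite_nat[OF finite_V] by blast
    have realise: "realisation M V E X R e" if "R \<in> borel_measurable M" for R
      using that e by unfold_locales
    show ?thesis
    proof (intro conjI allI impI)
      interpret R: realisation M V E X "\<lambda>_. 0" e by (rule realise) simp
      show "normal_approximation_bound absolute_constant M V E X"
        using C R.centred_dependent_sum_transfer by (intro R.normal_approximation_transfer) blast
    next
      fix W assume W: "self_normalized M V E X W"
      then interpret R: realisation M V E X W e
        by (intro realise) (simp add: self_normalized_def)
      show "self_normalized_bound absolute_constant M V E X W"
        using C R.centred_dependent_sum_transfer by (intro R.self_normalized_transfer[OF W]) blast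
    qed
  qed
  with C show ?thesis by blast
qed

end
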